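(* Let $M\ge 4$ and let $p\ge 0$ be an integer with $4(p+1)\le M$. Then the element (the "full chain") $$\mathcal F_{\mathcal G_{0\prec p}}=\Phi_{\mathcal G_p}\,\Phi_{\mathcal G_{p-1}}\cdots\Phi_{\mathcal G_0},\qquad \Phi_{\mathcal G_k}=\exp\!\left(H^k_{1-2}\otimes\sigma^k_G\right)\cdot\exp\!\left(I^{1\otimes 2}_{M-4k}\,\bigl(1\otimes e^{-\frac12\sigma^k_{1+2}}\bigr)\right)\cdot\exp\!\left(H^k_{1+2}\otimes\sigma^k_{1+2}\right)$$ of $\widehat U_2$ is a twisting element for $U(so(M))$, that is, $$\left(\mathcal F\right)_{12}(\Delta\otimes\mathrm{id})\mathcal F=\left(\mathcal F\right)_{23}(\mathrm{id}\otimes\Delta)\mathcal F,\qquad(\epsilon\otimes\mathrm{id})\mathcal F=(\mathrm{id}\otimes\epsilon)\mathcal F=1\qquad\text{for }\mathcal F=\mathcal F_{\mathcal G_{0\prec p}}.$$ Consequently $\mathcal R_{\mathcal G_{0\prec p}}=\left(\mathcal F_{\mathcal G_{0\prec p}}\right)_{21}\left(\mathcal F_{\mathcal G_{0\prec p}}\right)^{-1}$ is a triangular universal $R$-matrix for the twisted coproduct $\Delta_{\mathcal F}=\mathcal F\Delta\mathcal F^{-1}$, $\mathcal F=\mathcal F_{\mathcal G_{0\prec p}}$.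
   Context: All Lie algebras are over $\mathbb C$. Let $N=[M/2]$, let $\mathcal E_{i,j}$ be the $M\times M$ matrix units, $A_{i,j}=\mathcal E_{i,j}-\mathcal E_{M+1-j,M+1-i}$, and realize $so(M)$ as the span of the $A_{i,j}$, $1\le i,j\le M$. Put $H_i=\frac12(\mathcal E_{i,i}-\mathcal E_{M+1-i,M+1-i})$ for $1\le i\le N$, and for $1\le i<j\le N$ put $E_{i-j}=-A_{i,j}$, $E_{i+j}=-A_{i,M+1-j}$; if $M=2N+1$ is odd put also $E_i=-A_{i,N+1}$ for $1\le i\le N$. For $k\ge 0$ with $4(k+1)\le M$ let $a=2k+1$, $b=2k+2$, and define $H^k_{1\pm2}=H_a\pm H_b$, $E^k_{1+2}=E_{a+b}$, $E^k_{1-2}=E_{a-b}$, $\sigma^k_{1+2}=\ln(1+E^k_{1+2})$, $$I^{1\otimes2}_{M-4k}=\delta\,E_a\otimes E_b+\sum_{l=2k+3}^{N}\left(E_{a+l}\otimes E_{b-l}+E_{a-l}\otimes E_{b+l}\right),\qquad I^1_{M-4k}=\tfrac{\delta}{2}E_a^2+\sum_{l=2k+3}^{N}E_{a+l}E_{a-l},$$ where $\delta=1$ if $M$ is odd and $\delta=0$ (term absent) if $M$ is even. Finally $G^k_{1-2}=E^k_{1-2}-I^1_{M-4k}\in U(so(M))$ and $\sigma^k_G=\ln(1+G^k_{1-2})$. $U(so(M))$ carries its usual Hopf structure ($\Delta(x)=x\otimes1+1\otimes x$, $\epsilon(x)=0$ for $x\in so(M)$). Logarithms and exponentials denote their power series,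 in the following completion. Grade $so(M)$ by the eigenvalues of $\mathrm{ad}\bigl(\sum_{i}2(N+1-i)H_i\bigr)$ (all positive root vectors above have positive degree, $H_i$ has degree $0$); this grades $U(so(M))^{\otimes n}$ by total degree $d\in\mathbb Z$, and $\widehat U_n=\bigcup_{d_0\in\mathbb Z}\prod_{d\ge d_0}\left(U(so(M))^{\otimes n}\right)_d$ is an algebra, to which $\Delta$, $\epsilon$ (applied in any tensor factor) extend degreewise. For $\mathcal F\in\widehat U_2$, $\mathcal F_{12}=\mathcal F\otimes1$, $\mathcal F_{23}=1\otimes\mathcal F$, and $\mathcal F_{21}$ is $\mathcal F$ with its two tensor factors interchanged. An $R$-matrix is triangular for a coproduct $\Delta_{\mathcal F}$ if it is an invertible element satisfying $\mathcal R\Delta_{\mathcal F}=\Delta_{\mathcal F}^{op}\mathcal R$, the quasitriangularity relations $(\Delta_{\mathcal F}\otimes\mathrm{id})\mathcal R=\mathcal R_{13}\mathcal R_{23}$, $(\mathrm{id}\otimes\Delta_{\mathcal F})\mathcal R=\mathcal R_{13}\mathcal R_{12}$, and $\mathcal R_{21}\mathcal R=1$. *)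

theory Defs
  imports
    "HOL-Analysis.Analysis"
    "HOL-Library.Poly_Mapping"
    "HOL-Computational_Algebra.Formal_Laurent_Series"
begin

unbundle Formal_Laurent_Series.fps_syntax

section \<open>Complex vector spaces, algebras and Lie algebras\<close>

class scaleC =
  fixes scaleC :: "complex \<Rightarrow> 'a \<Rightarrow> 'a"  (infixr "*\<^sub>C" 75)

class complex_vector = scaleC + ab_group_add +
  assumes scaleC_add_right: "c *\<^sub>C (x + y) = c *\<^sub>C x + c *\<^sub>C y"
    and scaleC_add_left: "(c + d) *\<^sub>C x = c *\<^sub>C x + d *\<^sub>C x"
    and scaleC_scaleC: "c *\<^sub>C d *\<^sub>C x = (c * d) *\<^sub>C x"
    and scaleC_one: "1 *\<^sub>C x = x"

class complex_algebra_1 = complex_vector + ring_1 +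
  assumes mult_scaleC_left: "(c *\<^sub>C x) * y = c *\<^sub>C (x * y)"
    and mult_scaleC_right: "x * (c *\<^sub>C y) = c *\<^sub>C (x * y)"

class complex_lie_algebra = complex_vector +
  fixes lie :: "'a \<Rightarrow> 'a \<Rightarrow> 'a"
  assumes lie_add_left: "lie (x + y) z = lie x z + lie y z"
    and lie_add_right: "lie x (y + z) = lie x y + lie x z"
    and lie_scaleC_left: "lie (c *\<^sub>C x) y = c *\<^sub>C lie x y"
    and lie_scaleC_right: "lie x (c *\<^sub>C y) = c *\<^sub>C lie x y"
    and lie_self: "lie x x = 0"
    and lie_jacobi: "lie x (lie y z) + lie y (lie z x) + lie z (lie x y) = 0"

text \<open>\<open>homog d\<close> is the homogeneous component of degree \<open>d\<close>; the classes impose no axioms on it.\<close>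

class graded_algebra = complex_algebra_1 +
  fixes homog :: "int \<Rightarrow> 'a set"

class graded_lie_algebra = complex_lie_algebra +
  fixes lie_homog :: "int \<Rightarrow> 'a set"

global_interpretation cvec: vector_space "scaleC :: complex \<Rightarrow> 'a \<Rightarrow> 'a::complex_vector"
  by unfold_locales
    (simp_all add: scaleC_add_right scaleC_add_left scaleC_scaleC scaleC_one)

abbreviation cspan :: "'a::complex_vector set \<Rightarrow> 'a set"
  where "cspan \<equiv> cvec.span"

abbreviation clinear :: "('a::complex_vector \<Rightarrow> 'b::complex_vector) \<Rightarrow> bool"
  where "clinear \<equiv> Vector_Spaces.linear scaleC scaleC"

instantiation complex :: complex_algebra_1
begin
definition scaleC_complex :: "complex \<Rightarrow> complex \<Rightarrow> complex"
  where "scaleC_complex = (*)"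
instance
  by standard (simp_all add: scaleC_complex_def algebra_simps)
end

instantiation vec :: (complex_vector, finite) complex_vector
begin
definition scaleC_vec :: "complex \<Rightarrow> ('a, 'b) vec \<Rightarrow> ('a, 'b) vec"
  where "scaleC_vec c v = (\<chi> i. c *\<^sub>C v $ i)"
instance
  by standard (simp_all add: scaleC_vec_def vec_eq_iff
      scaleC_add_right scaleC_add_left scaleC_scaleC scaleC_one)
end

lemma clinearI:
  assumes "\<And>x y. f (x + y) = f x + f y" "\<And>c x. f (c *\<^sub>C x) = c *\<^sub>C f x"
  shows "clinear f"
  by unfold_locales (simp_all add: assms)

lemma clinear_add: "clinear f \<Longrightarrow> f (x + y) = f x + f y"
  by (simp add: linear_iff_module_hom module_hom.add)

lemma clinear_scaleC: "clinear f \<Longrightarrow> f (c *\<^sub>C x) = c *\<^sub>C f x"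
  by (simp add: linear_iff_module_hom module_hom.scale)

lemma clinear_diff: "clinear f \<Longrightarrow> f (x - y) = f x - f y"
  by (simp add: linear_iff_module_hom module_hom.diff)

lemma clinear_zero: "clinear f \<Longrightarrow> f 0 = 0"
  by (simp add: linear_iff_module_hom module_hom.zero)

lemma clinear_span_eq_0:
  assumes "clinear f" "\<And>x. x \<in> S \<Longrightarrow> f x = 0" "x \<in> cspan S"
  shows "f x = 0"
  using assms(3)
  by (induction rule: cvec.span_induct_alt)
    (simp_all add: assms(1,2) clinear_add clinear_scaleC clinear_zero)

subsection \<open>Monoid algebras\<close>

instantiation poly_mapping :: (type, complex_vector) complex_vector
begin
lift_definition scaleC_poly_mapping :: "complex \<Rightarrow> ('a \<Rightarrow>\<^sub>0 'b) \<Rightarrow> ('a \<Rightarrow>\<^sub>0 'b)"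
  is "\<lambda>c f k. c *\<^sub>C f k"
  by (erule rev_finite_subset) auto
instance
  by (standard; transfer)
    (simp_all add: fun_eq_iff scaleC_add_right scaleC_add_left scaleC_scaleC scaleC_one)
end

lemma lookup_scaleC [simp]: "Poly_Mapping.lookup (c *\<^sub>C p) k = c *\<^sub>C Poly_Mapping.lookup p k"
  by transfer simp

lemma scaleC_single: "c *\<^sub>C Poly_Mapping.single k x = Poly_Mapping.single k (c *\<^sub>C x)"
  by (rule poly_mapping_eqI) (simp add: lookup_single when_def)

lemma poly_mapping_add_induct [case_names zero single add]:
  fixes p :: "'a \<Rightarrow>\<^sub>0 'b::comm_monoid_add"
  assumes "P 0" "\<And>k c. P (Poly_Mapping.single k c)" "\<And>p q. P p \<Longrightarrow> P q \<Longrightarrow> P (p + q)"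
  shows "P p"
proof (induction p rule: update_induct)
  case const
  show ?case by fact
next
  case (update p k c)
  have "Poly_Mapping.update k c p = p + Poly_Mapping.single k c"
    using update(1)
    by (intro poly_mapping_eqI)
      (auto simp: lookup_update lookup_add lookup_single when_def in_keys_iff)
  then show ?case using update assms by simp
qed

instance poly_mapping :: (monoid_add, complex_algebra_1) complex_algebra_1
proof
  fix c :: complex and p q :: "'a \<Rightarrow>\<^sub>0 'b"
  show "(c *\<^sub>C p) * q = c *\<^sub>C (p * q)"
  proof (induction p rule: poly_mapping_add_induct)
    case (single k a)
    then show ?case
      by (induction q rule: poly_mapping_add_induct)
        (simp_all add: scaleC_single mult_single mult_scaleC_left distrib_left scaleC_add_right)
  qed (simp_all add: distrib_right scaleC_add_right)
  show "p * (c *\<^sub>C q) = c *\<^sub>C (p * q)"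
  proof (induction p rule: poly_mapping_add_induct)
    case (single k a)
    then show ?case
      by (induction q rule: poly_mapping_add_induct)
        (simp_all add: scaleC_single mult_single mult_scaleC_right distrib_left scaleC_add_right)
  qed (simp_all add: distrib_right scaleC_add_right)
qed

definition lin_ext :: "('k \<Rightarrow> 'v) \<Rightarrow> ('k \<Rightarrow>\<^sub>0 complex) \<Rightarrow> 'v::complex_vector"
  where "lin_ext f p = (\<Sum>k\<in>Poly_Mapping.keys p. Poly_Mapping.lookup p k *\<^sub>C f k)"

lemma lin_ext_superset:
  assumes "finite S" "Poly_Mapping.keys p \<subseteq> S"
  shows "lin_ext f p = (\<Sum>k\<in>S. Poly_Mapping.lookup p k *\<^sub>C f k)"
  unfolding lin_ext_def
  by (rule sum.mono_neutral_left) (use assms in \<open>auto simp: in_keys_iff\<close>)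

lemma clinear_lin_ext: "clinear (lin_ext f)"
proof (rule clinearI)
  fix p q :: "'a \<Rightarrow>\<^sub>0 complex"
  let ?S = "Poly_Mapping.keys p \<union> Poly_Mapping.keys q"
  have "Poly_Mapping.keys (p + q) \<subseteq> ?S" by (rule Poly_Mapping.keys_add)
  then show "lin_ext f (p + q) = lin_ext f p + lin_ext f q"
    by (simp add: lin_ext_superset[of ?S] lookup_add scaleC_add_left sum.distrib)
next
  fix c and p :: "'a \<Rightarrow>\<^sub>0 complex"
  have "Poly_Mapping.keys (c *\<^sub>C p) \<subseteq> Poly_Mapping.keys p" by (auto simp: in_keys_iff)
  then show "lin_ext f (c *\<^sub>C p) = c *\<^sub>C lin_ext f p"
    by (simp add: lin_ext_superset[of "Poly_Mapping.keys p"] scaleC_scaleC cvec.scale_sum_right scaleC_complex_def)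
qed

lemma lin_ext_single: "lin_ext f (Poly_Mapping.single k c) = c *\<^sub>C f k"
  by (cases "c = 0") (simp_all add: lin_ext_def)

lemmas lin_ext_simps =
  lin_ext_single clinear_add[OF clinear_lin_ext] clinear_scaleC[OF clinear_lin_ext]
  clinear_diff[OF clinear_lin_ext] clinear_zero[OF clinear_lin_ext]

lemma lin_ext_mult:
  fixes f :: "'k::monoid_add \<Rightarrow> 'v::complex_algebra_1"
  assumes "\<And>j k. f (j + k) = f j * f k"
  shows "lin_ext f (p * q) = lin_ext f p * lin_ext f q"
proof (induction p rule: poly_mapping_add_induct)
  case (single k a)
  then show ?case
    by (induction q rule: poly_mapping_add_induct)
      (simp_all add: lin_ext_simps mult_single assms mult_scaleC_left mult_scaleC_right
        scaleC_scaleC distrib_left)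
qed (simp_all add: lin_ext_simps distrib_right)

section \<open>Universal enveloping algebras\<close>

datatype 'g fword = Fword (letters: "'g list")

instantiation fword :: (type) monoid_add
begin
definition "0 = Fword []"
definition "v + w = Fword (letters v @ letters w)"
instance
  by standard (simp_all add: zero_fword_def plus_fword_def)
end

text \<open>
  The complex monoid algebra of \<^typ>\<open>'g fword\<close> is the free associative algebra on the
  set \<^typ>\<open>'g\<close>.  Modulo the first two families of relations below it is the tensor
  algebra of the vector space \<^typ>\<open>'g\<close>.
\<close>

definition letter :: "'g \<Rightarrow> 'g fword \<Rightarrow>\<^sub>0 complex"
  where "letter x = Poly_Mapping.single (Fword [x]) 1"

inductive_set uea_rels :: "('g::complex_lie_algebra fword \<Rightarrow>\<^sub>0 complex) set"
  where
    add: "letter (x + y) - letter x - letter y \<in> uea_rels"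
  | scaleC: "letter (c *\<^sub>C x) - c *\<^sub>C letter x \<in> uea_rels"
  | lie: "letter x * letter y - letter y * letter x - letter (lie x y) \<in> uea_rels"

definition two_sided_ideal :: "'a::complex_algebra_1 set \<Rightarrow> 'a set"
  where "two_sided_ideal R = cspan {p * r * q | p r q. r \<in> R}"

lemma two_sided_ideal_mult:
  assumes "x \<in> two_sided_ideal R"
  shows "p * x \<in> two_sided_ideal R" "x * p \<in> two_sided_ideal R"
proof -
  show "p * x \<in> two_sided_ideal R"
    using assms unfolding two_sided_ideal_def
  proof (induction rule: cvec.span_induct_alt)
    case (step c x y)
    then obtain a r b where "x = a * r * b" "r \<in> R" by auto
    then have "p * x \<in> {p * r * q | p r q. r \<in> R}"
      by (metis (mono_tags, lifting) mem_Collect_eq mult.assoc)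
    with step show ?case
      by (simp add: distrib_left mult_scaleC_right cvec.span_add cvec.span_scale cvec.span_base)
  qed (simp add: cvec.span_zero)
  show "x * p \<in> two_sided_ideal R"
    using assms unfolding two_sided_ideal_def
  proof (induction rule: cvec.span_induct_alt)
    case (step c x y)
    then obtain a r b where "x = a * r * b" "r \<in> R" by auto
    then have "x * p \<in> {p * r * q | p r q. r \<in> R}"
      by (metis (mono_tags, lifting) mem_Collect_eq mult.assoc)
    with step show ?case
      by (simp add: distrib_right mult_scaleC_left cvec.span_add cvec.span_scale cvec.span_base)
  qed (simp add: cvec.span_zero)
qed

lemma two_sided_ideal_base: "r \<in> R \<Longrightarrow> r \<in> two_sided_ideal R"
  unfolding two_sided_ideal_def
  by (rule cvec.span_base) (metis (mono_tags, lifting) mem_Collect_eq mult_1 mult_1_right)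

lemma subspace_two_sided_ideal: "cvec.subspace (two_sided_ideal R)"
  unfolding two_sided_ideal_def by simp

lemma equivp_subspace:
  fixes I :: "'a::complex_vector set"
  assumes "cvec.subspace I"
  shows "equivp (\<lambda>p q. p - q \<in> I)"
proof (rule equivpI)
  show "reflp (\<lambda>p q. p - q \<in> I)"
    by (simp add: reflp_def cvec.subspace_0[OF assms])
  show "symp (\<lambda>p q. p - q \<in> I)"
    by (rule sympI) (use cvec.subspace_neg[OF assms] in force)
  show "transp (\<lambda>p q. p - q \<in> I)"
    by (rule transpI) (use cvec.subspace_add[OF assms] in force)
qed

lemma subspace_diff_eq_0:
  fixes I :: "'a::complex_vector set"
  shows "cvec.subspace I \<Longrightarrow> p = q \<Longrightarrow> p - q \<in> I"
  by (simp add: cvec.subspace_0)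

lemma subspace_cong:
  fixes I :: "'a::complex_vector set"
  assumes "cvec.subspace I" "p - p' \<in> I"
  shows "- p - - p' \<in> I" "c *\<^sub>C p - c *\<^sub>C p' \<in> I"
    and "q - q' \<in> I \<Longrightarrow> p + q - (p' + q') \<in> I" "q - q' \<in> I \<Longrightarrow> p - q - (p' - q') \<in> I"
proof -
  have "- (p - p') \<in> I" "c *\<^sub>C (p - p') \<in> I"
    using assms by (blast intro: cvec.subspace_neg cvec.subspace_scale)+
  then show "- p - - p' \<in> I" "c *\<^sub>C p - c *\<^sub>C p' \<in> I"
    by (simp_all add: cvec.scale_right_diff_distrib)
  assume "q - q' \<in> I"
  then have "(p - p') + (q - q') \<in> I" "(p - p') - (q - q') \<in> I"
    using assms by (blast intro: cvec.subspace_add cvec.subspace_diff)+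
  then show "p + q - (p' + q') \<in> I" "p - q - (p' - q') \<in> I"
    by (simp_all add: algebra_simps)
qed

definition word_ext :: "('g \<Rightarrow> 'a) \<Rightarrow> 'g fword \<Rightarrow> 'a::monoid_mult"
  where "word_ext f w = prod_list (map f (letters w))"

lemma word_ext_add: "word_ext f (v + w) = word_ext f v * word_ext f w"
  by (simp add: word_ext_def plus_fword_def)

definition lie_hom :: "('g::complex_lie_algebra \<Rightarrow> 'a::complex_algebra_1) \<Rightarrow> bool"
  where "lie_hom f \<longleftrightarrow> clinear f \<and> (\<forall>x y. f (lie x y) = f x * f y - f y * f x)"

lemma lin_ext_uea_ideal:
  assumes "lie_hom f" "p \<in> two_sided_ideal uea_rels"
  shows "lin_ext (word_ext f) p = 0"
proof -
  have letter: "lin_ext (word_ext f) (letter x) = f x" for x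
    by (simp add: letter_def lin_ext_simps word_ext_def scaleC_one)
  have "lin_ext (word_ext f) r = 0" if "r \<in> uea_rels" for r
    using that assms(1) unfolding lie_hom_def
    by cases (auto simp: lin_ext_simps letter lin_ext_mult word_ext_add clinear_add clinear_scaleC)
  then show ?thesis
    using assms(2) unfolding two_sided_ideal_def
    by (elim clinear_span_eq_0[OF clinear_lin_ext, rotated])
      (auto simp: lin_ext_mult word_ext_add)
qed

quotient_type (overloaded) 'g uea = "'g::complex_lie_algebra fword \<Rightarrow>\<^sub>0 complex" /
  "\<lambda>p q. p - q \<in> two_sided_ideal uea_rels"
  by (rule equivp_subspace[OF subspace_two_sided_ideal])

lemma zero_neq_one_uea: "(1 :: 'g::complex_lie_algebra fword \<Rightarrow>\<^sub>0 complex) \<notin> two_sided_ideal uea_rels"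
proof
  assume "(1 :: 'g fword \<Rightarrow>\<^sub>0 complex) \<in> two_sided_ideal uea_rels"
  moreover have "lie_hom (\<lambda>x::'g. 0::complex)"
    by (simp add: lie_hom_def clinearI)
  ultimately have "lin_ext (word_ext (\<lambda>x::'g. 0::complex)) 1 = 0"
    by (rule lin_ext_uea_ideal[rotated])
  then show False
    by (simp add: lin_ext_single word_ext_def zero_fword_def scaleC_complex_def flip: single_one)
qed

instantiation uea :: (complex_lie_algebra) complex_algebra_1
begin
lift_definition zero_uea :: "'a uea" is 0 .
lift_definition one_uea :: "'a uea" is 1 .
lift_definition plus_uea :: "'a uea \<Rightarrow> 'a uea \<Rightarrow> 'a uea" is "(+)"
  by (rule subspace_cong[OF subspace_two_sided_ideal])
lift_definition uminus_uea :: "'a uea \<Rightarrow> 'a uea" is uminus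
  by (rule subspace_cong[OF subspace_two_sided_ideal])
lift_definition minus_uea :: "'a uea \<Rightarrow> 'a uea \<Rightarrow> 'a uea" is "(-)"
  by (rule subspace_cong[OF subspace_two_sided_ideal])
lift_definition scaleC_uea :: "complex \<Rightarrow> 'a uea \<Rightarrow> 'a uea" is scaleC
  by (rule subspace_cong[OF subspace_two_sided_ideal])
lift_definition times_uea :: "'a uea \<Rightarrow> 'a uea \<Rightarrow> 'a uea" is "(*)"
proof -
  fix p p' q q' :: "'a fword \<Rightarrow>\<^sub>0 complex"
  let ?I = "two_sided_ideal uea_rels :: ('a fword \<Rightarrow>\<^sub>0 complex) set"
  assume "p - p' \<in> ?I" "q - q' \<in> ?I"
  then have "p * (q - q') + (p - p') * q' \<in> ?I"
    by (intro cvec.subspace_add[OF subspace_two_sided_ideal] two_sided_ideal_mult)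
  then show "p * q - p' * q' \<in> ?I"
    by (simp add: algebra_simps)
qed
instance
proof
  show "(0::'a uea) \<noteq> 1"
  proof (transfer, rule notI)
    assume "(0 - 1 :: 'a fword \<Rightarrow>\<^sub>0 complex) \<in> two_sided_ideal uea_rels"
    then show False
      using zero_neq_one_uea[where 'g = 'a] cvec.subspace_neg[OF subspace_two_sided_ideal] by force
  qed
qed (transfer, rule subspace_diff_eq_0[OF subspace_two_sided_ideal],
    simp add: distrib_left distrib_right mult.assoc add.assoc add.commute scaleC_add_right
      scaleC_add_left scaleC_scaleC scaleC_one mult_scaleC_left mult_scaleC_right)+
end

lift_definition uea_gen :: "'g::complex_lie_algebra \<Rightarrow> 'g uea" is letter .

text \<open>
  Extension of a Lie algebra homomorphism to the enveloping algebra; for such \<^term>\<open>f\<close> it does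
  not depend on the choice of a representative (lemma \<open>uea_lift_abs\<close>).
\<close>

definition uea_lift :: "('g::complex_lie_algebra \<Rightarrow> 'a) \<Rightarrow> 'g uea \<Rightarrow> 'a::complex_algebra_1"
  where "uea_lift f u = lin_ext (word_ext f) (rep_uea u)"

lemma uea_lift_abs:
  assumes "lie_hom f"
  shows "uea_lift f (abs_uea p) = lin_ext (word_ext f) p"
proof -
  have "rep_uea (abs_uea p) - p \<in> two_sided_ideal uea_rels"
    by (rule Quotient3_rep_abs[OF Quotient3_uea])
      (simp add: cvec.subspace_0[OF subspace_two_sided_ideal])
  from lin_ext_uea_ideal[OF assms this] show ?thesis
    by (simp add: uea_lift_def lin_ext_simps)
qed

lemma uea_abs_cases: "\<exists>p. u = abs_uea p"
  by (induction u rule: uea.abs_induct) blast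

lemma uea_lift_gen:
  assumes "lie_hom f"
  shows "uea_lift f (uea_gen x) = f x"
  by (simp add: uea_gen.abs_eq uea_lift_abs[OF assms] letter_def lin_ext_simps word_ext_def scaleC_one)

lemma uea_lift_mult:
  assumes "lie_hom f"
  shows "uea_lift f (u * v) = uea_lift f u * uea_lift f v"
proof -
  obtain p q where "u = abs_uea p" "v = abs_uea q" using uea_abs_cases by blast
  then show ?thesis
    by (simp add: times_uea.abs_eq uea_lift_abs[OF assms] lin_ext_mult word_ext_add)
qed

lemma uea_lift_one:
  assumes "lie_hom f"
  shows "uea_lift f 1 = 1"
  by (simp add: one_uea.abs_eq uea_lift_abs[OF assms] lin_ext_single word_ext_def zero_fword_def
      scaleC_one flip: single_one)

lemma clinear_uea_lift:
  assumes "lie_hom f"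
  shows "clinear (uea_lift f)"
proof (rule clinearI)
  fix u v :: "'a uea" and c :: complex
  obtain p q where "u = abs_uea p" "v = abs_uea q" using uea_abs_cases by blast
  then show "uea_lift f (u + v) = uea_lift f u + uea_lift f v"
    "uea_lift f (c *\<^sub>C u) = c *\<^sub>C uea_lift f u"
    by (simp_all add: plus_uea.abs_eq scaleC_uea.abs_eq uea_lift_abs[OF assms] lin_ext_simps)
qed

lemma lie_hom_uea_gen: "lie_hom uea_gen"
  unfolding lie_hom_def
proof (intro conjI clinearI allI; transfer)
  fix x y :: 'a and c
  show "letter (x + y) - (letter x + letter y) \<in> two_sided_ideal uea_rels"
    using two_sided_ideal_base[OF uea_rels.add[of x y]] by (simp add: diff_diff_eq)
  show "letter (c *\<^sub>C x) - c *\<^sub>C letter x \<in> two_sided_ideal uea_rels"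
    by (rule two_sided_ideal_base[OF uea_rels.scaleC])
  have "letter x * letter y - letter y * letter x - letter (lie x y) \<in> two_sided_ideal uea_rels"
    by (rule two_sided_ideal_base[OF uea_rels.lie])
  from cvec.subspace_neg[OF subspace_two_sided_ideal this]
  show "letter (lie x y) - (letter x * letter y - letter y * letter x) \<in> two_sided_ideal uea_rels"
    by simp
qed

section \<open>Tensor products of algebras\<close>

text \<open>
  Pairs with componentwise multiplication, written additively because
  \<^typ>\<open>'k \<Rightarrow>\<^sub>0 complex\<close> convolves along an additive monoid.
\<close>

datatype ('a, 'b) tpair = Tpair 'a 'b

instantiation tpair :: (monoid_mult, monoid_mult) monoid_add
begin
definition "0 = Tpair 1 1"
fun plus_tpair :: "('a, 'b) tpair \<Rightarrow> ('a, 'b) tpair \<Rightarrow> ('a, 'b) tpair"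
  where "Tpair a b + Tpair a' b' = Tpair (a * a') (b * b')"
instance
proof
  fix x y z :: "('a, 'b) tpair"
  show "x + y + z = x + (y + z)"
    by (cases x; cases y; cases z) (simp add: mult.assoc)
  show "0 + x = x" "x + 0 = x"
    by (cases x; simp add: zero_tpair_def)+
qed
end

abbreviation tbase :: "'a \<Rightarrow> 'b \<Rightarrow> ('a, 'b) tpair \<Rightarrow>\<^sub>0 complex"
  where "tbase a b \<equiv> Poly_Mapping.single (Tpair a b) 1"

inductive_set tensor_rels :: "(('a::complex_vector, 'b::complex_vector) tpair \<Rightarrow>\<^sub>0 complex) set"
  where
    add_left: "tbase (a + a') b - tbase a b - tbase a' b \<in> tensor_rels"
  | add_right: "tbase a (b + b') - tbase a b - tbase a b' \<in> tensor_rels"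
  | scaleC_left: "tbase (c *\<^sub>C a) b - c *\<^sub>C tbase a b \<in> tensor_rels"
  | scaleC_right: "tbase a (c *\<^sub>C b) - c *\<^sub>C tbase a b \<in> tensor_rels"

definition cbilinear :: "('a::complex_vector \<Rightarrow> 'b::complex_vector \<Rightarrow> 'c::complex_vector) \<Rightarrow> bool"
  where "cbilinear f \<longleftrightarrow> (\<forall>a. clinear (f a)) \<and> (\<forall>b. clinear (\<lambda>a. f a b))"

abbreviation pair_ext :: "('a \<Rightarrow> 'b \<Rightarrow> 'c) \<Rightarrow> ('a, 'b) tpair \<Rightarrow> 'c"
  where "pair_ext f \<equiv> case_tpair f"

lemma lin_ext_tensor_rels:
  assumes "cbilinear f" "p \<in> cspan tensor_rels"
  shows "lin_ext (pair_ext f) p = 0"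
proof (rule clinear_span_eq_0[OF clinear_lin_ext _ assms(2)])
  have "clinear (f a)" "clinear (\<lambda>a. f a b)" for a b
    using assms(1) by (simp_all add: cbilinear_def)
  then have [simp]: "f a (b + b') = f a b + f a b'" "f (a + a') b = f a b + f a' b"
    "f a (c *\<^sub>C b) = c *\<^sub>C f a b" "f (c *\<^sub>C a) b = c *\<^sub>C f a b" for a a' b b' c
    using clinear_add[of "f a"] clinear_add[of "\<lambda>a. f a b"]
      clinear_scaleC[of "f a"] clinear_scaleC[of "\<lambda>a. f a b"] by blast+
  fix r :: "('a, 'b) tpair \<Rightarrow>\<^sub>0 complex"
  assume "r \<in> tensor_rels"
  then show "lin_ext (pair_ext f) r = 0"
    by cases (simp_all add: lin_ext_simps scaleC_one)
qed

lemma tensor_rels_mult: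
  fixes r :: "('a::complex_algebra_1, 'b::complex_algebra_1) tpair \<Rightarrow>\<^sub>0 complex"
  assumes "r \<in> tensor_rels"
  shows "tbase a b * r \<in> tensor_rels" "r * tbase a b \<in> tensor_rels"
proof -
  have *: "tbase a b * tbase a' b' = tbase (a * a') (b * b')" for a a' :: 'a and b b' :: 'b
    by (simp add: mult_single)
  note distribs = * right_diff_distrib left_diff_distrib distrib_left distrib_right
    mult_scaleC_left mult_scaleC_right
  show "tbase a b * r \<in> tensor_rels"
    using assms
  proof cases
    case (add_left x x' y)
    then show ?thesis
      using tensor_rels.add_left[of "a * x" "a * x'" "b * y"] by (simp only: distribs)
  next
    case (add_right x y y')
    then show ?thesis
      using tensor_rels.add_right[of "a * x" "b * y" "b * y'"] by (simp only: distribs)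
  next
    case (scaleC_left c x y)
    then show ?thesis
      using tensor_rels.scaleC_left[of c "a * x" "b * y"] by (simp only: distribs)
  next
    case (scaleC_right x c y)
    then show ?thesis
      using tensor_rels.scaleC_right[of "a * x" c "b * y"] by (simp only: distribs)
  qed
  show "r * tbase a b \<in> tensor_rels"
    using assms
  proof cases
    case (add_left x x' y)
    then show ?thesis
      using tensor_rels.add_left[of "x * a" "x' * a" "y * b"] by (simp only: distribs)
  next
    case (add_right x y y')
    then show ?thesis
      using tensor_rels.add_right[of "x * a" "y * b" "y' * b"] by (simp only: distribs)
  next
    case (scaleC_left c x y)
    then show ?thesis
      using tensor_rels.scaleC_left[of c "x * a" "y * b"] by (simp only: distribs)
  next
    case (scaleC_right x c y)
    then show ?thesis
      using tensor_rels.scaleC_right[of "x * a" c "y * b"] by (simp only: distribs)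
  qed
qed

lemma cspan_tensor_rels_mult:
  fixes r :: "('a::complex_algebra_1, 'b::complex_algebra_1) tpair \<Rightarrow>\<^sub>0 complex"
  assumes "r \<in> cspan tensor_rels"
  shows "p * r \<in> cspan tensor_rels" "r * p \<in> cspan tensor_rels"
proof -
  have base: "tbase a b * r \<in> cspan tensor_rels \<and> r * tbase a b \<in> cspan tensor_rels" for a b
    using assms
  proof (induction rule: cvec.span_induct_alt)
    case (step c x y)
    then show ?case
      using tensor_rels_mult[OF step(1), of a b]
      by (auto simp: distrib_left distrib_right mult_scaleC_left mult_scaleC_right
          intro!: cvec.span_add cvec.span_scale intro: cvec.span_base)
  qed (simp add: cvec.span_zero)
  have "p * r \<in> cspan tensor_rels \<and> r * p \<in> cspan tensor_rels"
  proof (induction p rule: poly_mapping_add_induct)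
    case (single k c)
    obtain a b where "k = Tpair a b" by (cases k)
    then have k: "Poly_Mapping.single k c = c *\<^sub>C tbase a b"
      by (simp add: scaleC_single scaleC_complex_def)
    show ?case
      unfolding k mult_scaleC_left mult_scaleC_right
      using base by (blast intro: cvec.span_scale)
  qed (simp_all add: cvec.span_zero distrib_left distrib_right cvec.span_add)
  then show "p * r \<in> cspan tensor_rels" "r * p \<in> cspan tensor_rels" by auto
qed

quotient_type (overloaded) ('a, 'b) tensor =
  "('a::complex_algebra_1, 'b::complex_algebra_1) tpair \<Rightarrow>\<^sub>0 complex" /
  "\<lambda>p q. p - q \<in> cspan tensor_rels"
  by (rule equivp_subspace[OF cvec.subspace_span])

lemma one_notin_cspan_tensor_rels:
  "(1 :: ('a::complex_algebra_1, 'b::complex_algebra_1) tpair \<Rightarrow>\<^sub>0 complex) \<notin> cspan tensor_rels"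
proof
  assume *: "(1 :: ('a, 'b) tpair \<Rightarrow>\<^sub>0 complex) \<in> cspan tensor_rels"
  have ex: "\<exists>f :: 'c::complex_algebra_1 \<Rightarrow> complex. clinear f \<and> f 1 = 1"
  proof -
    interpret vector_space_pair "scaleC :: complex \<Rightarrow> 'c \<Rightarrow> 'c" "scaleC :: complex \<Rightarrow> complex \<Rightarrow> complex" ..
    have "cvec.independent {1 :: 'c}" by simp
    from linear_independent_extend[OF this, of "\<lambda>_. 1"] show ?thesis by auto
  qed
  obtain f :: "'a \<Rightarrow> complex" where f: "clinear f" "f 1 = 1" using ex by blast
  obtain g :: "'b \<Rightarrow> complex" where g: "clinear g" "g 1 = 1" using ex by blast
  have "cbilinear (\<lambda>a b. f a * g b)"
    unfolding cbilinear_def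
    by (intro conjI allI clinearI)
      (simp_all add: clinear_add[OF f(1)] clinear_scaleC[OF f(1)] clinear_add[OF g(1)]
        clinear_scaleC[OF g(1)] distrib_left distrib_right scaleC_complex_def)
  from lin_ext_tensor_rels[OF this *] show False
    by (simp add: lin_ext_single zero_tpair_def f(2) g(2) scaleC_complex_def flip: single_one)
qed

instantiation tensor :: (complex_algebra_1, complex_algebra_1) complex_algebra_1
begin
lift_definition zero_tensor :: "('a, 'b) tensor" is 0 .
lift_definition one_tensor :: "('a, 'b) tensor" is 1 .
lift_definition plus_tensor :: "('a, 'b) tensor \<Rightarrow> ('a, 'b) tensor \<Rightarrow> ('a, 'b) tensor" is "(+)"
  by (rule subspace_cong[OF cvec.subspace_span])
lift_definition uminus_tensor :: "('a, 'b) tensor \<Rightarrow> ('a, 'b) tensor" is uminus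
  by (rule subspace_cong[OF cvec.subspace_span])
lift_definition minus_tensor :: "('a, 'b) tensor \<Rightarrow> ('a, 'b) tensor \<Rightarrow> ('a, 'b) tensor" is "(-)"
  by (rule subspace_cong[OF cvec.subspace_span])
lift_definition scaleC_tensor :: "complex \<Rightarrow> ('a, 'b) tensor \<Rightarrow> ('a, 'b) tensor" is scaleC
  by (rule subspace_cong[OF cvec.subspace_span])
lift_definition times_tensor :: "('a, 'b) tensor \<Rightarrow> ('a, 'b) tensor \<Rightarrow> ('a, 'b) tensor" is "(*)"
proof -
  fix p p' q q' :: "('a, 'b) tpair \<Rightarrow>\<^sub>0 complex"
  assume "p - p' \<in> cspan tensor_rels" "q - q' \<in> cspan tensor_rels"
  then have "p * (q - q') + (p - p') * q' \<in> cspan tensor_rels"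
    by (intro cvec.span_add cspan_tensor_rels_mult)
  then show "p * q - p' * q' \<in> cspan tensor_rels"
    by (simp add: algebra_simps)
qed
instance
proof
  show "(0::('a, 'b) tensor) \<noteq> 1"
  proof (transfer, rule notI)
    assume "(0 - 1 :: ('a, 'b) tpair \<Rightarrow>\<^sub>0 complex) \<in> cspan tensor_rels"
    then show False
      using one_notin_cspan_tensor_rels[where 'a = 'a and 'b = 'b] cvec.span_neg by force
  qed
qed (transfer, rule subspace_diff_eq_0[OF cvec.subspace_span],
    simp add: distrib_left distrib_right mult.assoc add.assoc add.commute scaleC_add_right
      scaleC_add_left scaleC_scaleC scaleC_one mult_scaleC_left mult_scaleC_right)+
end

lift_definition tens :: "'a::complex_algebra_1 \<Rightarrow> 'b::complex_algebra_1 \<Rightarrow> ('a, 'b) tensor"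
  (infixr "\<otimes>" 75)
  is tbase .

text \<open>
  The linear map on the tensor product induced by a bilinear map \<^term>\<open>f\<close>; for bilinear
  \<^term>\<open>f\<close> it does not depend on the choice of a representative (lemma \<open>tensor_lift_abs\<close>).
\<close>

definition tensor_lift ::
    "('a::complex_algebra_1 \<Rightarrow> 'b::complex_algebra_1 \<Rightarrow> 'c) \<Rightarrow> ('a, 'b) tensor \<Rightarrow> 'c::complex_vector"
  where "tensor_lift f t = lin_ext (pair_ext f) (rep_tensor t)"

lemma tensor_lift_abs:
  assumes "cbilinear f"
  shows "tensor_lift f (abs_tensor p) = lin_ext (pair_ext f) p"
proof -
  have "rep_tensor (abs_tensor p) - p \<in> cspan tensor_rels"
    by (rule Quotient3_rep_abs[OF Quotient3_tensor]) (simp add: cvec.span_zero)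
  from lin_ext_tensor_rels[OF assms this] show ?thesis
    by (simp add: tensor_lift_def lin_ext_simps)
qed

lemma tensor_abs_cases: "\<exists>p. t = abs_tensor p"
  by (induction t rule: tensor.abs_induct) blast

lemma tensor_lift_tens:
  assumes "cbilinear f"
  shows "tensor_lift f (a \<otimes> b) = f a b"
  by (simp add: tens.abs_eq tensor_lift_abs[OF assms] lin_ext_single scaleC_one)

lemma clinear_tensor_lift:
  assumes "cbilinear f"
  shows "clinear (tensor_lift f)"
proof (rule clinearI)
  fix u v :: "('a, 'b) tensor" and c :: complex
  obtain p q where "u = abs_tensor p" "v = abs_tensor q" using tensor_abs_cases by blast
  then show "tensor_lift f (u + v) = tensor_lift f u + tensor_lift f v"
    "tensor_lift f (c *\<^sub>C u) = c *\<^sub>C tensor_lift f u"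
    by (simp_all add: plus_tensor.abs_eq scaleC_tensor.abs_eq tensor_lift_abs[OF assms] lin_ext_simps)
qed

lemma cbilinear_tens: "cbilinear (\<otimes>)"
  unfolding cbilinear_def
proof (intro conjI allI clinearI; transfer)
  fix a a' :: 'a and b b' :: 'b and c
  note base = cvec.span_base[where S = tensor_rels]
  show "tbase a (b + b') - (tbase a b + tbase a b') \<in> cspan tensor_rels"
    using base[OF tensor_rels.add_right[of a b b']] by (simp only: diff_diff_eq)
  show "tbase (a + a') b - (tbase a b + tbase a' b) \<in> cspan tensor_rels"
    using base[OF tensor_rels.add_left[of a a' b]] by (simp only: diff_diff_eq)
  show "tbase a (c *\<^sub>C b) - c *\<^sub>C tbase a b \<in> cspan tensor_rels"
    by (rule base[OF tensor_rels.scaleC_right])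
  show "tbase (c *\<^sub>C a) b - c *\<^sub>C tbase a b \<in> cspan tensor_rels"
    by (rule base[OF tensor_rels.scaleC_left])
qed

lemma tens_mult: "(a \<otimes> b) * (a' \<otimes> b') = (a * a') \<otimes> (b * b')"
  by transfer (simp add: mult_single cvec.span_zero)

lemma tens_one: "1 \<otimes> 1 = 1"
  by transfer (simp add: cvec.span_zero zero_tpair_def flip: single_one)

section \<open>The Hopf algebra structure\<close>

lemma lie_hom_comult:
  "lie_hom (\<lambda>x::'g::complex_lie_algebra. uea_gen x \<otimes> (1 :: 'g uea) + (1 :: 'g uea) \<otimes> uea_gen x)"
proof -
  have gen: "clinear (uea_gen :: 'g \<Rightarrow> 'g uea)"
    "uea_gen (lie x y) = uea_gen x * uea_gen y - uea_gen y * uea_gen x" for x y :: 'g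
    using lie_hom_uea_gen by (auto simp: lie_hom_def)
  have tens: "clinear (\<lambda>a. a \<otimes> (1 :: 'g uea))" "clinear (\<lambda>a. (1 :: 'g uea) \<otimes> (a :: 'g uea))"
    using cbilinear_tens by (auto simp: cbilinear_def)
  show ?thesis
    unfolding lie_hom_def
    by (intro conjI clinearI allI)
      (simp_all add: gen(2) clinear_add[OF gen(1)] clinear_scaleC[OF gen(1)]
        clinear_add[OF tens(1)] clinear_scaleC[OF tens(1)] clinear_diff[OF tens(1)]
        clinear_add[OF tens(2)] clinear_scaleC[OF tens(2)] clinear_diff[OF tens(2)]
        scaleC_add_right distrib_left distrib_right tens_mult)
qed

definition comult :: "'g::complex_lie_algebra uea \<Rightarrow> ('g uea, 'g uea) tensor"
  where "comult = uea_lift (\<lambda>x. uea_gen x \<otimes> 1 + 1 \<otimes> uea_gen x)"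

definition counit :: "'g::complex_lie_algebra uea \<Rightarrow> complex"
  where "counit = uea_lift (\<lambda>x. 0)"

lemma comult_gen: "comult (uea_gen x) = uea_gen x \<otimes> 1 + 1 \<otimes> uea_gen x"
  unfolding comult_def by (rule uea_lift_gen[OF lie_hom_comult])

lemma comult_mult: "comult (u * v) = comult u * comult v"
  unfolding comult_def by (rule uea_lift_mult[OF lie_hom_comult])

lemma comult_one: "comult 1 = 1"
  unfolding comult_def by (rule uea_lift_one[OF lie_hom_comult])

lemma lie_hom_counit: "lie_hom (\<lambda>x. 0 :: complex)"
  by (simp add: lie_hom_def clinearI)

lemma counit_gen: "counit (uea_gen x) = 0"
  unfolding counit_def by (rule uea_lift_gen[OF lie_hom_counit])

lemma counit_mult: "counit (u * v) = counit u * counit v"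
  unfolding counit_def by (rule uea_lift_mult[OF lie_hom_counit])

lemma counit_one: "counit 1 = 1"
  unfolding counit_def by (rule uea_lift_one[OF lie_hom_counit])

type_synonym 'g uea2 = "('g uea, 'g uea) tensor"
type_synonym 'g uea3 = "('g uea2, 'g uea) tensor"

definition tensor_swap :: "('a::complex_algebra_1, 'b::complex_algebra_1) tensor \<Rightarrow> ('b, 'a) tensor"
  where "tensor_swap = tensor_lift (\<lambda>a b. b \<otimes> a)"

definition tensor_assoc ::
    "('a::complex_algebra_1, ('b::complex_algebra_1, 'c::complex_algebra_1) tensor) tensor
      \<Rightarrow> (('a, 'b) tensor, 'c) tensor"
  where "tensor_assoc = tensor_lift (\<lambda>a. tensor_lift (\<lambda>b c. (a \<otimes> b) \<otimes> c))"

definition leg12 :: "'g::complex_lie_algebra uea2 \<Rightarrow> 'g uea3"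
  where "leg12 t = t \<otimes> 1"

definition leg23 :: "'g::complex_lie_algebra uea2 \<Rightarrow> 'g uea3"
  where "leg23 t = tensor_assoc (1 \<otimes> t)"

definition leg13 :: "'g::complex_lie_algebra uea2 \<Rightarrow> 'g uea3"
  where "leg13 = tensor_lift (\<lambda>a b. (a \<otimes> 1) \<otimes> b)"

definition comult_id :: "'g::complex_lie_algebra uea2 \<Rightarrow> 'g uea3"
  where "comult_id = tensor_lift (\<lambda>a b. comult a \<otimes> b)"

definition id_comult :: "'g::complex_lie_algebra uea2 \<Rightarrow> 'g uea3"
  where "id_comult = tensor_lift (\<lambda>a b. tensor_assoc (a \<otimes> comult b))"

definition counit_id :: "'g::complex_lie_algebra uea2 \<Rightarrow> 'g uea"
  where "counit_id = tensor_lift (\<lambda>a b. counit a *\<^sub>C b)"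

definition id_counit :: "'g::complex_lie_algebra uea2 \<Rightarrow> 'g uea"
  where "id_counit = tensor_lift (\<lambda>a b. counit b *\<^sub>C a)"

section \<open>Gradings and completions\<close>

instantiation uea :: (graded_lie_algebra) graded_algebra
begin
definition homog_uea :: "int \<Rightarrow> 'a uea set"
  where "homog_uea d = cspan {prod_list (map uea_gen xs) | xs ds.
    list_all2 (\<lambda>x e. x \<in> lie_homog e) xs ds \<and> sum_list ds = d}"
instance ..
end

instantiation tensor :: (graded_algebra, graded_algebra) graded_algebra
begin
definition homog_tensor :: "int \<Rightarrow> ('a, 'b) tensor set"
  where "homog_tensor d = cspan {a \<otimes> b | a b i j. a \<in> homog i \<and> b \<in> homog j \<and> i + j = d}"
instance ..
end

instantiation fls :: (complex_vector) complex_vector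
begin
lift_definition scaleC_fls :: "complex \<Rightarrow> 'a fls \<Rightarrow> 'a fls"
  is "\<lambda>c f d. c *\<^sub>C f d"
  by (erule MOST_mono) simp
instance
  by (standard; transfer)
    (simp_all add: fun_eq_iff scaleC_add_right scaleC_add_left scaleC_scaleC scaleC_one)
end

text \<open>
  A family \<open>f\<close> of homogeneous elements, bounded below in degree, is represented by the formal
  Laurent series with coefficients \<open>f $$ d\<close>.  The Cauchy product of Laurent series is the product
  of the completion, and their metric topology is that of convergence in every degree.
\<close>

definition completion :: "'a::graded_algebra fls set"
  where "completion = {f. \<forall>d. f $$ d \<in> homog d}"

definition hat :: "'a::graded_algebra \<Rightarrow> 'a fls"
  where "hat u = (THE f. f \<in> completion \<and> finite {d. f $$ d \<noteq> 0} \<and> (\<Sum>d | f $$ d \<noteq> 0. f $$ d) = u)"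

definition hat_map :: "('a::zero \<Rightarrow> 'b::zero) \<Rightarrow> 'a fls \<Rightarrow> 'b fls"
  where "hat_map \<phi> f = Abs_fls (\<lambda>d. \<phi> (f $$ d))"

definition hat_tens ::
    "'a::complex_algebra_1 fls \<Rightarrow> 'b::complex_algebra_1 fls \<Rightarrow> ('a, 'b) tensor fls"
    (infixr "\<otimes>\<^sub>c" 75)
  where "f \<otimes>\<^sub>c g = hat_map (\<lambda>a. a \<otimes> 1) f * hat_map (\<lambda>b. 1 \<otimes> b) g"

definition hat_exp :: "'a::complex_algebra_1 fls \<Rightarrow> 'a fls"
  where "hat_exp x = suminf (\<lambda>n. (1 / fact n) *\<^sub>C x ^ n)"

definition hat_ln1p :: "'a::complex_algebra_1 fls \<Rightarrow> 'a fls"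
  where "hat_ln1p x = suminf (\<lambda>n. ((- 1) ^ n / of_nat (n + 1)) *\<^sub>C x ^ (n + 1))"

definition hat_invertible :: "'a::graded_algebra fls \<Rightarrow> bool"
  where "hat_invertible f \<longleftrightarrow> f \<in> completion \<and> (\<exists>g\<in>completion. f * g = 1 \<and> g * f = 1)"

definition hat_inverse :: "'a::graded_algebra fls \<Rightarrow> 'a fls"
  where "hat_inverse f = (THE g. g \<in> completion \<and> f * g = 1 \<and> g * f = 1)"

section \<open>Twisting elements and triangular R-matrices\<close>

definition twisting_element :: "'g::graded_lie_algebra uea2 fls \<Rightarrow> bool"
  where "twisting_element F \<longleftrightarrow> F \<in> completion
    \<and> hat_map leg12 F * hat_map comult_id F = hat_map leg23 F * hat_map id_comult F
    \<and> hat_map counit_id F = 1 \<and> hat_map id_counit F = 1"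

definition twisted_comult :: "'g::graded_lie_algebra uea2 fls \<Rightarrow> 'g uea fls \<Rightarrow> 'g uea2 fls"
  where "twisted_comult F x = F * hat_map comult x * hat_inverse F"

text \<open>\<open>\<Delta>\<^sub>F \<otimes> id\<close> and \<open>id \<otimes> \<Delta>\<^sub>F\<close> for \<open>\<Delta>\<^sub>F = F \<Delta> F\<inverse>\<close>:\<close>

definition twisted_comult_id :: "'g::graded_lie_algebra uea2 fls \<Rightarrow> 'g uea2 fls \<Rightarrow> 'g uea3 fls"
  where "twisted_comult_id F t =
    hat_map leg12 F * hat_map comult_id t * hat_map leg12 (hat_inverse F)"

definition id_twisted_comult :: "'g::graded_lie_algebra uea2 fls \<Rightarrow> 'g uea2 fls \<Rightarrow> 'g uea3 fls"
  where "id_twisted_comult F t =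
    hat_map leg23 F * hat_map id_comult t * hat_map leg23 (hat_inverse F)"

definition triangular_R_matrix :: "'g::graded_lie_algebra uea2 fls \<Rightarrow> 'g uea2 fls \<Rightarrow> bool"
  where "triangular_R_matrix F R \<longleftrightarrow> hat_invertible R
    \<and> (\<forall>x\<in>completion. R * twisted_comult F x = hat_map tensor_swap (twisted_comult F x) * R)
    \<and> twisted_comult_id F R = hat_map leg13 R * hat_map leg23 R
    \<and> id_twisted_comult F R = hat_map leg13 R * hat_map leg12 R
    \<and> hat_map tensor_swap R * R = 1"

section \<open>The Lie algebra $so(M)$\<close>

text \<open>
  \<open>M = CARD('m)\<close>; \<open>index i\<close> is the \<open>i\<close>-th element of \<^typ>\<open>'m\<close>, for \<open>1 \<le> i \<le> M\<close>.
\<close>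

definition index :: "nat \<Rightarrow> 'm::{finite,linorder}"
  where "index i = sorted_list_of_set UNIV ! (i - 1)"

type_synonym 'm cmat = "((complex, 'm) vec, 'm) vec"

definition mat_unit :: "nat \<Rightarrow> nat \<Rightarrow> 'm::{finite,linorder} cmat"
  where "mat_unit i j = (\<chi> r s. if r = index i \<and> s = index j then 1 else 0)"

definition mat_A :: "nat \<Rightarrow> nat \<Rightarrow> 'm::{finite,linorder} cmat"
  where "mat_A i j = mat_unit i j - mat_unit (CARD('m) + 1 - j) (CARD('m) + 1 - i)"

definition so_set :: "('m::{finite,linorder} cmat) set"
  where "so_set = cspan {mat_A i j | i j. i \<in> {1..CARD('m)} \<and> j \<in> {1..CARD('m)}}"

lemma index_eq_iff:
  assumes "i \<in> {1..CARD('m)}" "j \<in> {1..CARD('m)}"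
  shows "(index i :: 'm::{finite,linorder}) = index j \<longleftrightarrow> i = j"
  using assms unfolding index_def
  by (subst nth_eq_iff_index_eq) (auto simp: length_sorted_list_of_set)

lemma mat_unit_mult:
  assumes "j \<in> {1..CARD('m)}" "k \<in> {1..CARD('m)}"
  shows "(mat_unit i j :: 'm::{finite,linorder} cmat) ** mat_unit k l
    = (if j = k then mat_unit i l else 0)"
proof -
  have "(\<Sum>t\<in>(UNIV :: 'm set). (if r = index i \<and> t = index j then 1 else 0)
        * (if t = index k \<and> s = index l then 1 else 0 :: complex))
      = (if j = k \<and> r = index i \<and> s = index l then 1 else 0)" for r s :: 'm
  proof -
    have "(\<Sum>t\<in>(UNIV :: 'm set). (if r = index i \<and> t = index j then 1 else 0)
        * (if t = index k \<and> s = index l then 1 else 0 :: complex))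
      = (\<Sum>t\<in>(UNIV :: 'm set). if t = index j
          then (if (index j :: 'm) = index k \<and> r = index i \<and> s = index l then 1 else 0) else 0)"
      by (rule sum.cong) auto
    then show ?thesis by (simp add: index_eq_iff[OF assms])
  qed
  then show ?thesis
    by (simp add: vec_eq_iff matrix_matrix_mult_def mat_unit_def)
qed

lemma cmat_mult_simps:
  fixes A B C :: "'m::finite cmat"
  shows "A ** (B + C) = A ** B + A ** C" "(A + B) ** C = A ** C + B ** C"
    "A ** (B - C) = A ** B - A ** C" "(A - B) ** C = A ** C - B ** C"
    "(c *\<^sub>C A) ** B = c *\<^sub>C (A ** B)" "A ** (c *\<^sub>C B) = c *\<^sub>C (A ** B)"
  by (simp_all add: vec_eq_iff matrix_matrix_mult_def scaleC_vec_def scaleC_complex_def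
      sum_distrib_left sum.distrib sum_subtractf algebra_simps)

lemma so_set_commutator:
  assumes "X \<in> (so_set :: ('m::{finite,linorder} cmat) set)" "Y \<in> so_set"
  shows "X ** Y - Y ** X \<in> so_set"
proof -
  let ?M = "CARD('m)"
  let ?S = "{mat_A i j | i j. i \<in> {1..?M} \<and> j \<in> {1..?M}} :: ('m cmat) set"
  have A_in: "mat_A i j \<in> cspan ?S" if "i \<in> {1..?M}" "j \<in> {1..?M}" for i j
    using that by (intro cvec.span_base) auto
  have gens: "mat_A i j ** mat_A k l - mat_A k l ** mat_A i j \<in> cspan ?S"
    if ij: "i \<in> {1..?M}" "j \<in> {1..?M}" and kl: "k \<in> {1..?M}" "l \<in> {1..?M}" for i j k l
  proof -
    define i' j' k' l' where "i' = ?M + 1 - i" and "j' = ?M + 1 - j"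
      and "k' = ?M + 1 - k" and "l' = ?M + 1 - l"
    note p = i'_def j'_def k'_def l'_def
    have ranges: "i' \<in> {1..?M}" "j' \<in> {1..?M}" "k' \<in> {1..?M}" "l' \<in> {1..?M}"
      using ij kl by (auto simp: p)
    have inv: "?M + 1 - i' = i" "?M + 1 - j' = j" "?M + 1 - k' = k" "?M + 1 - l' = l"
      using ij kl by (auto simp: p)
    have eqs: "(i' = l') = (i = l)" "(k' = j') = (j = k)" "(l' = i') = (i = l)"
      "(i' = k) = (i = k')" "(l = j') = (j = l')" "(l = i) = (i = l)" "(k' = i) = (i = k')"
      using ij kl by (auto simp: p)
    have A: "mat_A i j = mat_unit i j - (mat_unit j' i' :: 'm cmat)"
      "mat_A k l = mat_unit k l - (mat_unit l' k' :: 'm cmat)"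
      "mat_A i l = mat_unit i l - (mat_unit l' i' :: 'm cmat)"
      "mat_A k j = mat_unit k j - (mat_unit j' k' :: 'm cmat)"
      "mat_A i k' = mat_unit i k' - (mat_unit k i' :: 'm cmat)"
      "mat_A l' j = mat_unit l' j - (mat_unit j' l :: 'm cmat)"
      by (simp_all only: mat_A_def inv p[symmetric])
    define P Q R T where "P \<longleftrightarrow> j = k" and "Q \<longleftrightarrow> i = l" and "R \<longleftrightarrow> j = l'" and "T \<longleftrightarrow> i = k'"
    note PQRT = P_def[symmetric] Q_def[symmetric] R_def[symmetric] T_def[symmetric]
    have "mat_A i j ** mat_A k l
      = (if P then mat_unit i l else 0) - (if R then mat_unit i k' else 0)
        - ((if T then mat_unit j' l else 0) - (if Q then mat_unit j' k' else (0 :: 'm cmat)))"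
      unfolding A cmat_mult_simps
      by (simp only: mat_unit_mult[OF ij(2) kl(1)] mat_unit_mult[OF ij(2) ranges(4)]
          mat_unit_mult[OF ranges(1) kl(1)] mat_unit_mult[OF ranges(1) ranges(4)] eqs PQRT, simp add: algebra_simps)
    moreover have "mat_A k l ** mat_A i j
      = (if Q then mat_unit k j else 0) - (if R then mat_unit k i' else 0)
        - ((if T then mat_unit l' j else 0) - (if P then mat_unit l' i' else (0 :: 'm cmat)))"
      unfolding A cmat_mult_simps
      by (simp only: mat_unit_mult[OF kl(2) ij(1)] mat_unit_mult[OF kl(2) ranges(2)]
          mat_unit_mult[OF ranges(3) ij(1)] mat_unit_mult[OF ranges(3) ranges(2)] eqs PQRT, simp add: algebra_simps)
    ultimately have "mat_A i j ** mat_A k l - mat_A k l ** mat_A i j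
      = (if P then mat_A i l else 0) - (if Q then mat_A k j else 0)
        - (if R then mat_A i k' else 0) + (if T then mat_A l' j else (0 :: 'm cmat))"
      unfolding A by simp
    also have "\<dots> \<in> cspan ?S"
      using A_in[OF ij(1) kl(2)] A_in[OF kl(1) ij(2)] A_in[OF ij(1) ranges(3)]
        A_in[OF ranges(4) ij(2)] cvec.span_zero[of ?S]
      by (intro cvec.span_add cvec.span_diff; split if_split; blast)
    finally show ?thesis .
  qed
  have left: "X ** mat_A k l - mat_A k l ** X \<in> cspan ?S"
    if kl: "k \<in> {1..?M}" "l \<in> {1..?M}" for k l
    using assms(1) unfolding so_set_def
  proof (induction rule: cvec.span_induct_alt)
    case (step c A B)
    then have "c *\<^sub>C (A ** mat_A k l - mat_A k l ** A) + (B ** mat_A k l - mat_A k l ** B) \<in> cspan ?S"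
      using gens[OF _ _ kl] by (auto intro!: cvec.span_add cvec.span_scale)
    then show ?case
      by (simp add: cmat_mult_simps cvec.scale_right_diff_distrib
          algebra_simps)
  qed (simp add: cvec.span_zero)
  show ?thesis
    using assms(2) unfolding so_set_def
  proof (induction rule: cvec.span_induct_alt)
    case (step c A B)
    then have "c *\<^sub>C (X ** A - A ** X) + (X ** B - B ** X) \<in> cspan ?S"
      using left by (auto intro!: cvec.span_add cvec.span_scale)
    then show ?case
      by (simp add: cmat_mult_simps cvec.scale_right_diff_distrib
          algebra_simps)
  qed (simp add: cvec.span_zero)
qed

typedef (overloaded) 'm so = "so_set :: ('m::{finite,linorder} cmat) set"
  unfolding so_set_def using cvec.span_zero by blast

setup_lifting type_definition_so

instantiation so :: ("{finite,linorder}") complex_lie_algebra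
begin
lift_definition zero_so :: "'a so" is 0
  by (simp add: so_set_def cvec.span_zero)
lift_definition plus_so :: "'a so \<Rightarrow> 'a so \<Rightarrow> 'a so" is "(+)"
  by (simp add: so_set_def cvec.span_add)
lift_definition uminus_so :: "'a so \<Rightarrow> 'a so" is uminus
  by (simp add: so_set_def cvec.span_neg)
lift_definition minus_so :: "'a so \<Rightarrow> 'a so \<Rightarrow> 'a so" is "(-)"
  by (simp add: so_set_def cvec.span_diff)
lift_definition scaleC_so :: "complex \<Rightarrow> 'a so \<Rightarrow> 'a so" is scaleC
  by (simp add: so_set_def cvec.span_scale)
lift_definition lie_so :: "'a so \<Rightarrow> 'a so \<Rightarrow> 'a so" is "\<lambda>X Y. X ** Y - Y ** X"
  by (rule so_set_commutator)
instance
proof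
  fix x y z :: "'a so" and c d :: complex
  show "x + y + z = x + (y + z)" by transfer (rule add.assoc)
  show "x + y = y + x" by transfer (rule add.commute)
  show "0 + x = x" by transfer simp
  show "- x + x = 0" by transfer simp
  show "x - y = x + - y" by transfer simp
  show "c *\<^sub>C (x + y) = c *\<^sub>C x + c *\<^sub>C y" by transfer (rule scaleC_add_right)
  show "(c + d) *\<^sub>C x = c *\<^sub>C x + d *\<^sub>C x" by transfer (rule scaleC_add_left)
  show "c *\<^sub>C d *\<^sub>C x = (c * d) *\<^sub>C x" by transfer (rule scaleC_scaleC)
  show "1 *\<^sub>C x = x" by transfer (rule scaleC_one)
  show "lie (x + y) z = lie x z + lie y z" by transfer (simp add: cmat_mult_simps)
  show "lie x (y + z) = lie x y + lie x z" by transfer (simp add: cmat_mult_simps)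
  show "lie (c *\<^sub>C x) y = c *\<^sub>C lie x y"
    by transfer (simp add: cmat_mult_simps cvec.scale_right_diff_distrib)
  show "lie x (c *\<^sub>C y) = c *\<^sub>C lie x y"
    by transfer (simp add: cmat_mult_simps cvec.scale_right_diff_distrib)
  show "lie x x = 0" by transfer simp
  show "lie x (lie y z) + lie y (lie z x) + lie z (lie x y) = 0"
    by transfer (simp add: cmat_mult_simps matrix_mul_assoc)
qed
end

definition so_A :: "nat \<Rightarrow> nat \<Rightarrow> 'm::{finite,linorder} so"
  where "so_A i j = Abs_so (mat_A i j)"

definition so_H :: "nat \<Rightarrow> 'm::{finite,linorder} so"
  where "so_H i = Abs_so ((1 / 2) *\<^sub>C
    (mat_unit i i - mat_unit (CARD('m) + 1 - i) (CARD('m) + 1 - i)))"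

definition so_grading_element :: "'m::{finite,linorder} so"
  where "so_grading_element =
    (\<Sum>i = 1..CARD('m) div 2. of_nat (2 * (CARD('m) div 2 + 1 - i)) *\<^sub>C so_H i)"

instantiation so :: ("{finite,linorder}") graded_lie_algebra
begin
definition lie_homog_so :: "int \<Rightarrow> 'a so set"
  where "lie_homog_so d = {x. lie so_grading_element x = of_int d *\<^sub>C x}"
instance ..
end

section \<open>The full chain\<close>

text \<open>
  \<open>E_minus i j\<close>, \<open>E_plus i j\<close>, \<open>E_short i\<close> are the root vectors of \<open>e\<^sub>i - e\<^sub>j\<close>,
  \<open>e\<^sub>i + e\<^sub>j\<close> and \<open>e\<^sub>i\<close>; the last is used for odd \<open>M\<close> only.
\<close>

definition H_elt :: "nat \<Rightarrow> 'm::{finite,linorder} so uea"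
  where "H_elt i = uea_gen (so_H i)"

definition E_minus :: "nat \<Rightarrow> nat \<Rightarrow> 'm::{finite,linorder} so uea"
  where "E_minus i j = uea_gen (- so_A i j)"

definition E_plus :: "nat \<Rightarrow> nat \<Rightarrow> 'm::{finite,linorder} so uea"
  where "E_plus i j = uea_gen (- so_A i (CARD('m) + 1 - j))"

definition E_short :: "nat \<Rightarrow> 'm::{finite,linorder} so uea"
  where "E_short i = uea_gen (- so_A i (CARD('m) div 2 + 1))"

definition I_tens :: "nat \<Rightarrow> 'm::{finite,linorder} so uea2"
  where "I_tens k = (let a = 2 * k + 1; b = 2 * k + 2 in
    (if odd CARD('m) then E_short a \<otimes> E_short b else 0)
    + (\<Sum>l = 2 * k + 3..CARD('m) div 2.
        E_plus a l \<otimes> E_minus b l + E_minus a l \<otimes> E_plus b l))"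

definition I_one :: "nat \<Rightarrow> 'm::{finite,linorder} so uea"
  where "I_one k = (let a = 2 * k + 1 in
    (if odd CARD('m) then (1 / 2) *\<^sub>C (E_short a)\<^sup>2 else 0)
    + (\<Sum>l = 2 * k + 3..CARD('m) div 2. E_plus a l * E_minus a l))"

definition G_elt :: "nat \<Rightarrow> 'm::{finite,linorder} so uea"
  where "G_elt k = E_minus (2 * k + 1) (2 * k + 2) - I_one k"

definition sigma_plus :: "nat \<Rightarrow> 'm::{finite,linorder} so uea fls"
  where "sigma_plus k = hat_ln1p (hat (E_plus (2 * k + 1) (2 * k + 2)))"

definition sigma_G :: "nat \<Rightarrow> 'm::{finite,linorder} so uea fls"
  where "sigma_G k = hat_ln1p (hat (G_elt k))"

definition Phi :: "nat \<Rightarrow> 'm::{finite,linorder} so uea2 fls"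
  where "Phi k = (let a = 2 * k + 1; b = 2 * k + 2 in
    hat_exp (hat (H_elt a - H_elt b) \<otimes>\<^sub>c sigma_G k)
    * hat_exp (hat (I_tens k) * (1 \<otimes>\<^sub>c hat_exp ((- 1 / 2) *\<^sub>C sigma_plus k)))
    * hat_exp (hat (H_elt a + H_elt b) \<otimes>\<^sub>c sigma_plus k))"

definition full_chain :: "nat \<Rightarrow> 'm::{finite,linorder} so uea2 fls"
  where "full_chain p = prod_list (map Phi (rev [0..<p + 1]))"

end

theory Submission
  imports Defs
begin

text \<open>
  The chain is a composition of twists.  If \<open>F\<close> is a twist for \<open>\<Delta>\<close> and \<open>J\<close> is a twist for
  the twisted coproduct \<open>\<Delta>\<^sub>F = F \<Delta> F\<inverse>\<close>, then \<open>J F\<close> is a twist for \<open>\<Delta>\<close> (\<open>cocycle_compose\<close>).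
  So each of the three exponentials of a link, and then each link, is checked only against the
  coproduct twisted by the factors to its right.

  Inside a link, \<open>exp (H\<^sup>+ \<otimes> \<sigma>)\<close> is a Jordanian twist: conjugation by it turns the coproduct of
  \<open>E = E\<^sub>a\<^sub>+\<^sub>b\<close> into one for which \<open>1 + E\<close> is group-like, so \<open>\<sigma> = ln (1 + E)\<close> becomes primitive
  (\<open>jordanian_twist\<close>).  Let \<open>A\<^sub>i\<close> run over the root vectors \<open>E\<^sub>a\<^sub>\<plusminus>\<^sub>l\<close>, \<open>E\<^sub>a\<close> and \<open>B\<^sub>i\<close> over the dual ones
  among \<open>E\<^sub>b\<^sub>\<plusminus>\<^sub>l\<close>, \<open>E\<^sub>b\<close>.  They span a Heisenberg algebra with central element \<open>E\<close>, and the cocycle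
  equation of the extension factor \<open>exp (\<Sum>\<^sub>i A\<^sub>i \<otimes> B\<^sub>i e\<^sup>-\<^sup>\<sigma>\<^sup>/\<^sup>2)\<close> becomes an identity between four
  exponentials whose exponents have only one nontrivial commutator, which is central
  (\<open>exp_pentagon\<close>, \<open>extension_cocycle\<close>).  After these two factors \<open>E\<^sub>a\<^sub>-\<^sub>b\<close> is not primitive, but its
  defect is exactly that of the quadratic element \<open>I\<^sup>1\<close>; hence \<open>G = E\<^sub>a\<^sub>-\<^sub>b - I\<^sup>1\<close> is primitive
  (\<open>twisted_F1_G\<close>).  As \<open>H\<^sup>-\<close> stays primitive and \<open>[H\<^sup>-, G] = G\<close>, the third exponential is again a
  Jordanian twist.

  The tensor \<open>\<Sum>\<^sub>i A\<^sub>i \<otimes> B\<^sub>i\<close> and the element \<open>I\<^sup>1\<close> are built from the invariant form of the vector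
  representation of the smaller orthogonal algebra on the indices strictly between \<open>b\<close> and its
  mirror image.  A link therefore commutes with the coproducts of that algebra
  (\<open>Phi_commute_gen\<close>), to which all later links belong: for them the coproduct is still untwisted,
  and the chain is a twist by induction (\<open>full_chain_twist\<close>).  The statement on the R-matrix holds
  for every invertible twist of a cocommutative Hopf algebra (\<open>triangular_twist\<close>).

  All this takes place in algebras of Laurent series.  The grading is the eigenspace decomposition
  of an inner derivation, so its components are independent and the embedding \<open>hat\<close> of the
  enveloping algebra into the completion is an algebra homomorphism (\<open>alg_hom_hat\<close>); relations
  between generators can thus be computed in \<open>so(M)\<close> and used between series.
\<close>

unbundle no vec_syntax

section \<open>Laurent series over a complex algebra\<close>

lemma fls_scaleC_nth [simp]: "(c *\<^sub>C f) $$ d = c *\<^sub>C (f $$ d)"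
  by (simp add: scaleC_fls.rep_eq)

text \<open>
  Unlike a bound on \<open>fls_subdegree\<close>, which is \<open>0\<close> at the zero series, this holds for the zero
  series with every \<open>n\<close>.
\<close>

definition ord_ge :: "'a::zero fls \<Rightarrow> int \<Rightarrow> bool"
  where "ord_ge f n \<longleftrightarrow> (\<forall>d<n. f $$ d = 0)"

lemma ord_geD: "ord_ge f n \<Longrightarrow> d < n \<Longrightarrow> f $$ d = 0"
  by (simp add: ord_ge_def)

lemma ord_ge_mono: "ord_ge f n \<Longrightarrow> m \<le> n \<Longrightarrow> ord_ge f m"
  by (simp add: ord_ge_def)

lemma ord_ge_zero [simp]: "ord_ge 0 n"
  by (simp add: ord_ge_def)

lemma ord_ge_one: "ord_ge (1 :: 'a::zero_neq_one fls) 0"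
  by (simp add: ord_ge_def)

lemma ord_ge_add: "ord_ge f n \<Longrightarrow> ord_ge g n \<Longrightarrow> ord_ge (f + g) n" for f g :: "'a::monoid_add fls"
  by (simp add: ord_ge_def)

lemma ord_ge_minus: "ord_ge f n \<Longrightarrow> ord_ge (- f) n" for f :: "'a::group_add fls"
  by (simp add: ord_ge_def)

lemma ord_ge_diff: "ord_ge f n \<Longrightarrow> ord_ge g n \<Longrightarrow> ord_ge (f - g) n" for f g :: "'a::group_add fls"
  by (simp add: ord_ge_def)

lemma ord_ge_scaleC: "ord_ge f n \<Longrightarrow> ord_ge (c *\<^sub>C f) n"
  by (simp add: ord_ge_def)

lemma ord_ge_sum: "(\<And>x. x \<in> S \<Longrightarrow> ord_ge (f x) n) \<Longrightarrow> ord_ge (\<Sum>x\<in>S. f x) n"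
  for f :: "'b \<Rightarrow> 'a::comm_monoid_add fls"
  by (induction S rule: infinite_finite_induct) (auto intro: ord_ge_add)

lemma ord_ge_subdegree: "ord_ge f (fls_subdegree f)"
  by (simp add: ord_ge_def)

text \<open>
  A homomorphism may raise the order of a series, so products before and after applying it can be
  compared only if the summation range is not tied to the exact subdegrees.
\<close>

lemma times_nth_ord:
  fixes f g :: "'a::ring_1 fls"
  assumes "ord_ge f a" "ord_ge g b"
  shows "(f * g) $$ n = (\<Sum>i=a..n-b. f $$ i * g $$ (n - i))"
proof (cases "f = 0 \<or> g = 0")
  case False
  have a: "a \<le> fls_subdegree f" and b: "b \<le> fls_subdegree g"
    using False assms by (auto simp: ord_ge_def intro!: fls_subdegree_geI)
  show ?thesis
    unfolding fls_times_nth(2)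
    by (rule sum.mono_neutral_left) (use a b in auto)
qed auto

lemma ord_ge_mult:
  fixes f g :: "'a::ring_1 fls"
  assumes "ord_ge f a" "ord_ge g b"
  shows "ord_ge (f * g) (a + b)"
  by (auto simp: ord_ge_def times_nth_ord[OF assms])

lemma ord_ge_mult_nonneg:
  fixes f g :: "'a::ring_1 fls"
  shows "ord_ge f 0 \<Longrightarrow> ord_ge g n \<Longrightarrow> ord_ge (f * g) n"
    and "ord_ge f n \<Longrightarrow> ord_ge g 0 \<Longrightarrow> ord_ge (f * g) n"
  using ord_ge_mult[of f 0 g n] ord_ge_mult[of f n g 0] by auto

lemma ord_ge_power:
  fixes f :: "'a::ring_1 fls"
  assumes "ord_ge f 1"
  shows "ord_ge (f ^ n) (int n)"
proof (induction n)
  case (Suc n)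
  then show ?case using ord_ge_mult[OF assms Suc] by (simp add: add.commute)
qed (simp add: ord_ge_one)

text \<open>
  Identities between infinite sums are proved by showing that the difference has arbitrarily large
  order; the shift \<open>m\<close> leaves room for a fixed factor of negative order.
\<close>

lemma ord_ge_all_eq_0:
  assumes "\<And>N::nat. ord_ge f (int N + m)"
  shows "f = 0"
proof (rule fls_zero_eqI)
  fix d
  show "f $$ d = 0"
    by (rule ord_geD[OF assms[of "nat (d - m + 1)"]]) auto
qed

instance fls :: (complex_algebra_1) complex_algebra_1
proof
  fix c :: complex and f g :: "'a fls"
  note o = ord_ge_subdegree[of f] ord_ge_subdegree[of g]
  show "(c *\<^sub>C f) * g = c *\<^sub>C (f * g)"
    by (rule fls_eqI)
      (simp add: times_nth_ord[OF o] times_nth_ord[OF ord_ge_scaleC[OF o(1)] o(2)]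
        mult_scaleC_left cvec.scale_sum_right)
  show "f * (c *\<^sub>C g) = c *\<^sub>C (f * g)"
    by (rule fls_eqI)
      (simp add: times_nth_ord[OF o] times_nth_ord[OF o(1) ord_ge_scaleC[OF o(2)]]
        mult_scaleC_right cvec.scale_sum_right)
qed

lemmas scaleC_simps = mult_scaleC_left mult_scaleC_right scaleC_scaleC scaleC_one

subsection \<open>Coefficientwise application of algebra homomorphisms\<close>

definition alg_hom :: "('a::complex_algebra_1 \<Rightarrow> 'b::complex_algebra_1) \<Rightarrow> bool"
  where "alg_hom \<phi> \<longleftrightarrow> clinear \<phi> \<and> \<phi> 1 = 1 \<and> (\<forall>x y. \<phi> (x * y) = \<phi> x * \<phi> y)"

lemma alg_homD:
  assumes "alg_hom \<phi>"
  shows "clinear \<phi>" "\<phi> 1 = 1" "\<phi> (x * y) = \<phi> x * \<phi> y" "\<phi> (x + y) = \<phi> x + \<phi> y"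
    "\<phi> (x - y) = \<phi> x - \<phi> y" "\<phi> 0 = 0" "\<phi> (c *\<^sub>C x) = c *\<^sub>C \<phi> x" "\<phi> (- x) = - \<phi> x"
proof -
  show 1: "clinear \<phi>" "\<phi> 1 = 1" "\<phi> (x * y) = \<phi> x * \<phi> y"
    using assms by (auto simp: alg_hom_def)
  show 2: "\<phi> (x + y) = \<phi> x + \<phi> y"
    "\<phi> (x - y) = \<phi> x - \<phi> y" "\<phi> 0 = 0" "\<phi> (c *\<^sub>C x) = c *\<^sub>C \<phi> x"
    by (simp_all add: clinear_add[OF 1(1)] clinear_diff[OF 1(1)] clinear_zero[OF 1(1)] clinear_scaleC[OF 1(1)])
  show "\<phi> (- x) = - \<phi> x"
    using clinear_diff[OF 1(1), of 0 x] 2(3) by simp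
qed

lemma alg_hom_sum: "alg_hom \<phi> \<Longrightarrow> \<phi> (\<Sum>x\<in>S. f x) = (\<Sum>x\<in>S. \<phi> (f x))"
  by (induction S rule: infinite_finite_induct) (simp_all add: alg_homD)

lemma alg_hom_power: "alg_hom \<phi> \<Longrightarrow> \<phi> (x ^ n) = \<phi> x ^ n"
  by (induction n) (simp_all add: alg_homD)

lemma alg_hom_comp: "alg_hom \<phi> \<Longrightarrow> alg_hom \<psi> \<Longrightarrow> alg_hom (\<lambda>x. \<phi> (\<psi> x))"
  unfolding alg_hom_def by (auto intro!: clinearI simp: clinear_add clinear_scaleC)

lemma hat_map_nth:
  assumes "\<phi> 0 = 0"
  shows "hat_map \<phi> f $$ d = \<phi> (f $$ d)"
proof -
  have "\<forall>\<^sub>\<infinity>n. \<phi> (f $$ (- int n)) = 0"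
    using MOST_fls_neg_nth_eq_0[of f] by (rule MOST_mono) (simp add: assms)
  then show ?thesis
    by (simp add: hat_map_def)
qed

lemma hat_map_nth_hom: "alg_hom \<phi> \<Longrightarrow> hat_map \<phi> f $$ d = \<phi> (f $$ d)"
  by (simp add: hat_map_nth alg_homD)

lemma ord_ge_hat_map: "\<phi> 0 = 0 \<Longrightarrow> ord_ge f n \<Longrightarrow> ord_ge (hat_map \<phi> f) n"
  by (simp add: ord_ge_def hat_map_nth)

lemma alg_hom_hat_map:
  assumes "alg_hom \<phi>"
  shows "alg_hom (hat_map \<phi>)"
  unfolding alg_hom_def
proof (intro conjI allI clinearI)
  note [simp] = hat_map_nth_hom[OF assms] alg_homD[OF assms]
  fix f g :: "'a fls" and c
  show "hat_map \<phi> (f + g) = hat_map \<phi> f + hat_map \<phi> g" "hat_map \<phi> (c *\<^sub>C f) = c *\<^sub>C hat_map \<phi> f"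
    "hat_map \<phi> 1 = 1"
    by (simp_all add: fls_eq_iff)
  note o = ord_ge_subdegree[of f] ord_ge_subdegree[of g]
  have o': "ord_ge (hat_map \<phi> f) (fls_subdegree f)" "ord_ge (hat_map \<phi> g) (fls_subdegree g)"
    using o by (simp_all add: ord_ge_hat_map)
  show "hat_map \<phi> (f * g) = hat_map \<phi> f * hat_map \<phi> g"
    by (simp add: fls_eq_iff times_nth_ord[OF o] times_nth_ord[OF o'] alg_hom_sum[OF assms])
qed

lemma hat_map_comp:
  "alg_hom \<phi> \<Longrightarrow> alg_hom \<psi> \<Longrightarrow> hat_map \<phi> (hat_map \<psi> f) = hat_map (\<lambda>x. \<phi> (\<psi> x)) f"
  by (simp add: fls_eq_iff hat_map_nth_hom alg_hom_comp)

subsection \<open>Convergent series\<close>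

text \<open>
  Only terms of index at most \<open>d\<close> contribute to the coefficient of degree \<open>d\<close> when the \<open>n\<close>-th term
  has order at least \<open>n\<close>; the infinite sums of the completion are all of this kind.
\<close>

definition ser :: "(nat \<Rightarrow> 'a::ring_1 fls) \<Rightarrow> 'a fls"
  where "ser a = Abs_fls (\<lambda>d. \<Sum>n\<le>nat d. a n $$ d)"

lemma ser_nth:
  assumes "\<And>n. ord_ge (a n) (int n)" "nat d \<le> N"
  shows "ser a $$ d = (\<Sum>n\<le>N. a n $$ d)"
proof -
  have "(\<Sum>n\<le>nat d. a n $$ d) = 0" if "d < 0" for d
    using assms(1) that by (intro sum.neutral) (auto simp: ord_ge_def)
  then have "ser a $$ d = (\<Sum>n\<le>nat d. a n $$ d)"
    unfolding ser_def by (intro nth_Abs_fls_lower_bound[of 0]) auto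
  also have "\<dots> = (\<Sum>n\<le>N. a n $$ d)"
  proof (intro sum.mono_neutral_left ballI)
    fix n assume "n \<in> {..N} - {..nat d}"
    then show "a n $$ d = 0"
      by (intro ord_geD[OF assms(1)]) auto
  qed (use assms(2) in auto)
  finally show ?thesis .
qed

lemmas ser_nth_nat = ser_nth[OF _ order_refl]

lemma ser_approx:
  assumes "\<And>n. ord_ge (a n) (int n)"
  shows "ord_ge (ser a - (\<Sum>n<N. a n)) (int N)"
  unfolding ord_ge_def
proof (intro allI impI)
  fix d assume "d < int N"
  show "(ser a - (\<Sum>n<N. a n)) $$ d = 0"
  proof (cases N)
    case 0
    with \<open>d < int N\<close> have "ser a $$ d = a 0 $$ d"
      using ser_nth[OF assms, where d = d and N = 0] by simp
    with 0 \<open>d < int N\<close> assms[of 0] show ?thesis by (simp add: ord_ge_def)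
  next
    case (Suc M)
    have "ser a $$ d = (\<Sum>n\<le>M. a n $$ d)"
      by (rule ser_nth[OF assms]) (use \<open>d < int N\<close> Suc in auto)
    then show ?thesis
      by (simp add: Suc fls_nth_sum lessThan_Suc_atMost)
  qed
qed

lemma ser_eqI:
  assumes "\<And>n. ord_ge (a n) (int n)" "\<And>N. ord_ge (L - (\<Sum>n<N. a n)) (int N)"
  shows "ser a = L"
proof -
  have "ser a - L = 0"
  proof (rule ord_ge_all_eq_0)
    fix N :: nat
    have "ser a - L = (ser a - (\<Sum>n<N. a n)) - (L - (\<Sum>n<N. a n))" by simp
    then show "ord_ge (ser a - L) (int N + 0)"
      using ser_approx[OF assms(1), of N] assms(2)[of N] ord_ge_diff by fastforce
  qed
  then show ?thesis by simp
qed

lemma suminf_eq_ser: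
  fixes a :: "nat \<Rightarrow> 'a::ring_1 fls"
  assumes "\<And>n. ord_ge (a n) (int n)"
  shows "suminf a = ser a"
proof (rule sums_unique[symmetric], unfold sums_def, rule metric_LIMSEQ_I)
  fix r :: real assume "0 < r"
  then obtain N where N: "inverse (2 ^ N) < r"
    using real_arch_pow_inv[of r "1/2"] by (auto simp: power_one_over field_simps)
  have "dist (\<Sum>n<k. a n) (ser a) < r" if "k \<ge> N" for k
  proof (cases "(\<Sum>n<k. a n) = ser a")
    case False
    have "ord_ge ((\<Sum>n<k. a n) - ser a) (int k)"
      using ord_ge_minus[OF ser_approx[OF assms, of k]] by simp
    then have le: "int k \<le> fls_subdegree ((\<Sum>n<k. a n) - ser a)"
      using False by (intro fls_subdegree_geI) (auto simp: ord_ge_def)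
    then have "N \<le> nat (fls_subdegree ((\<Sum>n<k. a n) - ser a))"
      using that by linarith
    then have "inverse ((2::real) ^ nat (fls_subdegree ((\<Sum>n<k. a n) - ser a))) \<le> inverse (2 ^ N)"
      by (intro le_imp_inverse_le power_increasing) auto
    also note N
    finally show ?thesis
      using False le by (simp add: dist_fls_def)
  qed (use \<open>0 < r\<close> in simp)
  then show "\<exists>no. \<forall>k\<ge>no. dist (\<Sum>n<k. a n) (ser a) < r" by blast
qed

lemma hat_map_ser:
  assumes "alg_hom \<phi>" "\<And>n. ord_ge (a n) (int n)"
  shows "hat_map \<phi> (ser a) = ser (\<lambda>n. hat_map \<phi> (a n))"
proof (rule fls_eqI)
  fix d
  have "ord_ge (hat_map \<phi> (a n)) (int n)" for n
    using assms by (simp add: ord_ge_hat_map alg_homD)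
  then show "hat_map \<phi> (ser a) $$ d = ser (\<lambda>n. hat_map \<phi> (a n)) $$ d"
    using assms by (simp add: ser_nth_nat hat_map_nth_hom alg_hom_sum)
qed

lemma ser_mult:
  assumes a: "\<And>n. ord_ge (a n) (int n)" and b: "\<And>n. ord_ge (b n) (int n)"
  shows "ser a * ser b = ser (\<lambda>k. \<Sum>i\<le>k. a i * b (k - i))"
proof (rule ser_eqI[symmetric])
  show "ord_ge (\<Sum>i\<le>n. a i * b (n - i)) (int n)" for n
  proof (rule ord_ge_sum)
    fix i assume "i \<in> {..n}"
    then show "ord_ge (a i * b (n - i)) (int n)"
      using ord_ge_mult[OF a[of i] b[of "n - i"]] by (simp add: of_nat_diff)
  qed
next
  fix N
  let ?A = "\<Sum>n<N. a n" and ?B = "\<Sum>n<N. b n" and ?T = "{(i, j). i + j < N}"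
  have T: "?T \<subseteq> {..<N} \<times> {..<N}" by auto
  have "ord_ge ?A 0"
    by (intro ord_ge_sum ord_ge_mono[OF a]) simp
  moreover have "ord_ge (ser b) 0"
    using ser_approx[OF b, of 0] by simp
  ultimately have 1: "ord_ge ((ser a - ?A) * ser b + ?A * (ser b - ?B)) (int N)"
    by (intro ord_ge_add ord_ge_mult_nonneg ser_approx a b)
  have "?A * ?B - (\<Sum>(i,j)\<in>?T. a i * b j) = (\<Sum>(i,j)\<in>{..<N} \<times> {..<N} - ?T. a i * b j)"
    using T by (simp add: sum_product sum.cartesian_product sum_diff)
  also have "ord_ge \<dots> (int N)"
  proof (rule ord_ge_sum)
    fix p assume "p \<in> {..<N} \<times> {..<N} - ?T"
    then obtain i j where "p = (i, j)" "N \<le> i + j" by (cases p) auto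
    then show "ord_ge (case p of (i, j) \<Rightarrow> a i * b j) (int N)"
      by (auto intro!: ord_ge_mono[OF ord_ge_mult[OF a b]])
  qed
  finally have 2: "ord_ge (?A * ?B - (\<Sum>k<N. \<Sum>i\<le>k. a i * b (k - i))) (int N)"
    by (simp add: sum.triangle_reindex)
  have eq: "ser a * ser b - (\<Sum>k<N. \<Sum>i\<le>k. a i * b (k - i))
    = ((ser a - ?A) * ser b + ?A * (ser b - ?B)) + (?A * ?B - (\<Sum>k<N. \<Sum>i\<le>k. a i * b (k - i)))"
    by (simp add: algebra_simps)
  show "ord_ge (ser a * ser b - (\<Sum>k<N. \<Sum>i\<le>k. a i * b (k - i))) (int N)"
    unfolding eq by (rule ord_ge_add[OF 1 2])
qed

subsection \<open>Substitution into complex power series\<close>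

definition psub :: "complex fps \<Rightarrow> 'a::complex_algebra_1 fls \<Rightarrow> 'a fls"
  where "psub c x = ser (\<lambda>n. (c $ n) *\<^sub>C x ^ n)"

lemma psub_summable: "ord_ge (x :: 'a::complex_algebra_1 fls) 1 \<Longrightarrow> ord_ge ((c $ n) *\<^sub>C x ^ n) (int n)"
  by (intro ord_ge_scaleC ord_ge_power)

lemma psub_approx: "ord_ge x 1 \<Longrightarrow> ord_ge (psub c x - (\<Sum>n<N. (c $ n) *\<^sub>C x ^ n)) (int N)"
  unfolding psub_def by (intro ser_approx psub_summable)

lemma ord_ge_psub: "ord_ge x 1 \<Longrightarrow> ord_ge (psub c x) 0"
  using psub_approx[of x c 0] by simp

lemma ord_ge_psub1:
  assumes "ord_ge x 1" "c $ 0 = 0"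
  shows "ord_ge (psub c x) 1"
  using psub_approx[OF assms(1), of c 1] assms(2) by simp

lemma psub_mult: "ord_ge x 1 \<Longrightarrow> psub (c * d) x = psub c x * psub d x"
  unfolding psub_def
  by (simp add: ser_mult[OF psub_summable psub_summable] scaleC_simps power_add[symmetric] mult.commute
      fps_mult_nth cvec.scale_sum_left atLeast0AtMost)

lemma psub_add: "ord_ge x 1 \<Longrightarrow> psub (c + d) x = psub c x + psub d x"
  unfolding psub_def
  by (rule fls_eqI)
    (simp add: ser_nth_nat psub_summable ord_ge_scaleC ord_ge_power ord_ge_add scaleC_add_left sum.distrib)

lemma psub_diff: "ord_ge x 1 \<Longrightarrow> psub (c - d) x = psub c x - psub d x"
  using psub_add[of x "c - d" d] by simp

lemma psub_const: "psub (fps_const c) x = c *\<^sub>C 1" if "ord_ge x 1"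
  unfolding psub_def
proof (rule ser_eqI)
  fix N
  have "(\<Sum>n<N. (fps_const c $ n) *\<^sub>C x ^ n) = (if N = 0 then 0 else c *\<^sub>C 1)"
    by (induction N) auto
  then show "ord_ge (c *\<^sub>C 1 - (\<Sum>n<N. (fps_const c $ n) *\<^sub>C x ^ n)) (int N)"
    by (auto intro!: ord_ge_scaleC ord_ge_one simp del: scaleC_one)
qed (use that in \<open>rule psub_summable\<close>)

lemma psub_one: "ord_ge x 1 \<Longrightarrow> psub 1 x = 1"
  using psub_const[of x 1] by (simp add: scaleC_one)

lemma psub_X: "ord_ge x 1 \<Longrightarrow> psub fps_X x = x"
  unfolding psub_def
proof (rule ser_eqI)
  fix N assume x: "ord_ge x 1"
  have "(\<Sum>n<N. (fps_X $ n) *\<^sub>C x ^ n) = (if N < 2 then 0 else x)"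
  proof (induction N)
    case (Suc N)
    then show ?case by (cases "N = 1") (auto simp: scaleC_one)
  qed simp
  then show "ord_ge (x - (\<Sum>n<N. (fps_X $ n) *\<^sub>C x ^ n)) (int N)"
    by (auto intro: ord_ge_mono[OF x])
qed (use psub_summable in auto)

lemma psub_power: "ord_ge x 1 \<Longrightarrow> psub (c ^ n) x = psub c x ^ n"
  by (induction n) (simp_all add: psub_one psub_mult)

lemma psub_scale: "ord_ge x 1 \<Longrightarrow> psub (fps_const k * c) x = k *\<^sub>C psub c x"
  by (simp add: psub_mult psub_const scaleC_simps)

lemma psub_sum: "ord_ge x 1 \<Longrightarrow> psub (\<Sum>i\<in>S. c i) x = (\<Sum>i\<in>S. psub (c i) x)"
proof (induction S rule: infinite_finite_induct)
  case empty
  then show ?case using psub_const[of x 0] by simp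
qed (simp_all add: psub_add psub_const[where c = 0, simplified])

lemma ord_ge_psub_low:
  assumes "ord_ge x 1" "\<And>n. n < N \<Longrightarrow> c $ n = 0"
  shows "ord_ge (psub c x) (int N)"
proof -
  have "(\<Sum>n<N. (c $ n) *\<^sub>C x ^ n) = 0"
    using assms(2) by (intro sum.neutral) auto
  then show ?thesis
    using psub_approx[OF assms(1), of c N] by simp
qed

text \<open>
  Modulo order \<open>N\<close>, both sides are the value at \<open>x\<close> of the truncation of \<open>c\<close> at \<open>N\<close> composed
  with \<open>d\<close>.
\<close>

lemma psub_compose:
  assumes "ord_ge x 1" "d $ 0 = 0"
  shows "psub c (psub d x) = psub (c oo d) x"
proof -
  have y: "ord_ge (psub d x) 1" by (rule ord_ge_psub1[OF assms])
  have "psub c (psub d x) - psub (c oo d) x = 0"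
  proof (rule ord_ge_all_eq_0)
    fix N :: nat
    let ?p = "\<Sum>m<N. fps_const (c $ m) * d ^ m"
    have 1: "ord_ge (psub c (psub d x) - (\<Sum>m<N. (c $ m) *\<^sub>C psub d x ^ m)) (int N)"
      by (rule psub_approx[OF y])
    have "((c oo d) - ?p) $ n = 0" if "n < N" for n
    proof -
      have "(c oo d) $ n = (\<Sum>m\<le>n. c $ m * (d ^ m $ n))"
        by (simp add: fps_compose_nth atLeast0AtMost)
      also have "\<dots> = (\<Sum>m<N. c $ m * (d ^ m $ n))"
        using that assms(2) by (intro sum.mono_neutral_left) (auto simp: startsby_zero_power_prefix)
      finally show ?thesis by (simp add: fps_sum_nth)
    qed
    then have 2: "ord_ge (psub ((c oo d) - ?p) x) (int N)"
      by (rule ord_ge_psub_low[OF assms(1)])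
    have "psub ((c oo d) - ?p) x = psub (c oo d) x - (\<Sum>m<N. (c $ m) *\<^sub>C psub d x ^ m)"
      using assms(1) by (simp add: psub_diff psub_sum psub_scale psub_power)
    then show "ord_ge (psub c (psub d x) - psub (c oo d) x) (int N + 0)"
      using ord_ge_diff[OF 1 2] by simp
  qed
  then show ?thesis by simp
qed

lemma hat_map_psub:
  assumes "alg_hom \<phi>" "ord_ge x 1"
  shows "hat_map \<phi> (psub c x) = psub c (hat_map \<phi> x)"
  unfolding psub_def
  using assms by (simp add: hat_map_ser psub_summable alg_homD[OF alg_hom_hat_map[OF assms(1)]]
      alg_hom_power[OF alg_hom_hat_map])

text \<open>
  Moving \<open>y\<close> through a power series needs the relation with \<open>x\<close> alone.  With \<open>x' = x\<close> this says
  that power series inherit commutation; with \<open>x' = x + s\<close> it gives the effect of conjugation by an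
  exponential on an eigenvector.
\<close>

lemma psub_intertwine:
  assumes x: "ord_ge x 1" and x': "ord_ge x' 1" and xy: "x * y = y * x'"
  shows "psub c x * y = y * psub c x'"
proof -
  define m where "m = fls_subdegree y"
  have y: "ord_ge y m" by (simp add: m_def ord_ge_subdegree)
  have pow: "x ^ n * y = y * x' ^ n" for n
  proof (induction n)
    case (Suc n)
    have "x ^ Suc n * y = x * (y * x' ^ n)" by (simp add: Suc mult.assoc)
    also have "\<dots> = y * x' ^ Suc n" by (simp add: xy flip: mult.assoc)
    finally show ?case .
  qed simp
  have "psub c x * y - y * psub c x' = 0"
  proof (rule ord_ge_all_eq_0)
    fix N :: nat
    have "psub c x * y - y * psub c x'
      = (psub c x - (\<Sum>n<N. (c $ n) *\<^sub>C x ^ n)) * y - y * (psub c x' - (\<Sum>n<N. (c $ n) *\<^sub>C x' ^ n))"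
      by (simp add: algebra_simps sum_distrib_left sum_distrib_right scaleC_simps pow)
    then show "ord_ge (psub c x * y - y * psub c x') (int N + m)"
      using ord_ge_diff[OF ord_ge_mult[OF psub_approx[OF x, of c N] y]
          ord_ge_mult[OF y psub_approx[OF x', of c N], unfolded add.commute[of m]]] by simp
  qed
  then show ?thesis by simp
qed

subsection \<open>Exponential and logarithm\<close>

lemma hat_exp_psub: "ord_ge x 1 \<Longrightarrow> hat_exp x = psub (fps_exp 1) x"
  unfolding hat_exp_def psub_def
  by (subst suminf_eq_ser) (auto intro: ord_ge_scaleC ord_ge_power)

lemma hat_ln1p_psub: "ord_ge x 1 \<Longrightarrow> hat_ln1p x = psub (fps_ln 1) x"
proof -
  assume x: "ord_ge x 1"
  let ?a = "\<lambda>n. ((- 1) ^ n / of_nat (n + 1)) *\<^sub>C x ^ (n + 1)"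
  have a: "ord_ge (?a n) (int n)" for n
    by (intro ord_ge_scaleC ord_ge_mono[OF ord_ge_power[OF x]]) simp
  have "ser ?a = psub (fps_ln 1) x"
  proof (rule ser_eqI[OF a])
    fix N
    have "(\<Sum>n<Suc N. (fps_ln 1 $ n) *\<^sub>C x ^ n) = (\<Sum>n<N. ?a n)"
      by (subst sum.lessThan_Suc_shift) (simp add: fps_ln_nth)
    then show "ord_ge (psub (fps_ln 1) x - (\<Sum>n<N. ?a n)) (int N)"
      using ord_ge_mono[OF psub_approx[OF x, of "fps_ln 1" "Suc N"], of "int N"] by simp
  qed
  then show ?thesis
    unfolding hat_ln1p_def by (simp only: suminf_eq_ser[OF a])
qed

lemma ord_ge_hat_exp: "ord_ge x 1 \<Longrightarrow> ord_ge (hat_exp x) 0"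
  by (simp add: hat_exp_psub ord_ge_psub)

lemma ord_ge_hat_ln1p: "ord_ge x 1 \<Longrightarrow> ord_ge (hat_ln1p x) 1"
  by (simp add: hat_ln1p_psub ord_ge_psub1)

lemma hat_map_exp: "alg_hom \<phi> \<Longrightarrow> ord_ge x 1 \<Longrightarrow> hat_map \<phi> (hat_exp x) = hat_exp (hat_map \<phi> x)"
  by (simp add: hat_exp_psub hat_map_psub ord_ge_hat_map alg_homD)

lemma hat_map_ln1p: "alg_hom \<phi> \<Longrightarrow> ord_ge x 1 \<Longrightarrow> hat_map \<phi> (hat_ln1p x) = hat_ln1p (hat_map \<phi> x)"
  by (simp add: hat_ln1p_psub hat_map_psub ord_ge_hat_map alg_homD)

lemma hat_exp_intertwine:
  "ord_ge x 1 \<Longrightarrow> ord_ge x' 1 \<Longrightarrow> x * y = y * x' \<Longrightarrow> hat_exp x * y = y * hat_exp x'"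
  by (simp add: hat_exp_psub psub_intertwine)

lemma hat_ln1p_intertwine:
  "ord_ge x 1 \<Longrightarrow> ord_ge x' 1 \<Longrightarrow> x * y = y * x' \<Longrightarrow> hat_ln1p x * y = y * hat_ln1p x'"
  by (simp add: hat_ln1p_psub psub_intertwine)

lemma hat_exp_zero: "hat_exp 0 = 1"
proof -
  have "hat_exp 0 = psub (fps_exp 1 oo 0) (0 :: 'a fls)"
    using psub_compose[of "0::'a fls" 0 "fps_exp 1"] psub_const[of "0::'a fls" 0]
    by (simp add: hat_exp_psub)
  also have "fps_exp 1 oo 0 = (1 :: complex fps)"
    by (simp add: fps_eq_iff fps_compose_nth sum.atLeast_Suc_atMost power_0_left)
  finally show ?thesis by (simp add: psub_one)
qed

lemma hat_ln1p_zero: "hat_ln1p 0 = 0"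
proof -
  have "hat_ln1p 0 = psub (fps_ln 1 oo 0) (0 :: 'a fls)"
    using psub_compose[of "0::'a fls" 0 "fps_ln 1"] psub_const[of "0::'a fls" 0]
    by (simp add: hat_ln1p_psub)
  also have "fps_ln 1 oo 0 = (0 :: complex fps)"
    by (simp add: fps_eq_iff fps_compose_nth sum.atLeast_Suc_atMost power_0_left)
  finally show ?thesis using psub_const[of "0::'a fls" 0] by simp
qed

lemma exp_oo_ln: "(fps_exp 1 oo fps_ln 1) = (1 + fps_X :: complex fps)"
proof -
  have "(fps_exp 1 - 1) oo fps_ln 1 = (fps_X :: complex fps)"
    by (simp add: fps_ln_fps_exp_inv fps_inv_right)
  then have "(fps_exp 1 oo fps_ln 1) - 1 = (fps_X :: complex fps)"
    by (simp add: fps_compose_sub_distrib)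
  then show ?thesis by (simp add: algebra_simps)
qed

lemma ln_oo_exp: "fps_ln 1 oo (fps_exp 1 - 1) = (fps_X :: complex fps)"
  by (simp add: fps_ln_fps_exp_inv fps_inv)

lemma hat_exp_ln1p: "ord_ge x 1 \<Longrightarrow> hat_exp (hat_ln1p x) = 1 + x"
  by (simp add: hat_exp_psub ord_ge_hat_ln1p)
    (simp add: hat_ln1p_psub psub_compose exp_oo_ln psub_add psub_one psub_X)

lemma hat_ln1p_exp: "ord_ge x 1 \<Longrightarrow> hat_ln1p (hat_exp x - 1) = x"
proof -
  assume x: "ord_ge x 1"
  have e: "hat_exp x - 1 = psub (fps_exp 1 - 1) x"
    by (simp add: hat_exp_psub x psub_diff psub_one)
  have "ord_ge (hat_exp x - 1) 1"
    unfolding e by (rule ord_ge_psub1[OF x]) simp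
  then show ?thesis
    by (simp add: hat_ln1p_psub) (simp add: e psub_compose x ln_oo_exp psub_X)
qed

text \<open>
  The divided powers of \<open>x + y\<close> are the Cauchy products of those of \<open>x\<close> and \<open>y\<close>, because both
  satisfy the recursion \<open>(x + y) e\<^sub>k = (k + 1) e\<^sub>k\<^sub>+\<^sub>1\<close>.
\<close>

lemma hat_exp_add:
  assumes x: "ord_ge x 1" and y: "ord_ge y 1" and xy: "x * y = y * x"
  shows "hat_exp (x + y) = hat_exp x * hat_exp y"
proof -
  have com: "x ^ i * y = y * x ^ i" for i
    by (induction i) (simp_all add: mult.assoc xy, simp add: xy flip: mult.assoc)
  let ?e = "\<lambda>x n. (1 / fact n) *\<^sub>C x ^ n"
  have step: "(\<Sum>i\<le>Suc k. ?e x i * ?e y (Suc k - i)) = (1 / of_nat (Suc k)) *\<^sub>C ((x + y) * (\<Sum>i\<le>k. ?e x i * ?e y (k - i)))" for k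
  proof -
    have ex: "x * (?e x i * z) = of_nat (Suc i) *\<^sub>C (?e x (Suc i) * z)" for i z
      by (simp add: scaleC_simps divide_simps mult.assoc del: of_nat_Suc)
    have ey: "y * (?e x i * ?e y j) = of_nat (Suc j) *\<^sub>C (?e x i * ?e y (Suc j))" for i j
      by (simp add: scaleC_simps divide_simps com flip: mult.assoc del: of_nat_Suc)
    have "(x + y) * (\<Sum>i\<le>k. ?e x i * ?e y (k - i))
      = (\<Sum>i\<le>k. of_nat (Suc i) *\<^sub>C (?e x (Suc i) * ?e y (k - i)))
        + (\<Sum>i\<le>k. of_nat (Suc (k - i)) *\<^sub>C (?e x i * ?e y (Suc (k - i))))"
      by (simp only: distrib_right sum_distrib_left ex ey sum.distrib)
    also have "(\<Sum>i\<le>k. of_nat (Suc i) *\<^sub>C (?e x (Suc i) * ?e y (k - i)))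
      = (\<Sum>i\<le>Suc k. of_nat i *\<^sub>C (?e x i * ?e y (Suc k - i)))"
      by (subst sum.atMost_Suc_shift) simp
    also have "(\<Sum>i\<le>k. of_nat (Suc (k - i)) *\<^sub>C (?e x i * ?e y (Suc (k - i))))
      = (\<Sum>i\<le>Suc k. of_nat (Suc k - i) *\<^sub>C (?e x i * ?e y (Suc k - i)))"
      by (subst sum.atMost_Suc) (auto intro!: sum.cong simp: Suc_diff_le simp del: of_nat_Suc of_nat_diff)
    finally have "(x + y) * (\<Sum>i\<le>k. ?e x i * ?e y (k - i))
      = (\<Sum>i\<le>Suc k. of_nat (Suc k) *\<^sub>C (?e x i * ?e y (Suc k - i)))"
      by (simp only: sum.distrib[symmetric] scaleC_add_left[symmetric] of_nat_add[symmetric])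
        (auto intro!: sum.cong)
    then show ?thesis
      by (simp only: cvec.scale_sum_right[symmetric] scaleC_scaleC)
        (simp add: scaleC_one del: of_nat_Suc)
  qed
  have "(\<Sum>i\<le>k. ?e x i * ?e y (k - i)) = ?e (x + y) k" for k
  proof (induction k)
    case (Suc k)
    show ?case
      unfolding step Suc by (simp add: scaleC_simps del: of_nat_Suc)
  qed (simp add: scaleC_one)
  moreover have "ord_ge (?e x n) (int n)" "ord_ge (?e y n) (int n)" for n
    by (intro ord_ge_scaleC ord_ge_power x y)+
  ultimately have "ser (?e x) * ser (?e y) = ser (?e (x + y))"
    by (simp add: ser_mult)
  then show ?thesis
    using x y by (simp add: hat_exp_psub psub_def ord_ge_add)
qed

lemma hat_exp_uminus:
  assumes "ord_ge x 1"
  shows "hat_exp x * hat_exp (- x) = 1" "hat_exp (- x) * hat_exp x = 1"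
  using hat_exp_add[of x "- x"] hat_exp_add[of "- x" x] assms ord_ge_minus[OF assms]
  by (simp_all add: hat_exp_zero)

lemma hat_ln1p_mult:
  assumes x: "ord_ge x 1" and y: "ord_ge y 1" and xy: "x * y = y * x"
  shows "hat_ln1p (x + y + x * y) = hat_ln1p x + hat_ln1p y"
proof -
  note o = ord_ge_hat_ln1p[OF x] ord_ge_hat_ln1p[OF y]
  have "x * hat_ln1p y = hat_ln1p y * x"
    using hat_ln1p_intertwine[OF y y, of x] xy by simp
  then have "hat_ln1p x * hat_ln1p y = hat_ln1p y * hat_ln1p x"
    by (intro hat_ln1p_intertwine x)
  then have "hat_exp (hat_ln1p x + hat_ln1p y) = (1 + x) * (1 + y)"
    using o by (simp add: hat_exp_add hat_exp_ln1p x y)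
  then have "x + y + x * y = hat_exp (hat_ln1p x + hat_ln1p y) - 1"
    by (simp add: algebra_simps)
  then show ?thesis
    using o by (simp add: hat_ln1p_exp ord_ge_add)
qed

text \<open>
  The case of \<open>exp X Y exp (- X) = \<Sum>\<^sub>n (ad X)\<^sup>n Y / n!\<close> in which the third commutator vanishes.  It
  is proved for divided powers, where \<open>e\<^sub>n Y = Y e\<^sub>n + Z e\<^sub>n\<^sub>-\<^sub>1 + W e\<^sub>n\<^sub>-\<^sub>2 / 2\<close>.
\<close>

lemma hat_exp_conj:
  assumes X: "ord_ge X 1"
    and XY: "X * Y = Y * X + Z" and XZ: "X * Z = Z * X + W" and XW: "X * W = W * X"
  shows "hat_exp X * Y = (Y + Z + (1/2) *\<^sub>C W) * hat_exp X"
proof -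
  define e where "e n = (1 / fact n) *\<^sub>C X ^ n" for n
  have e0: "e 0 = 1" "e (Suc 0) = X"
    by (simp_all add: e_def scaleC_one)
  have Xe: "X * e n = of_nat (Suc n) *\<^sub>C e (Suc n)" for n
    by (simp add: e_def scaleC_simps divide_simps del: of_nat_Suc)
  have cancel: "a = b" if "of_nat (Suc n) *\<^sub>C a = of_nat (Suc n) *\<^sub>C b" for n and a b :: "'a fls"
    using that by (simp del: of_nat_Suc)
  have "X ^ n * W = W * X ^ n" for n
  proof (induction n)
    case (Suc n)
    have "X ^ Suc n * W = X * (W * X ^ n)" by (simp add: Suc mult.assoc)
    also have "\<dots> = W * X ^ Suc n" by (simp add: XW flip: mult.assoc)
    finally show ?case .
  qed simp
  then have W: "e n * W = W * e n" for n
    by (simp add: e_def scaleC_simps)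
  have Z: "e (Suc n) * Z = Z * e (Suc n) + W * e n" for n
  proof (induction n)
    case 0
    then show ?case by (simp add: e0 XZ)
  next
    case (Suc n)
    have "of_nat (Suc (Suc n)) *\<^sub>C (e (Suc (Suc n)) * Z) = X * (e (Suc n) * Z)"
      by (simp only: Xe mult_scaleC_left mult.assoc[symmetric])
    also have "\<dots> = Z * (X * e (Suc n)) + W * e (Suc n) + W * (X * e n)"
      unfolding Suc by (simp only: distrib_left XZ XW mult.assoc[symmetric] distrib_right)
    also have "\<dots> = of_nat (Suc (Suc n)) *\<^sub>C (Z * e (Suc (Suc n))) + (1 + of_nat (Suc n)) *\<^sub>C (W * e (Suc n))"
      by (simp only: Xe scaleC_add_left mult_scaleC_right scaleC_one add.assoc)
    finally show ?case
      by - (rule cancel[of "Suc n"], (simp only: scaleC_add_right of_nat_Suc))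
  qed
  have Y: "e (Suc (Suc n)) * Y = Y * e (Suc (Suc n)) + Z * e (Suc n) + (1/2) *\<^sub>C (W * e n)" for n
  proof (induction n)
    case 0
    have "of_nat (Suc (Suc 0)) *\<^sub>C (e (Suc (Suc 0)) * Y) = X * (X * Y)"
      using Xe[of "Suc 0"] by (simp only: e0 mult_scaleC_left mult.assoc[symmetric])
    also have "\<dots> = Y * (X * X) + Z * X + Z * X + W"
      by (simp only: distrib_left XY XZ mult.assoc[symmetric] distrib_right add.assoc)
    also have "Y * (X * X) = of_nat (Suc (Suc 0)) *\<^sub>C (Y * e (Suc (Suc 0)))"
      using Xe[of "Suc 0"] by (simp only: e0 mult_scaleC_right)
    also have "W = of_nat (Suc (Suc 0)) *\<^sub>C (1/2) *\<^sub>C W"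
      by (simp add: scaleC_simps)
    finally show ?case
      by - (rule cancel[of "Suc 0"],
        (simp add: e0 scaleC_add_left[of 1 1 "Z * X", simplified] scaleC_add_right scaleC_one add.assoc))
  next
    case (Suc n)
    have "of_nat (Suc (Suc (Suc n))) *\<^sub>C (e (Suc (Suc (Suc n))) * Y) = X * (e (Suc (Suc n)) * Y)"
      by (simp only: Xe mult_scaleC_left mult.assoc[symmetric])
    also have "\<dots> = Y * (X * e (Suc (Suc n))) + (Z * e (Suc (Suc n)) + Z * (X * e (Suc n)))
        + (W * e (Suc n) + (1/2) *\<^sub>C (W * (X * e n)))"
      unfolding Suc by (simp only: distrib_left XY XZ XW mult.assoc[symmetric] distrib_right
          mult_scaleC_right) (simp only: add.assoc mult.assoc[symmetric] XW)
    also have "Z * e (Suc (Suc n)) + Z * (X * e (Suc n)) = (1 + of_nat (Suc (Suc n))) *\<^sub>C (Z * e (Suc (Suc n)))"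
      by (simp only: Xe mult_scaleC_right scaleC_add_left scaleC_one)
    also have "W * e (Suc n) + (1/2) *\<^sub>C (W * (X * e n)) = (1 + (1/2) * of_nat (Suc n)) *\<^sub>C (W * e (Suc n))"
      by (simp only: Xe mult_scaleC_right scaleC_add_left scaleC_one scaleC_scaleC)
    also have "1 + (1/2) * of_nat (Suc n) = (of_nat (Suc (Suc (Suc n))) * (1/2) :: complex)"
      by (simp add: field_simps)
    also have "Y * (X * e (Suc (Suc n))) = of_nat (Suc (Suc (Suc n))) *\<^sub>C (Y * e (Suc (Suc (Suc n))))"
      by (simp only: Xe mult_scaleC_right)
    finally show ?case
      by - (rule cancel[of "Suc (Suc n)"], (simp only: scaleC_add_right scaleC_scaleC of_nat_Suc[of "Suc (Suc n)"]))
  qed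
  let ?S = "\<lambda>N. \<Sum>n<N. e n"
  have S: "?S (Suc (Suc N)) * Y = Y * ?S (Suc (Suc N)) + Z * ?S (Suc N) + (1/2) *\<^sub>C (W * ?S N)" for N
  proof (induction N)
    case 0
    then show ?case
      by (simp add: e0 distrib_left distrib_right XY)
  next
    case (Suc N)
    have "?S (Suc (Suc (Suc N))) * Y = ?S (Suc (Suc N)) * Y + e (Suc (Suc N)) * Y"
      by (simp only: sum.lessThan_Suc[of e "Suc (Suc N)"] distrib_right)
    then show ?case
      unfolding Suc Y by (simp add: distrib_left scaleC_add_right add_ac)
  qed
  have apx: "ord_ge (hat_exp X - ?S N) (int N)" for N
    using psub_approx[OF X, of "fps_exp 1" N] by (simp add: hat_exp_psub[OF X] e_def)
  \<comment> \<open>The factors \<open>Y\<close>, \<open>Z\<close>, \<open>W\<close> may have negative order.\<close>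
  define m where "m = Min {fls_subdegree Y, fls_subdegree Z, fls_subdegree W}"
  have m: "ord_ge Y m" "ord_ge Z m" "ord_ge W m"
    by (auto simp: m_def intro: ord_ge_mono[OF ord_ge_subdegree])
  have "hat_exp X * Y - (Y + Z + (1/2) *\<^sub>C W) * hat_exp X = 0"
  proof (rule ord_ge_all_eq_0)
    fix N :: nat
    let ?d = "\<lambda>N. hat_exp X - ?S N"
    have *: "hat_exp X * Y - (Y + Z + (1/2) *\<^sub>C W) * hat_exp X
      = ?d (Suc (Suc N)) * Y - Y * ?d (Suc (Suc N)) - Z * ?d (Suc N) - (1/2) *\<^sub>C (W * ?d N)"
      by (simp only: left_diff_distrib right_diff_distrib S cvec.scale_right_diff_distrib
          distrib_right mult_scaleC_left) simp
    have d: "ord_ge (?d (Suc (Suc N))) (int N)" "ord_ge (?d (Suc N)) (int N)" "ord_ge (?d N) (int N)"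
      by (rule ord_ge_mono[OF apx], simp)+
    show "ord_ge (hat_exp X * Y - (Y + Z + (1/2) *\<^sub>C W) * hat_exp X) (int N + m)"
      unfolding *
      using ord_ge_mult[OF d(1) m(1)] ord_ge_mult[OF m(1) d(1)] ord_ge_mult[OF m(2) d(2)]
        ord_ge_mult[OF m(3) d(3)]
      by (simp only: add.commute[of m]) (intro ord_ge_diff ord_ge_scaleC)
  qed
  then show ?thesis by simp
qed

section \<open>Gradings by an inner derivation\<close>

text \<open>
  That the degree is an eigenvalue of an inner derivation passes from a Lie algebra to its
  enveloping algebra and to tensor products, and replaces a basis theorem in the proof that the
  homogeneous components are independent.  The second axiom says that every element is a sum of
  homogeneous ones, in the form of an induction rule.
\<close>

class inner_graded_lie_algebra = graded_lie_algebra +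
  assumes lie_homog_inner: "\<exists>h. \<forall>d. \<forall>x\<in>lie_homog d. lie h x = of_int d *\<^sub>C x"
    and lie_homog_total:
      "(\<And>d x. x \<in> lie_homog d \<Longrightarrow> P x) \<Longrightarrow> (\<And>x y. P x \<Longrightarrow> P y \<Longrightarrow> P (x + y)) \<Longrightarrow> P z"

class inner_graded_algebra = graded_algebra +
  assumes homog_zero: "0 \<in> homog d"
    and homog_add: "x \<in> homog d \<Longrightarrow> y \<in> homog d \<Longrightarrow> x + y \<in> homog d"
    and homog_scaleC: "x \<in> homog d \<Longrightarrow> c *\<^sub>C x \<in> homog d"
    and homog_one: "1 \<in> homog 0"
    and homog_mult: "x \<in> homog d \<Longrightarrow> y \<in> homog e \<Longrightarrow> x * y \<in> homog (d + e)"
    and homog_inner: "\<exists>h. \<forall>d. \<forall>x\<in>homog d. h * x - x * h = of_int d *\<^sub>C x"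
    and homog_total:
      "(\<And>d x. x \<in> homog d \<Longrightarrow> P x) \<Longrightarrow> (\<And>x y. P x \<Longrightarrow> P y \<Longrightarrow> P (x + y)) \<Longrightarrow> P z"

lemma homog_minus: "x \<in> homog d \<Longrightarrow> - x \<in> homog d" for x :: "'a::inner_graded_algebra"
  using homog_scaleC[of x d "-1"] by simp

lemma homog_diff: "x \<in> homog d \<Longrightarrow> y \<in> homog d \<Longrightarrow> x - y \<in> homog d" for x :: "'a::inner_graded_algebra"
  using homog_add[OF _ homog_minus, of x d y] by simp

lemma homog_sum: "(\<And>s. s \<in> S \<Longrightarrow> f s \<in> homog d) \<Longrightarrow> (\<Sum>s\<in>S. f s) \<in> homog d"
  for f :: "'b \<Rightarrow> 'a::inner_graded_algebra"
  by (induction S rule: infinite_finite_induct) (auto simp: homog_zero homog_add)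

text \<open>
  Components of different degrees are eigenvectors of \<open>ad h\<close> for different eigenvalues: applying
  \<open>ad h - e\<close> removes the component of degree \<open>e\<close> and rescales the others by nonzero factors.
\<close>

lemma homog_independent:
  fixes x :: "int \<Rightarrow> 'a::inner_graded_algebra"
  assumes "finite S" "\<And>d. d \<in> S \<Longrightarrow> x d \<in> homog d" "(\<Sum>d\<in>S. x d) = 0" "d \<in> S"
  shows "x d = 0"
  using assms
proof (induction S arbitrary: x d rule: finite_induct)
  case (insert e S)
  obtain h :: 'a where h: "\<And>d y. y \<in> homog d \<Longrightarrow> h * y - y * h = of_int d *\<^sub>C y"
    using homog_inner by blast
  have "(\<Sum>d\<in>insert e S. (of_int d - of_int e) *\<^sub>C x d)
    = (\<Sum>d\<in>insert e S. (h * x d - x d * h) - of_int e *\<^sub>C x d)"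
    by (rule sum.cong[OF refl]) (simp only: h[OF insert.prems(1)] cvec.scale_left_diff_distrib)
  also have "\<dots> = h * (\<Sum>d\<in>insert e S. x d) - (\<Sum>d\<in>insert e S. x d) * h - of_int e *\<^sub>C (\<Sum>d\<in>insert e S. x d)"
    by (simp only: sum_subtractf sum_distrib_left sum_distrib_right cvec.scale_sum_right)
  also have "\<dots> = 0" unfolding insert.prems(2) by simp
  finally have "(\<Sum>d\<in>S. (of_int d - of_int e) *\<^sub>C x d) = 0"
    using insert.hyps by simp
  then have "(of_int d - of_int e) *\<^sub>C x d = 0" if "d \<in> S" for d
    using insert.IH[of "\<lambda>d. (of_int d - of_int e) *\<^sub>C x d" d] insert.prems(1) that
    by (simp add: homog_scaleC)
  then have S: "x d = 0" if "d \<in> S" for d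
    using that insert.hyps by auto
  then have "x e = 0"
    using insert.prems(2) insert.hyps by simp
  with S insert.prems(3) show ?case by auto
qed simp

subsection \<open>The completion is an algebra\<close>

lemma completionD: "f \<in> completion \<Longrightarrow> f $$ d \<in> homog d"
  by (simp add: completion_def)

lemma completion_add: "f \<in> completion \<Longrightarrow> g \<in> completion \<Longrightarrow> f + g \<in> completion"
  for f :: "'a::inner_graded_algebra fls"
  by (simp add: completion_def homog_add)

lemma completion_scaleC: "f \<in> completion \<Longrightarrow> c *\<^sub>C f \<in> completion"
  for f :: "'a::inner_graded_algebra fls"
  by (simp add: completion_def homog_scaleC)

lemma completion_one: "(1 :: 'a::inner_graded_algebra fls) \<in> completion"
  by (simp add: completion_def homog_one homog_zero)

lemma completion_zero: "(0 :: 'a::inner_graded_algebra fls) \<in> completion"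
  by (simp add: completion_def homog_zero)

lemma completion_minus: "f \<in> completion \<Longrightarrow> - f \<in> completion"
  for f :: "'a::inner_graded_algebra fls"
  by (simp add: completion_def homog_minus)

lemma completion_diff: "f \<in> completion \<Longrightarrow> g \<in> completion \<Longrightarrow> f - g \<in> completion"
  for f :: "'a::inner_graded_algebra fls"
  by (simp add: completion_def homog_diff)

lemma completion_sum: "(\<And>i. i \<in> S \<Longrightarrow> f i \<in> completion) \<Longrightarrow> (\<Sum>i\<in>S. f i) \<in> completion"
  for f :: "'b \<Rightarrow> 'a::inner_graded_algebra fls"
  by (induction S rule: infinite_finite_induct) (auto simp: completion_zero completion_add)

lemma completion_mult:
  fixes f g :: "'a::inner_graded_algebra fls"
  assumes "f \<in> completion" "g \<in> completion"
  shows "f * g \<in> completion"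
proof -
  have "(f * g) $$ d \<in> homog d" for d
    unfolding times_nth_ord[OF ord_ge_subdegree ord_ge_subdegree]
  proof (rule homog_sum)
    fix i
    show "f $$ i * g $$ (d - i) \<in> homog d"
      using homog_mult[OF completionD[OF assms(1)] completionD[OF assms(2)], of i "d - i"] by simp
  qed
  then show ?thesis by (simp add: completion_def)
qed

lemma completion_power: "f \<in> completion \<Longrightarrow> f ^ n \<in> completion"
  for f :: "'a::inner_graded_algebra fls"
  by (induction n) (simp_all add: completion_one completion_mult)

lemma completion_psub:
  fixes x :: "'a::inner_graded_algebra fls"
  assumes "x \<in> completion" "ord_ge x 1"
  shows "psub c x \<in> completion"
proof -
  have "psub c x $$ d \<in> homog d" for d
    unfolding psub_def
    using assms by (subst ser_nth_nat)
      (auto intro!: psub_summable homog_sum homog_scaleC completionD[OF completion_power])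
  then show ?thesis by (simp add: completion_def)
qed

lemma completion_exp: "x \<in> completion \<Longrightarrow> ord_ge x 1 \<Longrightarrow> hat_exp x \<in> completion"
  for x :: "'a::inner_graded_algebra fls"
  by (simp add: hat_exp_psub completion_psub)

lemma completion_ln1p: "x \<in> completion \<Longrightarrow> ord_ge x 1 \<Longrightarrow> hat_ln1p x \<in> completion"
  for x :: "'a::inner_graded_algebra fls"
  by (simp add: hat_ln1p_psub completion_psub)

lemma completion_hat_map:
  assumes "f \<in> completion" "alg_hom \<phi>" "\<And>d x. x \<in> homog d \<Longrightarrow> \<phi> x \<in> homog d"
  shows "hat_map \<phi> f \<in> completion"
  using assms by (simp add: completion_def hat_map_nth_hom)

lemma hat_inverse_eq:
  fixes f g :: "'a::inner_graded_algebra fls"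
  assumes "g \<in> completion" "f * g = 1" "g * f = 1"
  shows "hat_inverse f = g"
  unfolding hat_inverse_def
proof (rule the_equality)
  fix g' assume "g' \<in> completion \<and> f * g' = 1 \<and> g' * f = 1"
  then have "g' = g' * (f * g)" "(g' * f) * g = g" using assms by auto
  then show "g' = g" by (simp add: mult.assoc)
qed (use assms in auto)

lemma hat_inverse:
  fixes f :: "'a::inner_graded_algebra fls"
  assumes "hat_invertible f"
  shows "hat_inverse f \<in> completion" "f * hat_inverse f = 1" "hat_inverse f * f = 1"
  using assms hat_inverse_eq unfolding hat_invertible_def by metis+

lemma hat_invertible_mult:
  fixes f g :: "'a::inner_graded_algebra fls"
  assumes "hat_invertible f" "hat_invertible g"
  shows "hat_invertible (f * g)" "hat_inverse (f * g) = hat_inverse g * hat_inverse f"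
proof -
  note f = hat_inverse[OF assms(1)] and g = hat_inverse[OF assms(2)]
  have "(f * g) * (hat_inverse g * hat_inverse f) = f * (g * hat_inverse g) * hat_inverse f"
    "(hat_inverse g * hat_inverse f) * (f * g) = hat_inverse g * (hat_inverse f * f) * g"
    by (simp_all only: mult.assoc)
  then have *: "(f * g) * (hat_inverse g * hat_inverse f) = 1" "(hat_inverse g * hat_inverse f) * (f * g) = 1"
    by (simp_all add: f g)
  show "hat_invertible (f * g)" "hat_inverse (f * g) = hat_inverse g * hat_inverse f"
    using * f(1) g(1) assms unfolding hat_invertible_def
    by (auto intro!: completion_mult hat_inverse_eq)
qed

lemma hat_inverse_exp:
  fixes x :: "'a::inner_graded_algebra fls"
  assumes "x \<in> completion" "ord_ge x 1"
  shows "hat_invertible (hat_exp x)" "hat_inverse (hat_exp x) = hat_exp (- x)"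
  using hat_exp_uminus[OF assms(2)] completion_exp[OF assms]
    completion_exp[OF completion_minus[OF assms(1)] ord_ge_minus[OF assms(2)]]
  by (auto simp: hat_invertible_def intro!: hat_inverse_eq)

lemma hat_inverse_one:
  "hat_invertible (1 :: 'a::inner_graded_algebra fls)" "hat_inverse (1 :: 'a::inner_graded_algebra fls) = 1"
  by (auto simp: hat_invertible_def completion_one intro!: hat_inverse_eq)

subsection \<open>The embedding into the completion\<close>

definition hmon :: "int \<Rightarrow> 'a::zero \<Rightarrow> 'a fls"
  where "hmon d u = Abs_fls (\<lambda>n. if n = d then u else 0)"

lemma hmon_nth [simp]: "hmon d u $$ n = (if n = d then u else 0)"
  by (simp add: hmon_def)

lemma hmon_mult: "hmon d u * hmon e v = hmon (d + e) (u * v)" for u v :: "'a::ring_1"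
proof (rule fls_eqI)
  fix n
  have o: "ord_ge (hmon d u) d" "ord_ge (hmon e v) e" by (simp_all add: ord_ge_def)
  have "(hmon d u * hmon e v) $$ n = (\<Sum>i=d..n - e. if i = d then (if n = d + e then u * v else 0) else 0)"
    unfolding times_nth_ord[OF o] by (intro sum.cong) auto
  then show "(hmon d u * hmon e v) $$ n = hmon (d + e) (u * v) $$ n"
    by simp
qed

definition decomp :: "'a::inner_graded_algebra fls \<Rightarrow> 'a \<Rightarrow> bool"
  where "decomp f u \<longleftrightarrow> f \<in> completion \<and> finite {d. f $$ d \<noteq> 0} \<and> (\<Sum>d | f $$ d \<noteq> 0. f $$ d) = u"

lemma decomp_superset:
  assumes "finite S" "\<And>d. d \<notin> S \<Longrightarrow> f $$ d = 0"
  shows "decomp f u \<longleftrightarrow> f \<in> completion \<and> (\<Sum>d\<in>S. f $$ d) = u"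
proof -
  have sub: "{d. f $$ d \<noteq> 0} \<subseteq> S" using assms(2) by blast
  then have "(\<Sum>d | f $$ d \<noteq> 0. f $$ d) = (\<Sum>d\<in>S. f $$ d)"
    using assms(1) by (intro sum.mono_neutral_left) auto
  with finite_subset[OF sub assms(1)] show ?thesis by (simp add: decomp_def)
qed

lemma decomp_add: "decomp f u \<Longrightarrow> decomp g v \<Longrightarrow> decomp (f + g) (u + v)"
proof -
  assume f: "decomp f u" and g: "decomp g v"
  let ?S = "{d. f $$ d \<noteq> 0} \<union> {d. g $$ d \<noteq> 0}"
  have "finite ?S" using f g by (simp add: decomp_def)
  with f g show ?thesis
    by (subst (asm) (1 2) decomp_superset[of ?S], simp, simp, simp, simp, subst decomp_superset[of ?S])
      (auto simp: sum.distrib completion_add)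
qed

lemma decomp_hmon: "u \<in> homog d \<Longrightarrow> decomp (hmon d u) u"
  by (subst decomp_superset[of "{d}"]) (auto simp: completion_def homog_zero)

lemma decomp_unique:
  assumes "decomp f u" "decomp g u"
  shows "f = g"
proof -
  let ?S = "{d. f $$ d \<noteq> 0} \<union> {d. g $$ d \<noteq> 0}"
  have fin: "finite ?S" using assms by (simp add: decomp_def)
  have *: "f \<in> completion" "g \<in> completion" "(\<Sum>d\<in>?S. f $$ d) = u" "(\<Sum>d\<in>?S. g $$ d) = u"
    using assms decomp_superset[OF fin, of f u] decomp_superset[OF fin, of g u] by auto
  have "f $$ d - g $$ d = 0" if "d \<in> ?S" for d
    by (rule homog_independent[OF fin _ _ that])
      (use * in \<open>auto simp: sum_subtractf intro: homog_diff completionD\<close>)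
  then have "f $$ d = g $$ d" for d
    by (cases "d \<in> ?S") auto
  then show ?thesis by (simp add: fls_eq_iff)
qed

lemma decomp_hat: "decomp (hat u) u"
proof -
  have "\<exists>f. decomp f u"
    by (induction u rule: homog_total) (blast intro: decomp_hmon decomp_add)+
  then have "\<exists>!f. decomp f u"
    using decomp_unique by blast
  then show ?thesis
    unfolding hat_def decomp_def[symmetric] by (rule theI')
qed

lemma hat_homog: "u \<in> homog d \<Longrightarrow> hat u = hmon d u" for u :: "'a::inner_graded_algebra"
  by (rule decomp_unique[OF decomp_hat decomp_hmon])

lemma hat_add: "hat (u + v) = hat u + hat v" for u :: "'a::inner_graded_algebra"
  by (rule decomp_unique[OF decomp_hat decomp_add[OF decomp_hat decomp_hat]])

lemma hat_completion: "hat u \<in> completion" for u :: "'a::inner_graded_algebra"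
  using decomp_hat[of u] by (simp add: decomp_def)

text \<open>
  Relations in the enveloping algebra become relations between series, whether or not the elements
  involved are homogeneous.
\<close>

lemma alg_hom_hat: "alg_hom (hat :: 'a::inner_graded_algebra \<Rightarrow> 'a fls)"
  unfolding alg_hom_def
proof (intro conjI allI clinearI)
  fix u v :: 'a and c
  show "hat (u + v) = hat u + hat v" by (rule hat_add)
  show "hat (c *\<^sub>C u) = c *\<^sub>C hat u"
  proof (induction u rule: homog_total)
    case (1 d u)
    then show ?case by (simp add: hat_homog[OF 1] hat_homog[OF homog_scaleC[OF 1]] fls_eq_iff)
  qed (simp add: hat_add scaleC_add_right)
  show "hat (1 :: 'a) = 1" by (simp add: hat_homog[OF homog_one] fls_eq_iff)
  show "hat (u * v) = hat u * hat v"
  proof (induction u rule: homog_total)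
    case u: (1 d u)
    show ?case
    proof (induction v rule: homog_total)
      case v: (1 e v)
      show ?case by (simp add: hat_homog[OF u] hat_homog[OF v] hat_homog[OF homog_mult[OF u v]] hmon_mult)
    qed (simp add: hat_add distrib_left)
  qed (simp add: hat_add distrib_right)
qed

lemmas hat_simps = alg_homD[OF alg_hom_hat] alg_hom_sum[OF alg_hom_hat]

lemma ord_ge_hat: "u \<in> homog d \<Longrightarrow> e \<le> d \<Longrightarrow> ord_ge (hat u) e" for u :: "'a::inner_graded_algebra"
  by (simp add: hat_homog ord_ge_def)

lemma hat_map_hat:
  fixes \<phi> :: "'a::inner_graded_algebra \<Rightarrow> 'b::inner_graded_algebra"
  assumes "alg_hom \<phi>" "\<And>d x. x \<in> homog d \<Longrightarrow> \<phi> x \<in> homog d"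
  shows "hat_map \<phi> (hat u) = hat (\<phi> u)"
proof (induction u rule: homog_total)
  case (1 d u)
  show ?case
    by (simp add: hat_homog[OF 1] hat_homog[OF assms(2)[OF 1]] fls_eq_iff hat_map_nth_hom[OF assms(1)] alg_homD[OF assms(1)])
qed (simp add: hat_add alg_homD[OF assms(1)] alg_homD[OF alg_hom_hat_map[OF assms(1)]])

subsection \<open>Gradings of enveloping algebras and tensor products\<close>

lemma tens_simps:
  "(a + a') \<otimes> b = a \<otimes> b + a' \<otimes> b" "a \<otimes> (b + b') = a \<otimes> b + a \<otimes> b'"
  "(a - a') \<otimes> b = a \<otimes> b - a' \<otimes> b" "a \<otimes> (b - b') = a \<otimes> b - a \<otimes> b'"
  "(c *\<^sub>C a) \<otimes> b = c *\<^sub>C (a \<otimes> b)" "a \<otimes> (c *\<^sub>C b) = c *\<^sub>C (a \<otimes> b)"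
  "0 \<otimes> b = 0" "a \<otimes> 0 = 0" "(- a) \<otimes> b = - (a \<otimes> b)" "a \<otimes> (- b) = - (a \<otimes> b)"
proof -
  have l: "clinear (\<lambda>a. a \<otimes> b)" and r: "clinear (\<lambda>b. a \<otimes> b)" for a :: 'a and b :: 'b
    using cbilinear_tens by (auto simp: cbilinear_def)
  show "(a + a') \<otimes> b = a \<otimes> b + a' \<otimes> b" "(a - a') \<otimes> b = a \<otimes> b - a' \<otimes> b"
    "(c *\<^sub>C a) \<otimes> b = c *\<^sub>C (a \<otimes> b)"
    by (rule clinear_add[OF l] clinear_diff[OF l] clinear_scaleC[OF l])+
  show "a \<otimes> (b + b') = a \<otimes> b + a \<otimes> b'" "a \<otimes> (b - b') = a \<otimes> b - a \<otimes> b'"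
    "a \<otimes> (c *\<^sub>C b) = c *\<^sub>C (a \<otimes> b)"
    by (rule clinear_add[OF r] clinear_diff[OF r] clinear_scaleC[OF r])+
  show 0: "0 \<otimes> b = 0" "a \<otimes> 0 = 0" for a :: 'a and b :: 'b
    by (rule clinear_zero[OF l] clinear_zero[OF r])+
  show "(- a) \<otimes> b = - (a \<otimes> b)"
    using clinear_diff[OF l, of 0 a b] by (simp add: 0)
  show "a \<otimes> (- b) = - (a \<otimes> b)"
    using clinear_diff[OF r, of a 0 b] by (simp add: 0)
qed

lemma tensor_induct [case_names tens add]:
  assumes "\<And>a b. P (a \<otimes> b)" "\<And>s t. P s \<Longrightarrow> P t \<Longrightarrow> P (s + t)"
  shows "P t"
proof -
  obtain p where "t = abs_tensor p" using tensor_abs_cases by blast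
  moreover have "P (abs_tensor p)"
  proof (induction p rule: poly_mapping_add_induct)
    case zero
    have "abs_tensor 0 = (0 \<otimes> 0 :: ('a, 'b) tensor)"
      by (simp add: tens_simps zero_tensor.abs_eq)
    then show ?case using assms(1) by metis
  next
    case (single k c)
    obtain a b where k: "k = Tpair a b" by (cases k)
    have "abs_tensor (Poly_Mapping.single k c) = c *\<^sub>C (a \<otimes> b)"
      by (simp add: k tens.abs_eq scaleC_tensor.abs_eq scaleC_single scaleC_complex_def)
    then show ?case using assms(1)[of "c *\<^sub>C a" b] by (simp add: tens_simps)
  next
    case (add p q)
    then show ?case using assms(2) by (simp add: plus_tensor.abs_eq[symmetric])
  qed
  ultimately show ?thesis by simp
qed

lemma uea_induct [case_names gen one add scaleC mult]:
  assumes "\<And>x. P (uea_gen x)" "P 1" "\<And>u v. P u \<Longrightarrow> P v \<Longrightarrow> P (u + v)"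
    "\<And>c u. P u \<Longrightarrow> P (c *\<^sub>C u)" "\<And>u v. P u \<Longrightarrow> P v \<Longrightarrow> P (u * v)"
  shows "P u"
proof -
  obtain p where "u = abs_uea p" using uea_abs_cases by blast
  moreover have "P (abs_uea p)"
  proof (induction p rule: poly_mapping_add_induct)
    case zero
    have "abs_uea 0 = 0 *\<^sub>C (1 :: 'a uea)"
      by (simp add: zero_uea.abs_eq)
    then show ?case using assms(2,4) by metis
  next
    case (single k c)
    have word: "P (abs_uea (Poly_Mapping.single (Fword xs) 1))" for xs
    proof (induction xs)
      case Nil
      have "abs_uea (Poly_Mapping.single (Fword []) 1) = (1 :: 'a uea)"
        by (simp add: one_uea.abs_eq zero_fword_def[symmetric])
      then show ?case using assms(2) by simp
    next
      case (Cons x xs)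
      have "abs_uea (Poly_Mapping.single (Fword (x # xs)) 1)
        = uea_gen x * abs_uea (Poly_Mapping.single (Fword xs) 1)"
        by (simp add: uea_gen.abs_eq times_uea.abs_eq letter_def mult_single plus_fword_def)
      then show ?case using assms(1,5) Cons by simp
    qed
    obtain xs where "k = Fword xs" by (cases k)
    then have "abs_uea (Poly_Mapping.single k c) = c *\<^sub>C abs_uea (Poly_Mapping.single (Fword xs) 1)"
      by (simp add: scaleC_uea.abs_eq scaleC_single scaleC_complex_def)
    then show ?case using assms(4) word by simp
  next
    case (add p q)
    then show ?case using assms(3) by (simp add: plus_uea.abs_eq[symmetric])
  qed
  ultimately show ?thesis by simp
qed

lemma cspan_mult_closed:
  fixes x y :: "'a::complex_algebra_1"
  assumes "x \<in> cspan S" "y \<in> cspan T" "\<And>s t. s \<in> S \<Longrightarrow> t \<in> T \<Longrightarrow> s * t \<in> cspan R"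
  shows "x * y \<in> cspan R"
  using assms(1)
proof (induction rule: cvec.span_induct_alt)
  case (step c s x)
  have "s * y \<in> cspan R"
    using assms(2)
  proof (induction rule: cvec.span_induct_alt)
    case (step c t y)
    then show ?case
      using assms(3)[OF \<open>s \<in> S\<close> step(1)]
      by (simp add: distrib_left mult_scaleC_right cvec.span_add cvec.span_scale)
  qed (simp add: cvec.span_zero)
  with step show ?case
    by (simp add: distrib_right mult_scaleC_left cvec.span_add cvec.span_scale)
qed (simp add: cvec.span_zero)

lemma ad_eigen_span:
  fixes h :: "'a::complex_algebra_1"
  assumes "x \<in> cspan S" "\<And>s. s \<in> S \<Longrightarrow> h * s - s * h = c *\<^sub>C s"
  shows "h * x - x * h = c *\<^sub>C x"
proof -
  have "h * x - x * h - c *\<^sub>C x = 0"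
    by (rule clinear_span_eq_0[OF _ _ assms(1)])
      (auto intro!: clinearI simp: assms(2) distrib_left distrib_right scaleC_add_right mult_scaleC_left
        mult_scaleC_right cvec.scale_right_diff_distrib scaleC_scaleC mult.commute)
  then show ?thesis by simp
qed

text \<open>
  This reduces the induction rule of the grading to a statement about a span, which can be proved by
  induction on an element of the enveloping algebra.
\<close>

lemma total_from_span:
  fixes H :: "int \<Rightarrow> 'a::complex_vector set"
  assumes "z \<in> cspan (\<Union>d. H d)" "\<And>d. cvec.subspace (H d)"
    "\<And>d x. x \<in> H d \<Longrightarrow> P x" "\<And>x y. P x \<Longrightarrow> P y \<Longrightarrow> P (x + y)"
  shows "P z"
  using assms(1)
proof (induction rule: cvec.span_induct_alt)
  case base
  show ?case using assms(3) cvec.subspace_0[OF assms(2)] by blast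
next
  case (step c x y)
  then show ?case using assms(3,4) cvec.subspace_scale[OF assms(2)] by blast
qed

lemma uea_gen_simps:
  fixes x y :: "'g::complex_lie_algebra"
  shows
  "uea_gen (x + y) = uea_gen x + uea_gen y" "uea_gen (c *\<^sub>C x) = c *\<^sub>C uea_gen x"
  "uea_gen (x - y) = uea_gen x - uea_gen y" "uea_gen (0 :: 'g) = 0" "uea_gen (- x) = - uea_gen x"
  "uea_gen (lie x y) = uea_gen x * uea_gen y - uea_gen y * uea_gen x"
proof -
  have l: "clinear (uea_gen :: 'g \<Rightarrow> 'g uea)" using lie_hom_uea_gen by (auto simp: lie_hom_def)
  show "uea_gen (x + y) = uea_gen x + uea_gen y" "uea_gen (c *\<^sub>C x) = c *\<^sub>C uea_gen x"
    "uea_gen (x - y) = uea_gen x - uea_gen y"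
    by (rule clinear_add[OF l] clinear_scaleC[OF l] clinear_diff[OF l])+
  show 0: "uea_gen (0 :: 'g) = 0" by (rule clinear_zero[OF l])
  show "uea_gen (- x) = - uea_gen x" using clinear_diff[OF l, of 0 x] by (simp add: 0)
  show "uea_gen (lie x y) = uea_gen x * uea_gen y - uea_gen y * uea_gen x"
    using lie_hom_uea_gen by (auto simp: lie_hom_def)
qed

lemma homog_uea_gen: "x \<in> lie_homog d \<Longrightarrow> uea_gen x \<in> homog d"
  unfolding homog_uea_def by (intro cvec.span_base CollectI exI[of _ "[x]"] exI[of _ "[d]"]) auto

instance uea :: (inner_graded_lie_algebra) inner_graded_algebra
proof
  let ?B = "\<lambda>d. {prod_list (map uea_gen xs) | xs ds.
    list_all2 (\<lambda>(x::'a) e. x \<in> lie_homog e) xs ds \<and> sum_list ds = d}"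
  fix x y z :: "'a uea" and c and d e :: int and P :: "'a uea \<Rightarrow> bool"
  show "0 \<in> (homog d :: 'a uea set)" by (simp add: homog_uea_def cvec.span_zero)
  show "x + y \<in> homog d" if "x \<in> homog d" "y \<in> homog d"
    using that by (simp add: homog_uea_def cvec.span_add)
  show "c *\<^sub>C x \<in> homog d" if "x \<in> homog d"
    using that by (simp add: homog_uea_def cvec.span_scale)
  show "1 \<in> (homog 0 :: 'a uea set)"
    unfolding homog_uea_def by (intro cvec.span_base CollectI exI[of _ "[]"]) auto
  show mult': "x * y \<in> homog (d + e)" if "x \<in> homog d" "y \<in> homog e" for x y :: "'a uea" and d e
    using that unfolding homog_uea_def
  proof (rule cspan_mult_closed, safe)
    fix xs ys and ds es :: "int list"
    assume "list_all2 (\<lambda>(x::'a) e. x \<in> lie_homog e) xs ds" "list_all2 (\<lambda>(x::'a) e. x \<in> lie_homog e) ys es"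
    then show "prod_list (map uea_gen xs) * prod_list (map uea_gen ys) \<in> cspan (?B (sum_list ds + sum_list es))"
      by (intro cvec.span_base CollectI exI[of _ "xs @ ys"] exI[of _ "ds @ es"])
        (auto intro: list_all2_appendI)
  qed
  obtain h :: 'a where h: "\<And>d x. x \<in> lie_homog d \<Longrightarrow> lie h x = of_int d *\<^sub>C x"
    using lie_homog_inner by blast
  show "\<exists>h. \<forall>d. \<forall>x\<in>homog d. h * x - x * h = of_int d *\<^sub>C (x :: 'a uea)"
  proof (intro exI[of _ "uea_gen h"] allI ballI)
    fix d and x :: "'a uea" assume "x \<in> homog d"
    then show "uea_gen h * x - x * uea_gen h = of_int d *\<^sub>C x"
      unfolding homog_uea_def
    proof (rule ad_eigen_span, safe)
      fix xs and ds :: "int list"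
      assume "list_all2 (\<lambda>(x::'a) e. x \<in> lie_homog e) xs ds"
      then show "uea_gen h * prod_list (map uea_gen xs) - prod_list (map uea_gen xs) * uea_gen h
        = of_int (sum_list ds) *\<^sub>C prod_list (map uea_gen xs)"
      proof (induction rule: list_all2_induct)
        case (Cons x xs d ds)
        let ?h = "uea_gen h" and ?x = "uea_gen x" and ?p = "prod_list (map uea_gen xs)"
        have "?h * (?x * ?p) - (?x * ?p) * ?h = (?h * ?x - ?x * ?h) * ?p + ?x * (?h * ?p - ?p * ?h)"
          by (simp add: algebra_simps)
        also have "\<dots> = of_int d *\<^sub>C (?x * ?p) + of_int (sum_list ds) *\<^sub>C (?x * ?p)"
        proof -
          have "?h * ?x - ?x * ?h = of_int d *\<^sub>C ?x"
            using uea_gen_simps(6)[of h x] by (simp add: h[OF Cons(1)] uea_gen_simps(2))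
          then show ?thesis by (simp add: Cons(3) scaleC_simps)
        qed
        finally show ?case by (simp add: scaleC_add_left)
      qed simp
    qed
  qed
  show "P z" if P: "\<And>d x. x \<in> homog d \<Longrightarrow> P x" "\<And>x y. P x \<Longrightarrow> P y \<Longrightarrow> P (x + y)"
  proof (rule total_from_span[where H = homog and z = z and P = P])
    let ?S = "cspan (\<Union>d. homog d) :: 'a uea set"
    show "cvec.subspace (homog d :: 'a uea set)" for d by (simp add: homog_uea_def)
    show "z \<in> ?S"
    proof (induction z rule: uea_induct)
      case (gen x)
      show ?case
      proof (induction x rule: lie_homog_total)
        case (1 d x)
        then show ?case by (intro cvec.span_base) (blast intro: homog_uea_gen)
      qed (simp add: uea_gen_simps cvec.span_add)
    next
      case one
      show ?case by (intro cvec.span_base) (use \<open>1 \<in> homog 0\<close> in blast)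
    next
      case (mult u v)
      then show ?case
      proof (rule cspan_mult_closed)
        fix s t :: "'a uea" assume "s \<in> (\<Union>d. homog d)" "t \<in> (\<Union>d. homog d)"
        then obtain d e where "s \<in> homog d" "t \<in> homog e" by blast
        then show "s * t \<in> ?S"
          by (intro cvec.span_base) (use mult' in blast)
      qed
    qed (auto intro: cvec.span_add cvec.span_scale)
  qed (use P in blast)+
qed

lemma homog_tens:
  "a \<in> homog i \<Longrightarrow> b \<in> homog j \<Longrightarrow> a \<otimes> b \<in> homog (i + j)"
  unfolding homog_tensor_def by (rule cvec.span_base) blast

lemma homog_tens_one:
  "a \<in> homog i \<Longrightarrow> a \<otimes> (1 :: 'b::inner_graded_algebra) \<in> homog i"
  "b \<in> homog i \<Longrightarrow> (1 :: 'a::inner_graded_algebra) \<otimes> b \<in> homog i"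
  using homog_tens[OF _ homog_one, of a i] homog_tens[OF homog_one, of b i] by auto

instance tensor :: (inner_graded_algebra, inner_graded_algebra) inner_graded_algebra
proof
  let ?B = "\<lambda>d. {a \<otimes> b | (a::'a) (b::'b) i j. a \<in> homog i \<and> b \<in> homog j \<and> i + j = d}"
  fix x y z :: "('a, 'b) tensor" and c and d e :: int and P :: "('a, 'b) tensor \<Rightarrow> bool"
  show "0 \<in> (homog d :: ('a, 'b) tensor set)" by (simp add: homog_tensor_def cvec.span_zero)
  show "x + y \<in> homog d" if "x \<in> homog d" "y \<in> homog d"
    using that by (simp add: homog_tensor_def cvec.span_add)
  show "c *\<^sub>C x \<in> homog d" if "x \<in> homog d"
    using that by (simp add: homog_tensor_def cvec.span_scale)
  show "1 \<in> (homog 0 :: ('a, 'b) tensor set)"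
    using homog_tens[OF homog_one homog_one] by (simp add: tens_one)
  show "x * y \<in> homog (d + e)" if "x \<in> homog d" "y \<in> homog e"
    using that unfolding homog_tensor_def
  proof (rule cspan_mult_closed, safe)
    fix a a' :: 'a and b b' :: 'b and i j i' j'
    assume "a \<in> homog i" "b \<in> homog j" "a' \<in> homog i'" "b' \<in> homog j'"
    then show "(a \<otimes> b) * (a' \<otimes> b') \<in> cspan (?B (i + j + (i' + j')))"
      by (intro cvec.span_base CollectI exI[of _ "a * a'"] exI[of _ "b * b'"] exI[of _ "i + i'"] exI[of _ "j + j'"])
        (auto simp: tens_mult homog_mult)
  qed
  obtain h :: 'a where h: "\<And>d x. x \<in> homog d \<Longrightarrow> h * x - x * h = of_int d *\<^sub>C x"
    using homog_inner by blast
  obtain k :: 'b where k: "\<And>d x. x \<in> homog d \<Longrightarrow> k * x - x * k = of_int d *\<^sub>C x"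
    using homog_inner by blast
  show "\<exists>h. \<forall>d. \<forall>x\<in>homog d. h * x - x * h = of_int d *\<^sub>C (x :: ('a, 'b) tensor)"
  proof (intro exI[of _ "h \<otimes> 1 + 1 \<otimes> k"] allI ballI)
    fix d and x :: "('a, 'b) tensor" assume "x \<in> homog d"
    then show "(h \<otimes> 1 + 1 \<otimes> k) * x - x * (h \<otimes> 1 + 1 \<otimes> k) = of_int d *\<^sub>C x"
      unfolding homog_tensor_def
    proof (rule ad_eigen_span, safe)
      fix a :: 'a and b :: 'b and i j assume a: "a \<in> homog i" and b: "b \<in> homog j"
      have "(h \<otimes> 1 + 1 \<otimes> k) * (a \<otimes> b) - a \<otimes> b * (h \<otimes> 1 + 1 \<otimes> k)
        = (h * a - a * h) \<otimes> b + a \<otimes> (k * b - b * k)"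
        by (simp add: tens_mult distrib_left distrib_right tens_simps)
      then show "(h \<otimes> 1 + 1 \<otimes> k) * (a \<otimes> b) - a \<otimes> b * (h \<otimes> 1 + 1 \<otimes> k) = of_int (i + j) *\<^sub>C (a \<otimes> b)"
        by (simp add: h[OF a] k[OF b] tens_simps scaleC_add_left)
    qed
  qed
  show "P z" if P: "\<And>d x. x \<in> homog d \<Longrightarrow> P x" "\<And>x y. P x \<Longrightarrow> P y \<Longrightarrow> P (x + y)"
  proof (induction z rule: tensor_induct)
    case (tens a b)
    show ?case
    proof (induction a rule: homog_total)
      case a: (1 i a)
      show ?case
        by (induction b rule: homog_total) (auto intro: P homog_tens[OF a] simp: tens_simps)
    qed (auto intro: P simp: tens_simps)
  qed (rule P)
qed

section \<open>Homomorphisms between tensor products\<close>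

lemma cbilinear_mult_hom:
  fixes f :: "'a::complex_algebra_1 \<Rightarrow> 'c::complex_algebra_1"
  assumes "clinear f" "clinear g"
  shows "cbilinear (\<lambda>a b. f a * g b)"
  unfolding cbilinear_def
  by (intro conjI allI clinearI)
    (simp_all add: clinear_add[OF assms(1)] clinear_add[OF assms(2)] clinear_scaleC[OF assms(1)]
      clinear_scaleC[OF assms(2)] distrib_left distrib_right mult_scaleC_left mult_scaleC_right)

text \<open>
  The universal property of the tensor product of algebras.  Every structure map below is put into
  this form, so that it is determined by its values on \<open>a \<otimes> 1\<close> and \<open>1 \<otimes> b\<close>.
\<close>

lemma alg_hom_tensor_lift:
  fixes f :: "'a::complex_algebra_1 \<Rightarrow> 'c::complex_algebra_1" and g :: "'b::complex_algebra_1 \<Rightarrow> 'c"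
  assumes f: "alg_hom f" and g: "alg_hom g" and com: "\<And>a b. f a * g b = g b * f a"
  shows "alg_hom (tensor_lift (\<lambda>a b. f a * g b))"
    and "tensor_lift (\<lambda>a b. f a * g b) (a \<otimes> b) = f a * g b"
proof -
  let ?F = "tensor_lift (\<lambda>a b. f a * g b)"
  have bil: "cbilinear (\<lambda>a b. f a * g b)"
    by (rule cbilinear_mult_hom) (simp_all add: alg_homD f g)
  have F_tens: "?F (a \<otimes> b) = f a * g b" for a b
    by (rule tensor_lift_tens[OF bil])
  then show "?F (a \<otimes> b) = f a * g b" .
  have lin: "clinear ?F" by (rule clinear_tensor_lift[OF bil])
  show "alg_hom ?F"
    unfolding alg_hom_def
  proof (intro conjI allI)
    show "?F 1 = 1" using F_tens[of 1 1] by (simp add: tens_one alg_homD f g)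
    fix s t
    show "?F (s * t) = ?F s * ?F t"
    proof (induction s rule: tensor_induct)
      case (tens a b)
      show ?case
      proof (induction t rule: tensor_induct)
        case (tens a' b')
        have "f a * f a' * (g b * g b') = f a * (f a' * g b) * g b'"
          by (simp only: mult.assoc)
        also have "\<dots> = (f a * g b) * (f a' * g b')"
          unfolding com[of a' b] by (simp only: mult.assoc)
        finally show ?case
          by (simp only: F_tens tens_mult alg_homD(3)[OF f] alg_homD(3)[OF g])
      qed (simp add: clinear_add[OF lin] distrib_left)
    qed (simp add: clinear_add[OF lin] distrib_right)
  qed (rule lin)
qed

lemma alg_hom_tensor_eqI:
  assumes "alg_hom \<phi>" "alg_hom \<psi>"
    "\<And>a. \<phi> (a \<otimes> 1) = \<psi> (a \<otimes> 1)" "\<And>b. \<phi> (1 \<otimes> b) = \<psi> (1 \<otimes> b)"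
  shows "\<phi> t = \<psi> t"
proof (induction t rule: tensor_induct)
  case (tens a b)
  have "a \<otimes> b = (a \<otimes> 1) * (1 \<otimes> b)" by (simp add: tens_mult)
  then show ?case by (simp only: alg_homD(3)[OF assms(1)] alg_homD(3)[OF assms(2)] assms(3,4))
qed (simp add: alg_homD(4)[OF assms(1)] alg_homD(4)[OF assms(2)])

lemma alg_hom_uea_eqI:
  assumes "alg_hom \<phi>" "alg_hom \<psi>" "\<And>x. \<phi> (uea_gen x) = \<psi> (uea_gen x)"
  shows "\<phi> u = \<psi> u"
  by (induction u rule: uea_induct)
    (simp_all add: assms(3) alg_homD[OF assms(1)] alg_homD[OF assms(2)])

lemma alg_hom_tens_one: "alg_hom (\<lambda>a. a \<otimes> 1)" "alg_hom (\<lambda>b. 1 \<otimes> b)"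
  unfolding alg_hom_def by (auto intro!: clinearI simp: tens_simps tens_mult tens_one)

lemma tens_split: "a \<otimes> b = (a \<otimes> 1) * (1 \<otimes> b)"
  by (simp add: tens_mult)

lemma tens_one_commute: "(a \<otimes> 1) * (1 \<otimes> b) = (1 \<otimes> b) * (a \<otimes> 1)"
  by (simp add: tens_mult)

definition ins1 :: "'a::complex_algebra_1 \<Rightarrow> (('a, 'b::complex_algebra_1) tensor, 'c::complex_algebra_1) tensor"
  where "ins1 a = (a \<otimes> 1) \<otimes> 1"
definition ins2 :: "'b::complex_algebra_1 \<Rightarrow> (('a::complex_algebra_1, 'b) tensor, 'c::complex_algebra_1) tensor"
  where "ins2 b = (1 \<otimes> b) \<otimes> 1"
definition ins3 :: "'c::complex_algebra_1 \<Rightarrow> (('a::complex_algebra_1, 'b::complex_algebra_1) tensor, 'c) tensor"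
  where "ins3 c = 1 \<otimes> c"

lemma alg_hom_ins: "alg_hom ins1" "alg_hom ins2" "alg_hom ins3"
  unfolding ins1_def[abs_def] ins2_def[abs_def] ins3_def[abs_def]
  by (rule alg_hom_comp[OF alg_hom_tens_one(1) alg_hom_tens_one(1)]
      alg_hom_comp[OF alg_hom_tens_one(1) alg_hom_tens_one(2)] alg_hom_tens_one(2))+

lemma ins_commute:
  "ins1 a * ins2 b = ins2 b * ins1 a" "ins1 a * ins3 c = ins3 c * ins1 a" "ins2 b * ins3 c = ins3 c * ins2 b"
  by (simp_all add: ins1_def ins2_def ins3_def tens_mult)

text \<open>
  The homomorphism out of a threefold tensor product with prescribed restrictions to the three
  legs; permutations of the legs are instances.
\<close>

definition tri where
  "tri e f g = tensor_lift (\<lambda>t c. tensor_lift (\<lambda>a b. e a * f b) t * g c)"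

lemma alg_hom_tri:
  assumes e: "alg_hom e" and f: "alg_hom f" and g: "alg_hom g"
    and "\<And>a b. e a * f b = f b * e a" "\<And>a c. e a * g c = g c * e a" "\<And>b c. f b * g c = g c * f b"
  shows "alg_hom (tri e f g)" "tri e f g (ins1 a) = e a" "tri e f g (ins2 b) = f b" "tri e f g (ins3 c) = g c"
proof -
  note ef = alg_hom_tensor_lift[OF e f assms(4)]
  have com: "tensor_lift (\<lambda>a b. e a * f b) t * g c = g c * tensor_lift (\<lambda>a b. e a * f b) t" for t c
  proof (induction t rule: tensor_induct)
    case (tens a b)
    have "e a * f b * g c = e a * g c * f b" by (simp only: assms(6) mult.assoc)
    also have "\<dots> = g c * (e a * f b)" by (simp only: assms(5) mult.assoc)
    finally show ?case by (simp only: ef)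
  qed (simp add: alg_homD[OF ef(1)] distrib_left distrib_right)
  note efg = alg_hom_tensor_lift[OF ef(1) g com]
  show "alg_hom (tri e f g)" unfolding tri_def by (rule efg)
  show "tri e f g (ins1 a) = e a" "tri e f g (ins2 b) = f b" "tri e f g (ins3 c) = g c"
    unfolding tri_def ins1_def ins2_def ins3_def efg(2) ef(2)
    by (simp_all add: alg_homD[OF ef(1)] alg_homD[OF e] alg_homD[OF f] alg_homD[OF g])
qed

lemma alg_hom_tensor_swap: "alg_hom tensor_swap"
  and tensor_swap_tens: "tensor_swap (a \<otimes> b) = b \<otimes> a"
proof -
  have *: "tensor_swap = tensor_lift (\<lambda>a b. (1 \<otimes> a) * (b \<otimes> 1))"
    unfolding tensor_swap_def by (simp add: tens_mult)
  note lift = alg_hom_tensor_lift[OF alg_hom_tens_one(2) alg_hom_tens_one(1) tens_one_commute[symmetric]]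
  show "alg_hom tensor_swap" unfolding * by (rule lift)
  show "tensor_swap (a \<otimes> b) = b \<otimes> a" unfolding * lift(2) by (simp add: tens_mult)
qed

lemma tensor_swap_swap: "tensor_swap (tensor_swap t) = t"
  by (induction t rule: tensor_induct) (simp_all add: tensor_swap_tens alg_homD[OF alg_hom_tensor_swap])

lemma homog_tensor_swap:
  fixes t :: "('a::inner_graded_algebra, 'b::inner_graded_algebra) tensor"
  assumes "t \<in> homog d"
  shows "tensor_swap t \<in> homog d"
  using assms unfolding homog_tensor_def[of d, where 'a = 'a]
proof (induction rule: cvec.span_induct_alt)
  case base
  show ?case unfolding alg_homD(6)[OF alg_hom_tensor_swap] by (rule homog_zero)
next
  case (step c x y)
  then obtain a b i j where "x = a \<otimes> b" "a \<in> homog i" "b \<in> homog j" "i + j = d" by blast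
  then have "tensor_swap x \<in> homog d"
    using homog_tens[of b j a i] by (simp add: tensor_swap_tens add.commute)
  with step show ?case
    by (simp add: alg_homD[OF alg_hom_tensor_swap] homog_add homog_scaleC)
qed

lemma alg_hom_tensor_assoc: "alg_hom tensor_assoc"
  and tensor_assoc_tens: "tensor_assoc (a \<otimes> (b \<otimes> c)) = (a \<otimes> b) \<otimes> c"
proof -
  let ?g = "tensor_lift (\<lambda>b c. ins2 b * ins3 c)"
  note g = alg_hom_tensor_lift[OF alg_hom_ins(2,3) ins_commute(3)]
  have com: "ins1 a * ?g t = ?g t * ins1 a" for a t
  proof (induction t rule: tensor_induct)
    case (tens b c)
    have "ins1 a * (ins2 b * ins3 c) = ins2 b * (ins3 c * ins1 a)"
      by (simp add: ins_commute(1) ins_commute(2)[symmetric] flip: mult.assoc)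
    then show ?case by (simp add: g mult.assoc)
  qed (simp add: alg_homD[OF g(1)] distrib_left distrib_right)
  note lift = alg_hom_tensor_lift[OF alg_hom_ins(1) g(1) com]
  have "tensor_lift (\<lambda>b c. (a \<otimes> b) \<otimes> c) t = ins1 a * ?g t" for a t
  proof -
    have eq: "(a \<otimes> b) \<otimes> c = ins1 a * (ins2 b * ins3 c)" for b c
      by (simp add: ins1_def ins2_def ins3_def tens_mult)
    have bil: "cbilinear (\<lambda>b c. (a \<otimes> b) \<otimes> c)"
      unfolding cbilinear_def by (intro conjI allI clinearI) (simp_all add: tens_simps)
    show ?thesis
    proof (induction t rule: tensor_induct)
      case (tens b c)
      show ?case unfolding tensor_lift_tens[OF bil] g(2) by (rule eq)
    qed (simp only: clinear_add[OF clinear_tensor_lift[OF bil]] alg_homD(4)[OF g(1)] distrib_left)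
  qed
  then have *: "tensor_assoc = tensor_lift (\<lambda>a t. ins1 a * ?g t)"
    unfolding tensor_assoc_def by (intro arg_cong[where f = tensor_lift] ext)
  show "alg_hom tensor_assoc" unfolding * by (rule lift)
  show "tensor_assoc (a \<otimes> (b \<otimes> c)) = (a \<otimes> b) \<otimes> c"
    unfolding * lift(2) g(2) by (simp add: ins1_def ins2_def ins3_def tens_mult)
qed

lemma alg_hom_comult: "alg_hom comult"
  unfolding alg_hom_def
  by (simp add: comult_one comult_mult) (simp add: comult_def clinear_uea_lift[OF lie_hom_comult])

lemma alg_hom_counit: "alg_hom counit"
  unfolding alg_hom_def
  by (simp add: counit_one counit_mult) (simp add: counit_def clinear_uea_lift[OF lie_hom_counit])

lemma tensor_swap_comult: "tensor_swap (comult u) = comult u"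
  by (rule alg_hom_uea_eqI[OF alg_hom_comp[OF alg_hom_tensor_swap alg_hom_comult] alg_hom_comult])
    (simp add: comult_gen alg_homD[OF alg_hom_tensor_swap] tensor_swap_tens add.commute)

lemma alg_hom_leg12: "alg_hom leg12" unfolding leg12_def[abs_def] by (rule alg_hom_tens_one)

lemma alg_hom_leg23: "alg_hom leg23"
  unfolding leg23_def[abs_def] by (rule alg_hom_comp[OF alg_hom_tensor_assoc alg_hom_tens_one(2)])

lemma leg_simps:
  "leg12 (a \<otimes> 1) = ins1 a" "leg12 (1 \<otimes> b) = ins2 b"
  "leg23 (a \<otimes> 1) = ins2 a" "leg23 (1 \<otimes> b) = ins3 b"
  by (simp_all add: leg12_def leg23_def tensor_assoc_tens ins1_def ins2_def ins3_def tens_one)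

lemma leg13: "alg_hom leg13" "leg13 (a \<otimes> 1) = ins1 a" "leg13 (1 \<otimes> b) = ins3 b"
proof -
  have *: "leg13 = tensor_lift (\<lambda>a b. ins1 a * ins3 b)"
    unfolding leg13_def by (simp add: ins1_def ins3_def tens_mult)
  note lift = alg_hom_tensor_lift[OF alg_hom_ins(1,3) ins_commute(2)]
  show "alg_hom leg13" unfolding * by (rule lift)
  show "leg13 (a \<otimes> 1) = ins1 a" "leg13 (1 \<otimes> b) = ins3 b"
    unfolding * lift(2) by (simp_all add: alg_homD[OF alg_hom_ins(1)] alg_homD[OF alg_hom_ins(3)])
qed

lemma leg12_ins3_commute: "leg12 t * ins3 c = ins3 c * leg12 t"
  by (simp add: leg12_def ins3_def tens_mult)

lemma leg23_ins1_commute: "leg23 t * ins1 a = ins1 a * leg23 t"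
proof (induction t rule: tensor_induct)
  case (tens b c)
  have "leg23 (b \<otimes> c) = (1 \<otimes> b) \<otimes> c" by (simp add: leg23_def tensor_assoc_tens)
  then show ?case by (simp add: ins1_def tens_mult)
qed (simp add: alg_homD[OF alg_hom_leg23] distrib_left distrib_right)

lemma comult_id: "alg_hom comult_id" "comult_id (a \<otimes> 1) = leg12 (comult a)" "comult_id (1 \<otimes> b) = ins3 b"
proof -
  have *: "comult_id = tensor_lift (\<lambda>a b. leg12 (comult a) * ins3 b)"
    unfolding comult_id_def by (simp add: leg12_def ins3_def tens_mult)
  note lift = alg_hom_tensor_lift[OF alg_hom_comp[OF alg_hom_leg12 alg_hom_comult] alg_hom_ins(3) leg12_ins3_commute]
  show "alg_hom comult_id" unfolding * by (rule lift)
  show "comult_id (a \<otimes> 1) = leg12 (comult a)" "comult_id (1 \<otimes> b) = ins3 b"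
    unfolding * lift(2) by (simp_all add: alg_homD[OF alg_hom_ins(3)] alg_homD[OF alg_hom_leg12] comult_one)
qed

lemma id_comult:
  fixes a b :: "'g::complex_lie_algebra uea"
  shows "alg_hom (id_comult :: 'g uea2 \<Rightarrow> 'g uea3)" "id_comult (a \<otimes> 1) = ins1 a" "id_comult (1 \<otimes> b) = leg23 (comult b)"
proof -
  have "tensor_assoc (a \<otimes> t) = ins1 a * leg23 t" for a :: "'g uea" and t :: "'g uea2"
    by (subst tens_split)
      (simp add: alg_homD[OF alg_hom_tensor_assoc] leg23_def ins1_def
        tensor_assoc_tens[of a 1 1, unfolded tens_one])
  then have *: "(id_comult :: 'g uea2 \<Rightarrow> 'g uea3) = tensor_lift (\<lambda>a b. ins1 a * leg23 (comult b))"
    unfolding id_comult_def by (intro arg_cong[where f = tensor_lift] ext)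
  note lift = alg_hom_tensor_lift[OF alg_hom_ins(1) alg_hom_comp[OF alg_hom_leg23 alg_hom_comult] leg23_ins1_commute[symmetric]]
  show "alg_hom (id_comult :: 'g uea2 \<Rightarrow> 'g uea3)" unfolding * by (rule lift)
  show "id_comult (a \<otimes> 1) = ins1 a" "id_comult (1 \<otimes> b) = leg23 (comult b)"
    unfolding * lift(2) by (simp_all add: alg_homD[OF alg_hom_ins(1)] alg_homD[OF alg_hom_leg23] comult_one)
qed

lemma
  fixes a b :: "'g::complex_lie_algebra uea"
  shows counit_id: "alg_hom (counit_id :: 'g::complex_lie_algebra uea2 \<Rightarrow> 'g uea)" "counit_id (a \<otimes> 1) = counit a *\<^sub>C 1" "counit_id (1 \<otimes> b) = b"
  and id_counit: "alg_hom (id_counit :: 'g uea2 \<Rightarrow> 'g uea)" "id_counit (a \<otimes> 1) = a" "id_counit (1 \<otimes> b) = counit b *\<^sub>C 1"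
proof -
  have eps: "alg_hom (\<lambda>a. counit a *\<^sub>C (1 :: 'g uea))"
    unfolding alg_hom_def
    by (auto intro!: clinearI simp: alg_homD[OF alg_hom_counit] scaleC_add_left scaleC_simps scaleC_complex_def)
  have id: "alg_hom (\<lambda>a::'g uea. a)"
    by (auto simp: alg_hom_def intro!: clinearI)
  have 1: "(counit_id :: 'g uea2 \<Rightarrow> 'g uea) = tensor_lift (\<lambda>a b. (counit a *\<^sub>C 1) * (b :: 'g uea))"
    "(id_counit :: 'g uea2 \<Rightarrow> 'g uea) = tensor_lift (\<lambda>a b. (a :: 'g uea) * (counit b *\<^sub>C 1))"
    unfolding counit_id_def id_counit_def by (simp_all add: scaleC_simps)
  have com: "(c *\<^sub>C 1) * b = b * (c *\<^sub>C (1 :: 'g uea))" for c b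
    by (simp add: scaleC_simps)
  note l1 = alg_hom_tensor_lift[OF eps id com] and l2 = alg_hom_tensor_lift[OF id eps com[symmetric]]
  show "alg_hom (counit_id :: 'g uea2 \<Rightarrow> 'g uea)" unfolding 1 by (rule l1)
  show "alg_hom (id_counit :: 'g uea2 \<Rightarrow> 'g uea)" unfolding 1 by (rule l2)
  show "counit_id (a \<otimes> 1) = counit a *\<^sub>C 1" "counit_id (1 \<otimes> b) = b"
    "id_counit (a \<otimes> 1) = a" "id_counit (1 \<otimes> b) = counit b *\<^sub>C 1"
    unfolding 1 l1(2) l2(2) by (simp_all add: counit_one scaleC_one)
qed

subsection \<open>Passage to completions\<close>

lemma fls_commute:
  fixes f g :: "'a::ring_1 fls"
  assumes "\<And>i j. f $$ i * g $$ j = g $$ j * f $$ i"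
  shows "f * g = g * f"
proof (rule fls_eqI)
  fix n
  let ?a = "fls_subdegree f" and ?b = "fls_subdegree g"
  show "(f * g) $$ n = (g * f) $$ n"
    unfolding times_nth_ord[OF ord_ge_subdegree ord_ge_subdegree]
    by (rule sum.reindex_bij_witness[where i = "\<lambda>i. n - i" and j = "\<lambda>i. n - i"]) (auto simp: assms)
qed

lemma hat_map_commute:
  assumes "alg_hom \<phi>" "alg_hom \<psi>" "\<And>a b. \<phi> a * \<psi> b = \<psi> b * \<phi> a"
  shows "hat_map \<phi> f * hat_map \<psi> g = hat_map \<psi> g * hat_map \<phi> f"
  by (rule fls_commute) (simp add: hat_map_nth_hom assms)

abbreviation inl :: "'a::complex_algebra_1 fls \<Rightarrow> ('a, 'b::complex_algebra_1) tensor fls"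
  where "inl \<equiv> hat_map (\<lambda>a. a \<otimes> 1)"
abbreviation inr :: "'b::complex_algebra_1 fls \<Rightarrow> ('a::complex_algebra_1, 'b) tensor fls"
  where "inr \<equiv> hat_map (\<lambda>b. 1 \<otimes> b)"

lemmas hat_hom_comult = alg_homD[OF alg_hom_hat_map[OF alg_hom_comult]]
lemmas hat_hom_inl = alg_homD[OF alg_hom_hat_map[OF alg_hom_tens_one(1)]]
lemmas hat_hom_inr = alg_homD[OF alg_hom_hat_map[OF alg_hom_tens_one(2)]]
lemmas hat_hom_ins1 = alg_homD[OF alg_hom_hat_map[OF alg_hom_ins(1)]]
lemmas hat_hom_ins2 = alg_homD[OF alg_hom_hat_map[OF alg_hom_ins(2)]]
lemmas hat_hom_ins3 = alg_homD[OF alg_hom_hat_map[OF alg_hom_ins(3)]]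
lemmas hat_hom_leg12 = alg_homD[OF alg_hom_hat_map[OF alg_hom_leg12]]
lemmas hat_hom_leg23 = alg_homD[OF alg_hom_hat_map[OF alg_hom_leg23]]
lemmas hat_hom_leg13 = alg_homD[OF alg_hom_hat_map[OF leg13(1)]]
lemmas hat_hom_comult_id = alg_homD[OF alg_hom_hat_map[OF comult_id(1)]]
lemmas hat_hom_id_comult = alg_homD[OF alg_hom_hat_map[OF id_comult(1)]]
lemmas hat_hom_swap = alg_homD[OF alg_hom_hat_map[OF alg_hom_tensor_swap]]

lemma hat_leg_simps:
  "hat_map leg12 (inl f) = hat_map ins1 f" "hat_map leg12 (inr f) = hat_map ins2 f"
  "hat_map leg23 (inl f) = hat_map ins2 f" "hat_map leg23 (inr f) = hat_map ins3 f"
  "hat_map comult_id (inl f) = hat_map leg12 (hat_map comult f)" "hat_map comult_id (inr f) = hat_map ins3 f"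
  "hat_map id_comult (inl f) = hat_map ins1 f" "hat_map id_comult (inr f) = hat_map leg23 (hat_map comult f)"
  "hat_map tensor_swap (inl f) = inr f" "hat_map tensor_swap (inr f) = inl f"
  by (simp_all add: hat_map_comp alg_hom_leg12 alg_hom_leg23 comult_id id_comult alg_hom_tens_one
      alg_hom_comult leg_simps alg_hom_tensor_swap tensor_swap_tens)

lemma inl_inr_commute: "inl f * inr g = inr g * inl f"
  by (rule hat_map_commute) (simp_all add: alg_hom_tens_one tens_one_commute)

lemma hat_ins_commute:
  "hat_map ins1 f * hat_map ins2 g = hat_map ins2 g * hat_map ins1 f"
  "hat_map ins1 f * hat_map ins3 g = hat_map ins3 g * hat_map ins1 f"
  "hat_map ins2 f * hat_map ins3 g = hat_map ins3 g * hat_map ins2 f"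
  by (intro hat_map_commute alg_hom_ins ins_commute)+

lemma hat_leg_ins_commute:
  "hat_map leg12 t * hat_map ins3 f = hat_map ins3 f * hat_map leg12 t"
  "hat_map leg23 t * hat_map ins1 f = hat_map ins1 f * hat_map leg23 t"
  by (intro hat_map_commute alg_hom_ins alg_hom_leg12 alg_hom_leg23 leg12_ins3_commute leg23_ins1_commute)+

lemma completion_inl:
  fixes f :: "'a::inner_graded_algebra fls"
  shows "f \<in> completion \<Longrightarrow> (inl f :: ('a, 'b::inner_graded_algebra) tensor fls) \<in> completion"
  by (rule completion_hat_map[OF _ alg_hom_tens_one(1) homog_tens_one(1)])

lemma completion_inr:
  fixes f :: "'b::inner_graded_algebra fls"
  shows "f \<in> completion \<Longrightarrow> (inr f :: ('a::inner_graded_algebra, 'b) tensor fls) \<in> completion"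
  by (rule completion_hat_map[OF _ alg_hom_tens_one(2) homog_tens_one(2)])

lemma completion_swap: "t \<in> completion \<Longrightarrow> hat_map tensor_swap t \<in> completion"
  for t :: "('a::inner_graded_algebra, 'b::inner_graded_algebra) tensor fls"
  by (rule completion_hat_map[OF _ alg_hom_tensor_swap homog_tensor_swap])

lemma hat_comult_gen: "hat_map comult (hat (uea_gen x)) = inl (hat (uea_gen x)) + inr (hat (uea_gen x))"
  for x :: "'g::inner_graded_lie_algebra"
proof (induction x rule: lie_homog_total)
  case (1 d x)
  show ?case
    by (simp add: fls_eq_iff hat_homog[OF homog_uea_gen[OF 1]] hat_map_nth_hom alg_hom_comult
        alg_hom_tens_one comult_gen alg_homD[OF alg_hom_comult] tens_simps)
qed (simp add: uea_gen_simps hat_add hat_hom_comult hat_hom_inl hat_hom_inr)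

lemma hat_counit_gen: "hat_map counit (hat (uea_gen x)) = 0"
  for x :: "'g::inner_graded_lie_algebra"
proof (induction x rule: lie_homog_total)
  case (1 d x)
  show ?case
    by (simp add: fls_eq_iff hat_homog[OF homog_uea_gen[OF 1]] hat_map_nth_hom alg_hom_counit
        counit_gen alg_homD[OF alg_hom_counit])
qed (simp add: uea_gen_simps hat_add alg_homD[OF alg_hom_hat_map[OF alg_hom_counit]])

section \<open>Composition of twists\<close>

text \<open>
  The bounds on the orders ensure that conjugation by \<open>F\<close> preserves positive order, and therefore
  commutes with the exponential and the logarithm.
\<close>

definition hat_unit :: "'a::inner_graded_algebra fls \<Rightarrow> bool"
  where "hat_unit F \<longleftrightarrow> hat_invertible F \<and> ord_ge F 0 \<and> ord_ge (hat_inverse F) 0"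

lemma hat_unitD:
  assumes "hat_unit F"
  shows "hat_invertible F" "F * hat_inverse F = 1" "hat_inverse F * F = 1" "ord_ge F 0" "ord_ge (hat_inverse F) 0"
    "F \<in> completion" "F * (hat_inverse F * x) = x" "hat_inverse F * (F * x) = x"
  using assms hat_inverse[of F] unfolding hat_unit_def hat_invertible_def
  by (auto simp flip: mult.assoc)

lemma hat_unit_exp: "x \<in> completion \<Longrightarrow> ord_ge x 1 \<Longrightarrow> hat_unit (hat_exp x)"
  by (simp add: hat_unit_def hat_inverse_exp ord_ge_hat_exp ord_ge_minus)

lemma hat_unit_mult:
  assumes "hat_unit F" "hat_unit G"
  shows "hat_unit (F * G)"
  using assms ord_ge_mult[of F 0 G 0] ord_ge_mult[of "hat_inverse G" 0 "hat_inverse F" 0]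
  by (simp add: hat_unit_def hat_invertible_mult)

lemma hat_unit_one: "hat_unit (1 :: 'a::inner_graded_algebra fls)"
  by (simp add: hat_unit_def hat_inverse_one ord_ge_one)

lemma ord_ge_conj:
  fixes u v x :: "'a::complex_algebra_1 fls"
  assumes "ord_ge u 0" "ord_ge v 0" "ord_ge x n"
  shows "ord_ge (u * x * v) n"
  using ord_ge_mult[OF ord_ge_mult[OF assms(1,3)] assms(2)] by simp

lemma conj_exp_ln:
  fixes u v x :: "'a::complex_algebra_1 fls"
  assumes "v * u = 1" "u * v = 1" "ord_ge u 0" "ord_ge v 0" "ord_ge x 1"
  shows "u * hat_exp x * v = hat_exp (u * x * v)" "u * hat_ln1p x * v = hat_ln1p (u * x * v)"
proof -
  note o = ord_ge_conj[OF assms(3,4,5)]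
  have "(u * x * v) * u = u * x" by (simp add: mult.assoc assms(1))
  then have "hat_exp (u * x * v) * u = u * hat_exp x" "hat_ln1p (u * x * v) * u = u * hat_ln1p x"
    by (auto intro!: hat_exp_intertwine hat_ln1p_intertwine o assms(5))
  then have "u * hat_exp x * v = hat_exp (u * x * v) * (u * v)" "u * hat_ln1p x * v = hat_ln1p (u * x * v) * (u * v)"
    by (simp_all add: mult.assoc[symmetric])
  then show "u * hat_exp x * v = hat_exp (u * x * v)" "u * hat_ln1p x * v = hat_ln1p (u * x * v)"
    by (simp_all add: assms(2))
qed

definition cocycle :: "'g::inner_graded_lie_algebra uea2 fls \<Rightarrow> bool"
  where "cocycle F \<longleftrightarrow> hat_map leg12 F * hat_map comult_id F = hat_map leg23 F * hat_map id_comult F"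

text \<open>
  The cocycle equation for \<open>J\<close> with respect to the coproduct \<open>\<Delta>\<^sub>F\<close>.
\<close>

definition cocycle_over :: "'g::inner_graded_lie_algebra uea2 fls \<Rightarrow> 'g uea2 fls \<Rightarrow> bool"
  where "cocycle_over F J \<longleftrightarrow>
    hat_map leg12 J * twisted_comult_id F J = hat_map leg23 J * id_twisted_comult F J"

lemma hat_map_unit:
  assumes "alg_hom \<phi>" "hat_unit F"
  shows "hat_map \<phi> F * hat_map \<phi> (hat_inverse F) = 1" "hat_map \<phi> (hat_inverse F) * hat_map \<phi> F = 1"
    "ord_ge (hat_map \<phi> F) 0" "ord_ge (hat_map \<phi> (hat_inverse F)) 0"
    "hat_map \<phi> F * (hat_map \<phi> (hat_inverse F) * x) = x" "hat_map \<phi> (hat_inverse F) * (hat_map \<phi> F * x) = x"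
proof -
  note h = alg_homD[OF alg_hom_hat_map[OF assms(1)]] and F = hat_unitD[OF assms(2)]
  show 1: "hat_map \<phi> F * hat_map \<phi> (hat_inverse F) = 1" "hat_map \<phi> (hat_inverse F) * hat_map \<phi> F = 1"
    by (simp_all add: h(3)[symmetric] F h(2))
  show "ord_ge (hat_map \<phi> F) 0" "ord_ge (hat_map \<phi> (hat_inverse F)) 0"
    using F alg_homD(6)[OF assms(1)] by (auto intro: ord_ge_hat_map)
  show "hat_map \<phi> F * (hat_map \<phi> (hat_inverse F) * x) = x" "hat_map \<phi> (hat_inverse F) * (hat_map \<phi> F * x) = x"
    by (simp_all add: 1 flip: mult.assoc)
qed

lemmas leg12_unit = hat_map_unit[OF alg_hom_leg12]
lemmas leg23_unit = hat_map_unit[OF alg_hom_leg23]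
text \<open>
  Writing \<open>(\<Delta>\<^sub>F \<otimes> id) J = F\<^sub>1\<^sub>2 (\<Delta> \<otimes> id) J F\<^sub>1\<^sub>2\<inverse>\<close>, the factors \<open>F\<^sub>1\<^sub>2\<inverse>\<close> and \<open>F\<^sub>1\<^sub>2\<close> cancel and the two
  cocycle equations stand side by side; likewise with \<open>F\<^sub>2\<^sub>3\<close>.
\<close>

lemma cocycle_compose:
  assumes "hat_unit F" "cocycle F" "cocycle_over F J"
  shows "cocycle (J * F)"
proof -
  let ?a = "hat_map leg12" and ?b = "hat_map leg23" and ?c = "hat_map comult_id" and ?d = "hat_map id_comult"
  have "?a (J * F) * ?c (J * F) = ?a J * twisted_comult_id F J * (?a F * ?c F)"
    by (simp add: twisted_comult_id_def hat_hom_leg12 hat_hom_comult_id mult.assoc leg12_unit[OF assms(1)])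
  also have "\<dots> = ?b J * id_twisted_comult F J * (?b F * ?d F)"
    using assms(2,3) by (simp add: cocycle_def cocycle_over_def)
  also have "\<dots> = ?b (J * F) * ?d (J * F)"
    by (simp add: id_twisted_comult_def hat_hom_leg23 hat_hom_id_comult mult.assoc leg23_unit[OF assms(1)])
  finally show ?thesis by (simp add: cocycle_def)
qed

lemma cocycle_over_one: "cocycle_over 1 J \<longleftrightarrow> cocycle J"
  by (simp add: cocycle_over_def cocycle_def twisted_comult_id_def id_twisted_comult_def
      hat_inverse_one hat_hom_leg12 hat_hom_leg23)

lemma alg_hom_conj:
  fixes u v :: "'b::complex_algebra_1"
  assumes "alg_hom \<phi>" "v * u = 1" "u * v = 1"
  shows "alg_hom (\<lambda>x. u * \<phi> x * v)"
  unfolding alg_hom_def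
proof (intro conjI clinearI allI)
  fix x y
  have "u * \<phi> x * v * (u * \<phi> y * v) = u * \<phi> x * (v * u) * \<phi> y * v" by (simp only: mult.assoc)
  then show "u * \<phi> (x * y) * v = u * \<phi> x * v * (u * \<phi> y * v)"
    by (simp add: alg_homD[OF assms(1)] assms(2) mult.assoc)
qed (simp_all add: alg_homD[OF assms(1)] distrib_left distrib_right scaleC_simps assms(3))

lemma alg_hom_twisted:
  assumes "hat_unit F"
  shows "alg_hom (twisted_comult F)" "alg_hom (twisted_comult_id F)" "alg_hom (id_twisted_comult F)"
  unfolding twisted_comult_def[abs_def] twisted_comult_id_def[abs_def] id_twisted_comult_def[abs_def]
  by (intro alg_hom_conj alg_hom_hat_map alg_hom_comult comult_id id_comult
      hat_unitD(2,3)[OF assms] leg12_unit(1,2)[OF assms] leg23_unit(1,2)[OF assms])+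

lemma twisted_exp_ln:
  assumes "hat_unit F"
  shows "ord_ge x 1 \<Longrightarrow> twisted_comult F (hat_exp x) = hat_exp (twisted_comult F x)"
    "ord_ge x 1 \<Longrightarrow> twisted_comult F (hat_ln1p x) = hat_ln1p (twisted_comult F x)"
    "ord_ge t 1 \<Longrightarrow> twisted_comult_id F (hat_exp t) = hat_exp (twisted_comult_id F t)"
    "ord_ge t 1 \<Longrightarrow> id_twisted_comult F (hat_exp t) = hat_exp (id_twisted_comult F t)"
  unfolding twisted_comult_def twisted_comult_id_def id_twisted_comult_def
  by (simp_all add: hat_map_exp hat_map_ln1p alg_hom_comult comult_id id_comult
      conj_exp_ln hat_unitD[OF assms] leg12_unit[OF assms] leg23_unit[OF assms] ord_ge_hat_map
      alg_homD[OF alg_hom_comult] alg_homD[OF comult_id(1)] alg_homD[OF id_comult(1)])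

lemma ord_ge_twisted_comult: "hat_unit F \<Longrightarrow> ord_ge x n \<Longrightarrow> ord_ge (twisted_comult F x) n"
  unfolding twisted_comult_def
  by (intro ord_ge_conj ord_ge_hat_map) (simp_all add: hat_unitD alg_homD[OF alg_hom_comult])

lemma twisted_legs:
  assumes "hat_unit F"
  shows "twisted_comult_id F (inl f) = hat_map leg12 (twisted_comult F f)"
    "twisted_comult_id F (inr f) = hat_map ins3 f"
    "id_twisted_comult F (inl f) = hat_map ins1 f"
    "id_twisted_comult F (inr f) = hat_map leg23 (twisted_comult F f)"
proof -
  show "twisted_comult_id F (inl f) = hat_map leg12 (twisted_comult F f)"
    "id_twisted_comult F (inr f) = hat_map leg23 (twisted_comult F f)"
    by (simp_all add: twisted_comult_id_def id_twisted_comult_def twisted_comult_def hat_leg_simps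
        hat_hom_leg12 hat_hom_leg23)
  show "twisted_comult_id F (inr f) = hat_map ins3 f" "id_twisted_comult F (inl f) = hat_map ins1 f"
    by (simp_all add: twisted_comult_id_def id_twisted_comult_def hat_leg_simps hat_leg_ins_commute
        mult.assoc leg12_unit[OF assms] leg23_unit[OF assms])
qed

lemma twisted_comult_mult:
  assumes "hat_unit J" "hat_unit F"
  shows "twisted_comult (J * F) x = J * twisted_comult F x * hat_inverse J"
  using assms by (simp add: twisted_comult_def hat_invertible_mult hat_unitD mult.assoc)

lemma twisted_comult_one: "twisted_comult 1 x = hat_map comult x"
  for x :: "'g::inner_graded_lie_algebra uea fls"
  by (simp add: twisted_comult_def hat_inverse_one)

lemma conj_eqI: "hat_unit J \<Longrightarrow> J * x = y * J \<Longrightarrow> J * x * hat_inverse J = y"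
  by (simp add: mult.assoc hat_unitD)

lemma completion_tens: "f \<in> completion \<Longrightarrow> g \<in> completion \<Longrightarrow> f \<otimes>\<^sub>c g \<in> completion"
  for f :: "'a::inner_graded_algebra fls" and g :: "'b::inner_graded_algebra fls"
  unfolding hat_tens_def by (intro completion_mult completion_inl completion_inr)

lemma ord_ge_inl_inr: "ord_ge f n \<Longrightarrow> ord_ge (inl f) n" "ord_ge f n \<Longrightarrow> ord_ge (inr f) n"
  by (auto intro!: ord_ge_hat_map simp: tens_simps)

lemma ord_ge_tens: "ord_ge f m \<Longrightarrow> ord_ge g n \<Longrightarrow> ord_ge (f \<otimes>\<^sub>c g) (m + n)"
  unfolding hat_tens_def by (intro ord_ge_mult ord_ge_inl_inr)

lemma hat_tens_mult: "(a \<otimes>\<^sub>c b) * (a' \<otimes>\<^sub>c b') = (a * a') \<otimes>\<^sub>c (b * b')"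
proof -
  have "(a \<otimes>\<^sub>c b) * (a' \<otimes>\<^sub>c b') = inl a * (inr b * inl a') * inr b'"
    by (simp only: hat_tens_def mult.assoc)
  also have "\<dots> = inl a * (inl a' * inr b) * inr b'" by (simp only: inl_inr_commute)
  also have "\<dots> = (a * a') \<otimes>\<^sub>c (b * b')"
    by (simp only: hat_tens_def hat_hom_inl hat_hom_inr mult.assoc)
  finally show ?thesis .
qed

lemma hat_tens_simps:
  "(a + a') \<otimes>\<^sub>c b = a \<otimes>\<^sub>c b + a' \<otimes>\<^sub>c b" "a \<otimes>\<^sub>c (b + b') = a \<otimes>\<^sub>c b + a \<otimes>\<^sub>c b'"
  "(a - a') \<otimes>\<^sub>c b = a \<otimes>\<^sub>c b - a' \<otimes>\<^sub>c b" "a \<otimes>\<^sub>c (b - b') = a \<otimes>\<^sub>c b - a \<otimes>\<^sub>c b'"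
  "(c *\<^sub>C a) \<otimes>\<^sub>c b = c *\<^sub>C (a \<otimes>\<^sub>c b)" "a \<otimes>\<^sub>c (c *\<^sub>C b) = c *\<^sub>C (a \<otimes>\<^sub>c b)"
  "0 \<otimes>\<^sub>c b = 0" "a \<otimes>\<^sub>c 0 = 0" "(- a) \<otimes>\<^sub>c b = - (a \<otimes>\<^sub>c b)" "a \<otimes>\<^sub>c (- b) = - (a \<otimes>\<^sub>c b)"
  by (simp_all add: hat_tens_def hat_hom_inl hat_hom_inr distrib_left distrib_right
      left_diff_distrib right_diff_distrib scaleC_simps)

lemma hat_tens_sum: "(\<Sum>i\<in>S. f i) \<otimes>\<^sub>c b = (\<Sum>i\<in>S. f i \<otimes>\<^sub>c b)" "a \<otimes>\<^sub>c (\<Sum>i\<in>S. f i) = (\<Sum>i\<in>S. a \<otimes>\<^sub>c f i)"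
  by (induction S rule: infinite_finite_induct) (simp_all add: hat_tens_simps)

lemma inl_inr_tens: "inl a = a \<otimes>\<^sub>c 1" "inr b = 1 \<otimes>\<^sub>c b"
  by (simp_all add: hat_tens_def hat_hom_inl hat_hom_inr)

definition tens3 where "tens3 a b c = hat_map ins1 a * hat_map ins2 b * hat_map ins3 c"

lemma tens3_mult: "tens3 a b c * tens3 a' b' c' = tens3 (a * a') (b * b') (c * c')"
proof -
  let ?x = "hat_map ins1" and ?y = "hat_map ins2" and ?z = "hat_map ins3"
  have "tens3 a b c * tens3 a' b' c' = ?x a * ?y b * (?z c * ?x a') * ?y b' * ?z c'"
    by (simp only: tens3_def mult.assoc)
  also have "\<dots> = ?x a * (?y b * ?x a') * (?z c * ?y b') * ?z c'"
    by (simp only: hat_ins_commute(2)[symmetric] mult.assoc)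
  also have "\<dots> = ?x a * ?x a' * (?y b * ?y b') * (?z c * ?z c')"
    by (simp only: hat_ins_commute(1)[symmetric] hat_ins_commute(3)[symmetric] mult.assoc)
  finally show ?thesis by (simp only: tens3_def hat_hom_ins1 hat_hom_ins2 hat_hom_ins3)
qed

lemma tens3_simps:
  "tens3 (a + a') b c = tens3 a b c + tens3 a' b c" "tens3 a (b + b') c = tens3 a b c + tens3 a b' c"
  "tens3 a b (c + c') = tens3 a b c + tens3 a b c'"
  "tens3 (a - a') b c = tens3 a b c - tens3 a' b c" "tens3 a (b - b') c = tens3 a b c - tens3 a b' c"
  "tens3 0 b c = 0" "tens3 a 0 c = 0" "tens3 a b 0 = 0" "tens3 a (- b) c = - tens3 a b c"
  by (simp_all add: tens3_def hat_hom_ins1 hat_hom_ins2 hat_hom_ins3 distrib_left distrib_right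
      left_diff_distrib right_diff_distrib)

lemma ins_tens3:
  "hat_map leg12 (a \<otimes>\<^sub>c b) = tens3 a b 1" "hat_map leg23 (a \<otimes>\<^sub>c b) = tens3 1 a b"
  "hat_map ins1 a = tens3 a 1 1" "hat_map ins2 a = tens3 1 a 1" "hat_map ins3 a = tens3 1 1 a"
  by (simp_all add: hat_tens_def tens3_def hat_hom_leg12 hat_hom_leg23 hat_leg_simps
      hat_hom_ins1 hat_hom_ins2 hat_hom_ins3)

lemma ord_ge_tens3: "ord_ge a l \<Longrightarrow> ord_ge b m \<Longrightarrow> ord_ge c n \<Longrightarrow> ord_ge (tens3 a b c) (l + m + n)"
  unfolding tens3_def
  by (intro ord_ge_mult ord_ge_hat_map) (simp_all add: alg_homD alg_hom_ins)

section \<open>Jordanian twists\<close>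

text \<open>
  An eigenvector of \<open>ad H\<close> with eigenvalue \<open>c\<close> satisfies \<open>(H \<otimes> s) A\<^sub>1 = A\<^sub>1 (H \<otimes> s + c s\<^sub>2)\<close>, so
  conjugation multiplies it by \<open>e\<^sup>c\<^sup>s\<close> in the second leg.
\<close>

lemma jordanian_intertwine:
  fixes H A s :: "'g::inner_graded_lie_algebra uea fls"
  assumes "ord_ge H 0" "ord_ge s 1" "H * A = A * H + c *\<^sub>C A"
  shows "hat_exp (H \<otimes>\<^sub>c s) * inl A = (A \<otimes>\<^sub>c hat_exp (c *\<^sub>C s)) * hat_exp (H \<otimes>\<^sub>c s)"
proof -
  have o: "ord_ge (H \<otimes>\<^sub>c s) 1" using ord_ge_tens[OF assms(1,2)] by simp
  have o': "ord_ge (c *\<^sub>C inr s :: 'g uea2 fls) 1"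
    by (intro ord_ge_scaleC ord_ge_inl_inr assms(2))
  have "(H \<otimes>\<^sub>c s) * inl A = inl A * (c *\<^sub>C inr s + H \<otimes>\<^sub>c s)"
    by (simp add: inl_inr_tens hat_tens_mult distrib_left assms(3) hat_tens_simps scaleC_simps add.commute)
  then have "hat_exp (H \<otimes>\<^sub>c s) * inl A = inl A * hat_exp (c *\<^sub>C inr s + H \<otimes>\<^sub>c s)"
    by (intro hat_exp_intertwine o ord_ge_add o')
  also have "hat_exp (c *\<^sub>C inr s + H \<otimes>\<^sub>c s) = hat_exp (c *\<^sub>C inr s) * hat_exp (H \<otimes>\<^sub>c s)"
    by (intro hat_exp_add o o') (simp add: inl_inr_tens hat_tens_mult scaleC_simps)
  also have "hat_exp (c *\<^sub>C inr s) = inr (hat_exp (c *\<^sub>C s))"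
    by (simp add: hat_map_exp alg_hom_tens_one ord_ge_scaleC assms(2) hat_hom_inr)
  finally show ?thesis by (simp add: hat_tens_def mult.assoc)
qed

lemma jordanian_commute:
  assumes "ord_ge H 0" "ord_ge s 1" "H * A = A * H" "s * B = B * s"
  shows "hat_exp (H \<otimes>\<^sub>c s) * (A \<otimes>\<^sub>c B) = (A \<otimes>\<^sub>c B) * hat_exp (H \<otimes>\<^sub>c s)"
  using ord_ge_tens[OF assms(1,2)]
  by (intro hat_exp_intertwine) (simp_all add: hat_tens_mult assms)

text \<open>
  Conjugation by \<open>J\<close> turns \<open>E\<^sub>1 + E\<^sub>2\<close> into \<open>E\<^sub>1 (1 + E\<^sub>2) + E\<^sub>2\<close>, that is, \<open>1 + E\<close> becomes group-like and
  \<open>\<sigma> = ln (1 + E)\<close> primitive.  In the cocycle equation, conjugation by \<open>J\<^sub>2\<^sub>3\<close> produces exactly this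
  coproduct of \<open>\<sigma>\<close>, and both sides become the product of \<open>exp (H\<^sub>1 \<sigma>\<^sub>2)\<close>, \<open>exp (H\<^sub>1 \<sigma>\<^sub>3)\<close> and
  \<open>exp (H\<^sub>2 \<sigma>\<^sub>3)\<close>.
\<close>

lemma jordanian_twist:
  fixes F :: "'g::inner_graded_lie_algebra uea2 fls"
  assumes F: "hat_unit F"
    and mem: "H \<in> completion" "E \<in> completion" and H: "ord_ge H 0" and E: "ord_ge E 1"
    and HE: "H * E = E * H + E"
    and tH: "twisted_comult F H = inl H + inr H" and tE: "twisted_comult F E = inl E + inr E"
  defines "J \<equiv> hat_exp (H \<otimes>\<^sub>c hat_ln1p E)"
  shows "hat_unit J"
    and "twisted_comult (J * F) (hat_ln1p E) = inl (hat_ln1p E) + inr (hat_ln1p E)"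
    and "cocycle_over F J"
proof -
  let ?s = "hat_ln1p E"
  have s: "ord_ge ?s 1" by (rule ord_ge_hat_ln1p[OF E])
  have Hs: "ord_ge (H \<otimes>\<^sub>c ?s) 1" using ord_ge_tens[OF H s] by simp
  show J: "hat_unit J"
    unfolding J_def by (intro hat_unit_exp completion_tens mem completion_ln1p E Hs)
  have "J * inl E = (E \<otimes>\<^sub>c (1 + E)) * J"
    unfolding J_def using jordanian_intertwine[OF H s, of E 1] HE
    by (simp add: scaleC_one hat_exp_ln1p E)
  moreover have "J * inr E = inr E * J"
    unfolding J_def inl_inr_tens
    by (rule jordanian_commute[OF H s]) (simp_all add: hat_ln1p_intertwine E)
  ultimately have "J * (inl E + inr E) = (E \<otimes>\<^sub>c (1 + E) + inr E) * J"
    by (simp add: distrib_left distrib_right)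
  then have "twisted_comult (J * F) E = E \<otimes>\<^sub>c (1 + E) + inr E"
    unfolding twisted_comult_mult[OF J F] tE by (rule conj_eqI[OF J])
  also have "\<dots> = inl E + inr E + inl E * inr E"
    by (simp add: hat_tens_def hat_hom_inr distrib_left)
  finally have "twisted_comult (J * F) ?s = hat_ln1p (inl E + inr E + inl E * inr E)"
    using twisted_exp_ln(2)[OF hat_unit_mult[OF J F] E] by simp
  also have "\<dots> = hat_ln1p (inl E) + hat_ln1p (inr E)"
    by (intro hat_ln1p_mult ord_ge_inl_inr E inl_inr_commute)
  finally show ts: "twisted_comult (J * F) ?s = inl ?s + inr ?s"
    by (simp add: hat_map_ln1p alg_hom_tens_one E)
  have o: "ord_ge (tens3 H 1 ?s) 1" "ord_ge (tens3 1 H ?s) 1" "ord_ge (tens3 H ?s 1) 1"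
    using ord_ge_tens3[OF H ord_ge_one s] ord_ge_tens3[OF ord_ge_one H s] ord_ge_tens3[OF H s ord_ge_one]
    by simp_all
  have "twisted_comult_id F J = hat_exp (hat_map leg12 (inl H + inr H) * hat_map ins3 ?s)"
    unfolding J_def twisted_exp_ln(3)[OF F Hs]
    by (simp add: hat_tens_def alg_homD[OF alg_hom_twisted(2)[OF F]] twisted_legs[OF F] tH)
  also have "hat_map leg12 (inl H + inr H) * hat_map ins3 ?s = tens3 H 1 ?s + tens3 1 H ?s"
    by (simp add: hat_hom_leg12 hat_leg_simps ins_tens3 distrib_right tens3_mult)
  also have "hat_exp \<dots> = hat_exp (tens3 H 1 ?s) * hat_exp (tens3 1 H ?s)"
    by (intro hat_exp_add o) (simp add: tens3_mult)
  finally have 1: "hat_map leg12 J * twisted_comult_id F J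
    = hat_exp (tens3 H ?s 1) * hat_exp (tens3 H 1 ?s) * hat_exp (tens3 1 H ?s)"
    by (simp add: J_def hat_map_exp alg_hom_leg12 Hs ins_tens3 mult.assoc)
  let ?J = "hat_map leg23 J" and ?J' = "hat_map leg23 (hat_inverse J)"
  have "id_twisted_comult F J = hat_exp (hat_map ins1 H * hat_map leg23 (twisted_comult F ?s))"
    unfolding J_def twisted_exp_ln(4)[OF F Hs]
    by (simp add: hat_tens_def alg_homD[OF alg_hom_twisted(3)[OF F]] twisted_legs[OF F])
  moreover have "ord_ge (hat_map ins1 H * hat_map leg23 (twisted_comult F ?s)) 1"
    using ord_ge_mult[OF ord_ge_hat_map[OF _ H] ord_ge_hat_map[OF _ ord_ge_twisted_comult[OF F s]], of ins1 leg23]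
    by (simp add: alg_homD(6)[OF alg_hom_ins(1)] alg_homD(6)[OF alg_hom_leg23])
  ultimately have "?J * id_twisted_comult F J * ?J' = hat_exp (?J * (hat_map ins1 H * hat_map leg23 (twisted_comult F ?s)) * ?J')"
    using conj_exp_ln(1)[of ?J' ?J] leg23_unit[OF J] by simp
  also have "?J * (hat_map ins1 H * hat_map leg23 (twisted_comult F ?s)) * ?J'
    = hat_map ins1 H * hat_map leg23 (twisted_comult (J * F) ?s)"
    unfolding twisted_comult_mult[OF J F]
    by (simp add: hat_hom_leg23 hat_leg_ins_commute flip: mult.assoc)
  also have "\<dots> = tens3 H ?s 1 + tens3 H 1 ?s"
    by (simp add: ts hat_hom_leg23 hat_leg_simps ins_tens3 distrib_left tens3_mult)
  also have "hat_exp \<dots> = hat_exp (tens3 H ?s 1) * hat_exp (tens3 H 1 ?s)"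
    by (intro hat_exp_add o) (simp add: tens3_mult)
  finally have "?J * id_twisted_comult F J * ?J' * ?J = hat_exp (tens3 H ?s 1) * hat_exp (tens3 H 1 ?s) * ?J"
    by simp
  then have "?J * id_twisted_comult F J = hat_exp (tens3 H ?s 1) * hat_exp (tens3 H 1 ?s) * ?J"
    by (simp add: mult.assoc leg23_unit[OF J])
  moreover have "?J = hat_exp (tens3 1 H ?s)"
    by (simp add: J_def hat_map_exp alg_hom_leg23 Hs ins_tens3)
  ultimately show "cocycle_over F J"
    using 1 by (simp add: cocycle_over_def)
qed

section \<open>Extensions of Jordanian twists\<close>

text \<open>
  The exponents \<open>q\<close> and \<open>w\<close> are central here, so \<open>exp p exp r = exp r exp p exp (w - q)\<close>, and the
  factor \<open>exp q\<close> on the left is traded for \<open>exp w\<close> on the right.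
\<close>

lemma exp_pentagon:
  fixes p q r w :: "'a::complex_algebra_1 fls"
  assumes o: "ord_ge p 1" "ord_ge q 1" "ord_ge r 1" "ord_ge w 1"
    and com: "p * q = q * p" "q * r = r * q" "w * p = p * w" "r * w = w * r" "q * w = w * q"
    and pr: "p * r = r * p + (w - q)"
  shows "hat_exp p * hat_exp (q + r) = hat_exp r * hat_exp (p + w)"
proof -
  have z: "p * (w - q) = (w - q) * p" by (simp add: algebra_simps com)
  have "hat_exp p * r = (r + (w - q)) * hat_exp p"
    using hat_exp_conj[OF o(1) pr, of 0] z by simp
  then have pr': "hat_exp (r + (w - q)) * hat_exp p = hat_exp p * hat_exp r"
    by (intro hat_exp_intertwine ord_ge_add ord_ge_diff o) simp
  have "hat_exp p * hat_exp (q + r) = hat_exp p * hat_exp q * hat_exp r"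
    by (simp add: hat_exp_add o com mult.assoc)
  also have "hat_exp p * hat_exp q = hat_exp q * hat_exp p"
  proof (intro hat_exp_intertwine o)
    have "hat_exp q * p = p * hat_exp q" by (intro hat_exp_intertwine o) (simp add: com)
    then show "p * hat_exp q = hat_exp q * p" by simp
  qed
  also have "hat_exp q * hat_exp p * hat_exp r = hat_exp q * hat_exp (r + (w - q)) * hat_exp p"
    by (simp only: mult.assoc pr')
  also have "hat_exp q * hat_exp (r + (w - q)) = hat_exp (q + (r + (w - q)))"
    by (intro hat_exp_add[symmetric] o ord_ge_add ord_ge_diff) (simp add: algebra_simps com)
  also have "q + (r + (w - q)) = r + w" by simp
  also have "hat_exp (r + w) * hat_exp p = hat_exp r * (hat_exp w * hat_exp p)"
    by (simp add: hat_exp_add o com mult.assoc)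
  also have "hat_exp w * hat_exp p = hat_exp (w + p)"
    by (intro hat_exp_add[symmetric] o com)
  finally show ?thesis by (simp add: add.commute)
qed

lemma sum_commutator:
  fixes f g :: "'i \<Rightarrow> 'a::ring"
  assumes "finite S" "\<And>i j. i \<in> S \<Longrightarrow> j \<in> S \<Longrightarrow> f i * g j = g j * f i + (if i = j then h j else 0)"
  shows "(\<Sum>i\<in>S. f i) * (\<Sum>j\<in>S. g j) = (\<Sum>j\<in>S. g j) * (\<Sum>i\<in>S. f i) + (\<Sum>j\<in>S. h j)"
proof -
  have "(\<Sum>i\<in>S. f i) * (\<Sum>j\<in>S. g j) = (\<Sum>j\<in>S. \<Sum>i\<in>S. f i * g j)"
    unfolding sum_product by (rule sum.swap)
  also have "\<dots> = (\<Sum>j\<in>S. \<Sum>i\<in>S. g j * f i + (if i = j then h j else 0))"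
    by (intro sum.cong refl assms)
  also have "\<dots> = (\<Sum>j\<in>S. g j) * (\<Sum>i\<in>S. f i) + (\<Sum>j\<in>S. h j)"
    using assms(1) by (simp add: sum.distrib sum_product)
  finally show ?thesis .
qed

lemma sum_commute:
  fixes f g :: "'i \<Rightarrow> 'a::ring"
  assumes "\<And>i j. i \<in> S \<Longrightarrow> j \<in> S \<Longrightarrow> f i * g j = g j * f i"
  shows "(\<Sum>i\<in>S. f i) * (\<Sum>j\<in>S. g j) = (\<Sum>j\<in>S. g j) * (\<Sum>i\<in>S. f i)"
  unfolding sum_product by (subst sum.swap) (intro sum.cong refl assms)

section \<open>An extended twist followed by a second Jordanian twist\<close>

lemma commute_mult: "a * x = x * a \<Longrightarrow> a * y = y * a \<Longrightarrow> a * (x * y) = x * y * a"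
  for a x y :: "'a::semigroup_mult"
  by (metis mult.assoc)

definition primitive :: "'g::inner_graded_lie_algebra uea fls \<Rightarrow> bool"
  where "primitive x \<longleftrightarrow> x \<in> completion \<and> hat_map comult x = inl x + inr x \<and> hat_map counit x = 0"

text \<open>
  The commutation relations that make a link a twist.  \<open>A i\<close> and \<open>B i\<close> are dual to each other in a
  Heisenberg algebra with central element \<open>E\<close>, and \<open>ad D\<close> maps the dual of \<open>A i\<close> back to the \<open>A\<close>'s
  through the involution \<open>r\<close>, which describes an invariant bilinear form.
\<close>

locale twist_link =
  fixes Hp Hm E D :: "'g::inner_graded_lie_algebra uea fls" and A B :: "'i \<Rightarrow> 'g uea fls"
    and S :: "'i set" and r :: "'i \<Rightarrow> 'i"
  assumes fin: "finite S" and r_in: "i \<in> S \<Longrightarrow> r i \<in> S" and r_r: "i \<in> S \<Longrightarrow> r (r i) = i"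
    and prim: "primitive Hp" "primitive Hm" "primitive E" "primitive D"
      "i \<in> S \<Longrightarrow> primitive (A i)" "i \<in> S \<Longrightarrow> primitive (B i)"
    and ord: "ord_ge Hp 0" "ord_ge Hm 0" "ord_ge E 1" "ord_ge D 1"
      "i \<in> S \<Longrightarrow> ord_ge (A i) 1" "i \<in> S \<Longrightarrow> ord_ge (B i) 1"
    and Hp: "Hp * E = E * Hp + E" "Hp * D = D * Hp" "Hp * Hm = Hm * Hp"
      "i \<in> S \<Longrightarrow> Hp * A i = A i * Hp + (1/2) *\<^sub>C A i"
      "i \<in> S \<Longrightarrow> Hp * B i = B i * Hp + (1/2) *\<^sub>C B i"
    and Hm: "Hm * D = D * Hm + D"
      "i \<in> S \<Longrightarrow> Hm * A i = A i * Hm + (1/2) *\<^sub>C A i"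
      "i \<in> S \<Longrightarrow> Hm * B i = B i * Hm - (1/2) *\<^sub>C B i"
    and E_central: "E * Hm = Hm * E" "E * D = D * E" "i \<in> S \<Longrightarrow> E * A i = A i * E" "i \<in> S \<Longrightarrow> E * B i = B i * E"
    and AA: "i \<in> S \<Longrightarrow> j \<in> S \<Longrightarrow> A i * A j = A j * A i"
    and BB: "i \<in> S \<Longrightarrow> j \<in> S \<Longrightarrow> B i * B j = B j * B i"
    and AB: "i \<in> S \<Longrightarrow> j \<in> S \<Longrightarrow> A i * B j = B j * A i + (if i = j then E else 0)"
    and DA: "i \<in> S \<Longrightarrow> D * A i = A i * D"
    and DB: "i \<in> S \<Longrightarrow> D * B i = B i * D - A (r i)"
begin

text \<open>
  In the usual notation \<open>t\<close> and \<open>t'\<close> are \<open>e\<^sup>\<sigma>\<^sup>/\<^sup>2\<close> and \<open>e\<^sup>-\<^sup>\<sigma>\<^sup>/\<^sup>2\<close>, and \<open>Q\<close> is \<open>I\<^sup>1\<close>.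
\<close>

definition "s = hat_ln1p E"
definition "t = hat_exp ((1/2) *\<^sub>C s)"
definition "t' = hat_exp ((- 1/2) *\<^sub>C s)"
definition "b i = B i * t'"
definition "X = (\<Sum>i\<in>S. A i \<otimes>\<^sub>c b i)"
definition "Q = (1/2) *\<^sub>C (\<Sum>i\<in>S. A i * A (r i))"
definition "J1 = hat_exp (Hp \<otimes>\<^sub>c s)"
definition "G = D - Q"
definition "J2 = hat_exp (Hm \<otimes>\<^sub>c hat_ln1p G)"

lemma mem: "Hp \<in> completion" "Hm \<in> completion" "E \<in> completion" "D \<in> completion"
  "i \<in> S \<Longrightarrow> A i \<in> completion" "i \<in> S \<Longrightarrow> B i \<in> completion"
  using prim by (auto simp: primitive_def)

lemma comult: "hat_map comult Hp = inl Hp + inr Hp" "hat_map comult Hm = inl Hm + inr Hm"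
  "hat_map comult E = inl E + inr E" "hat_map comult D = inl D + inr D"
  "i \<in> S \<Longrightarrow> hat_map comult (A i) = inl (A i) + inr (A i)"
  "i \<in> S \<Longrightarrow> hat_map comult (B i) = inl (B i) + inr (B i)"
  using prim by (auto simp: primitive_def)

lemma s_ord: "ord_ge s 1" "ord_ge (c *\<^sub>C s) 1"
  unfolding s_def by (intro ord_ge_scaleC ord_ge_hat_ln1p ord)+

lemma t_ord: "ord_ge t 0" "ord_ge t' 0"
  unfolding t_def t'_def by (intro ord_ge_hat_exp s_ord)+

lemma t_mem: "s \<in> completion" "t \<in> completion" "t' \<in> completion"
proof -
  show "s \<in> completion" unfolding s_def by (intro completion_ln1p mem ord)
  then show "t \<in> completion" "t' \<in> completion"
    unfolding t_def t'_def by (auto intro!: completion_exp completion_minus completion_scaleC ord_ge_minus s_ord)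
qed

lemma commute_E:
  assumes "E * x = x * E"
  shows "s * x = x * s" "t * x = x * t" "t' * x = x * t'"
proof -
  show s: "s * x = x * s" unfolding s_def by (intro hat_ln1p_intertwine ord assms)
  show "t * x = x * t" "t' * x = x * t'"
    unfolding t_def t'_def by (intro hat_exp_intertwine s_ord; simp add: scaleC_simps s)+
qed

lemma t_t': "t * t' = 1" "t' * t = 1" "E * t' = t - t'" "E * t = t * E" "E * t' = t' * E"
proof -
  have m: "(- 1/2) *\<^sub>C s = - ((1/2) *\<^sub>C s)" by simp
  show tt': "t * t' = 1" "t' * t = 1"
    unfolding t_def t'_def m by (intro hat_exp_uminus s_ord)+
  have "t * t = hat_exp ((1/2) *\<^sub>C s + (1/2) *\<^sub>C s)"
    unfolding t_def by (intro hat_exp_add[symmetric] s_ord) simp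
  also have "(1/2) *\<^sub>C s + (1/2) *\<^sub>C s = s"
    by (simp add: scaleC_add_left[symmetric] scaleC_one)
  also have "hat_exp s = 1 + E" unfolding s_def by (rule hat_exp_ln1p[OF ord(3)])
  finally have "(1 + E) * t' = t" by (metis mult.assoc mult_1_right tt'(1))
  then show "E * t' = t - t'" by (simp add: algebra_simps)
  show "E * t = t * E" "E * t' = t' * E" using commute_E[of E] by simp_all
qed

lemma b_rel:
  assumes i: "i \<in> S" and j: "j \<in> S"
  shows "b i * A j = A j * b i - (if i = j then t - t' else 0)"
    and "b i * b j = b j * b i" "b i * D = D * b i + A (r i) * t'" "Hm * b i = b i * Hm - (1/2) *\<^sub>C b i"
    and "E * b i = b i * E"
proof -
  note c = commute_E[OF E_central(3)] commute_E[OF E_central(4)] commute_E[OF E_central(2)] commute_E[OF E_central(1)]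
  have "b i * A j = B i * A j * t'" by (simp add: b_def c(3)[OF j] mult.assoc)
  also have "B i * A j = A j * B i - (if i = j then E else 0)" using AB[OF j i] by auto
  finally show "b i * A j = A j * b i - (if i = j then t - t' else 0)"
    by (simp add: b_def left_diff_distrib mult.assoc t_t')
  have "b i * b j = B i * B j * (t' * t')" if "i \<in> S" "j \<in> S" for i j
  proof -
    have "b i * b j = B i * (t' * B j) * t'" by (simp only: b_def mult.assoc)
    then show ?thesis by (simp only: c(6)[OF that(2)] mult.assoc)
  qed
  from this[OF i j] this[OF j i] show "b i * b j = b j * b i" using BB[OF i j] by simp
  have "b i * D = B i * D * t'" by (simp add: b_def c mult.assoc)
  also have "B i * D = D * B i + A (r i)" using DB[OF i] by simp
  finally show "b i * D = D * b i + A (r i) * t'" by (simp add: b_def distrib_right mult.assoc)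
  have "Hm * b i = (B i * Hm - (1/2) *\<^sub>C B i) * t'"
    by (simp only: b_def Hm(3)[OF i, symmetric] mult.assoc)
  also have "\<dots> = B i * (Hm * t') - (1/2) *\<^sub>C b i"
    by (simp only: left_diff_distrib b_def mult.assoc mult_scaleC_left)
  also have "Hm * t' = t' * Hm" by (simp only: c)
  finally show "Hm * b i = b i * Hm - (1/2) *\<^sub>C b i" by (simp only: b_def mult.assoc)
  show "E * b i = b i * E" unfolding b_def by (intro commute_mult E_central i t_t')
qed

lemma b_ord: "i \<in> S \<Longrightarrow> ord_ge (b i) 1" and b_mem: "i \<in> S \<Longrightarrow> b i \<in> completion"
  unfolding b_def by (intro ord_ge_mult_nonneg(2) completion_mult t_ord t_mem ord mem; assumption)+

lemma X_ord: "ord_ge X 1" and X_mem: "X \<in> completion"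
  unfolding X_def using ord_ge_mono[OF ord_ge_tens[OF ord(5) b_ord]]
  by (auto intro!: ord_ge_sum completion_sum completion_tens mem b_mem)

lemma K: "hat_unit (hat_exp X)" by (intro hat_unit_exp X_ord X_mem)

subsection \<open>The Jordanian factor\<close>

lemma J1: "hat_unit J1" "twisted_comult J1 s = inl s + inr s" "cocycle J1"
  using jordanian_twist[OF hat_unit_one mem(1,3) ord(1,3) Hp(1)]
  by (simp_all add: J1_def s_def twisted_comult_one comult cocycle_over_one)

lemma twisted_J1: "hat_map comult x = inl x + inr x \<Longrightarrow> J1 * inl x = y * J1 \<Longrightarrow> E * x = x * E
   \<Longrightarrow> twisted_comult J1 x = y + inr x"
proof -
  assume x: "hat_map comult x = inl x + inr x" "J1 * inl x = y * J1" "E * x = x * E"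
  have "J1 * inr x = inr x * J1"
    unfolding J1_def inl_inr_tens by (rule jordanian_commute[OF ord(1) s_ord(1)]) (simp_all add: commute_E(1)[OF x(3)])
  with x have "J1 * (inl x + inr x) = (y + inr x) * J1" by (simp add: distrib_left distrib_right)
  then show ?thesis
    unfolding twisted_comult_def x(1) by (rule conj_eqI[OF J1(1)])
qed

lemma twisted_J1_simps:
  "twisted_comult J1 D = inl D + inr D" "twisted_comult J1 Hm = inl Hm + inr Hm"
  "i \<in> S \<Longrightarrow> twisted_comult J1 (A i) = A i \<otimes>\<^sub>c t + inr (A i)"
  "i \<in> S \<Longrightarrow> twisted_comult J1 (b i) = inl (b i) + t' \<otimes>\<^sub>c b i"
proof -
  have "J1 * inl D = inl D * J1" "J1 * inl Hm = inl Hm * J1"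
    unfolding J1_def inl_inr_tens by (rule jordanian_commute[OF ord(1) s_ord(1)]; simp add: Hp)+
  then show "twisted_comult J1 D = inl D + inr D" "twisted_comult J1 Hm = inl Hm + inr Hm"
    by (auto intro!: twisted_J1 comult E_central)
  show "twisted_comult J1 (A i) = A i \<otimes>\<^sub>c t + inr (A i)" if "i \<in> S"
    unfolding t_def J1_def[symmetric] using that
    by (intro twisted_J1 comult E_central jordanian_intertwine[OF ord(1) s_ord(1) Hp(4), folded J1_def])
  assume i: "i \<in> S"
  have B: "twisted_comult J1 (B i) = B i \<otimes>\<^sub>c t + inr (B i)"
    unfolding t_def J1_def[symmetric] using i
    by (intro twisted_J1 comult E_central jordanian_intertwine[OF ord(1) s_ord(1) Hp(5), folded J1_def])
  have "twisted_comult J1 t' = hat_exp (inl ((- 1/2) *\<^sub>C s) + inr ((- 1/2) *\<^sub>C s))"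
    unfolding t'_def twisted_exp_ln(1)[OF J1(1) s_ord(2)]
    by (simp only: alg_homD(7)[OF alg_hom_twisted(1)[OF J1(1)]] J1(2) hat_hom_inl(7) hat_hom_inr(7) scaleC_add_right)
  also have "\<dots> = t' \<otimes>\<^sub>c t'"
    unfolding hat_tens_def t'_def
    by (simp only: hat_map_exp alg_hom_tens_one s_ord(2))
      (intro hat_exp_add ord_ge_inl_inr s_ord inl_inr_commute)
  finally have "twisted_comult J1 (b i) = (B i \<otimes>\<^sub>c t + inr (B i)) * (t' \<otimes>\<^sub>c t')"
    unfolding b_def alg_homD(3)[OF alg_hom_twisted(1)[OF J1(1)]] B by simp
  also have "\<dots> = inl (b i) + t' \<otimes>\<^sub>c b i"
    by (simp add: inl_inr_tens distrib_right hat_tens_mult t_t' b_def)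
  finally show "twisted_comult J1 (b i) = inl (b i) + t' \<otimes>\<^sub>c b i" .
qed

subsection \<open>The extension factor\<close>

text \<open>
  With \<open>b = B t'\<close> the coproduct twisted by the Jordanian factor is \<open>A \<otimes> t + 1 \<otimes> A\<close> on \<open>A\<close> and
  \<open>b \<otimes> 1 + t' \<otimes> b\<close> on \<open>b\<close>.  The exponents \<open>p = A \<otimes> b \<otimes> 1\<close>, \<open>q = A \<otimes> t \<otimes> b\<close>, \<open>r = 1 \<otimes> A \<otimes> b\<close> and
  \<open>w = A \<otimes> t' \<otimes> b\<close> (summed over the index) then satisfy the hypotheses of \<open>exp_pentagon\<close>, because
  \<open>[b i, A i] = - E t' = t' - t\<close>.
\<close>

lemma extension_cocycle: "cocycle_over J1 (hat_exp X)"
proof -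
  define p q r w :: "'g uea3 fls" where "p = (\<Sum>i\<in>S. tens3 (A i) (b i) 1)" and "q = (\<Sum>i\<in>S. tens3 (A i) t (b i))"
    and "r = (\<Sum>i\<in>S. tens3 1 (A i) (b i))" and "w = (\<Sum>i\<in>S. tens3 (A i) t' (b i))"
  note hom = alg_homD[OF alg_hom_twisted(2)[OF J1(1)]] alg_hom_sum[OF alg_hom_twisted(2)[OF J1(1)]]
    alg_homD[OF alg_hom_twisted(3)[OF J1(1)]] alg_hom_sum[OF alg_hom_twisted(3)[OF J1(1)]]
    alg_hom_sum[OF alg_hom_hat_map[OF alg_hom_leg12]] alg_hom_sum[OF alg_hom_hat_map[OF alg_hom_leg23]]
  have legs: "hat_map leg12 X = p" "hat_map leg23 X = r"
    by (simp_all add: X_def p_def r_def hom ins_tens3)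
  have "twisted_comult_id J1 X = (\<Sum>i\<in>S. hat_map leg12 (twisted_comult J1 (A i)) * hat_map ins3 (b i))"
    by (simp add: X_def hom twisted_legs[OF J1(1)] hat_tens_def)
  also have "\<dots> = q + r"
    unfolding q_def r_def sum.distrib[symmetric]
    by (intro sum.cong refl)
      (simp add: twisted_J1_simps hat_hom_leg12 hat_leg_simps ins_tens3 distrib_right tens3_mult)
  finally have qr: "twisted_comult_id J1 X = q + r" .
  have "id_twisted_comult J1 X = (\<Sum>i\<in>S. hat_map ins1 (A i) * hat_map leg23 (twisted_comult J1 (b i)))"
    by (simp add: X_def hom twisted_legs[OF J1(1)] hat_tens_def)
  also have "\<dots> = p + w"
    unfolding p_def w_def sum.distrib[symmetric]
    by (intro sum.cong refl)
      (simp add: twisted_J1_simps hat_hom_leg23 hat_leg_simps ins_tens3 distrib_left tens3_mult)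
  finally have pw: "id_twisted_comult J1 X = p + w" .
  have o: "ord_ge (tens3 (A i) (b i) 1) 1" "ord_ge (tens3 (A i) t (b i)) 1"
    "ord_ge (tens3 1 (A i) (b i)) 1" "ord_ge (tens3 (A i) t' (b i)) 1" if "i \<in> S" for i
    using ord_ge_tens3[OF ord(5)[OF that] b_ord[OF that] ord_ge_one]
      ord_ge_tens3[OF ord(5)[OF that] t_ord(1) b_ord[OF that]]
      ord_ge_tens3[OF ord_ge_one ord(5)[OF that] b_ord[OF that]]
      ord_ge_tens3[OF ord(5)[OF that] t_ord(2) b_ord[OF that]]
    by (auto intro: ord_ge_mono)
  then have ords: "ord_ge p 1" "ord_ge q 1" "ord_ge r 1" "ord_ge w 1"
    unfolding p_def q_def r_def w_def by (auto intro!: ord_ge_sum)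
  note tA = commute_E[OF E_central(3)] and tb = commute_E[OF b_rel(5)]
  have com: "p * q = q * p" "w * p = p * w" "q * r = r * q" "r * w = w * r" "q * w = w * q"
    unfolding p_def q_def r_def w_def
    by (rule sum_commute, simp add: tens3_mult AA[of _ _] b_rel(2) tA tb t_t')+
  have "p * r = r * p + (\<Sum>j\<in>S. tens3 (A j) (t' - t) (b j))"
    unfolding p_def r_def
  proof (rule sum_commutator[OF fin])
    fix i j assume ij: "i \<in> S" "j \<in> S"
    show "tens3 (A i) (b i) 1 * tens3 1 (A j) (b j) = tens3 1 (A j) (b j) * tens3 (A i) (b i) 1
      + (if i = j then tens3 (A j) (t' - t) (b j) else 0)"
      using b_rel(1)[OF ij] by (simp add: tens3_mult tens3_simps)
  qed
  also have "(\<Sum>j\<in>S. tens3 (A j) (t' - t) (b j)) = w - q"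
    unfolding w_def q_def by (simp add: tens3_simps sum_subtractf)
  finally have pr: "p * r = r * p + (w - q)" .
  have "hat_map leg12 (hat_exp X) * twisted_comult_id J1 (hat_exp X) = hat_exp p * hat_exp (q + r)"
    by (simp add: twisted_exp_ln(3)[OF J1(1) X_ord] hat_map_exp alg_hom_leg12 X_ord qr legs)
  also have "\<dots> = hat_exp r * hat_exp (p + w)"
    by (rule exp_pentagon[OF ords com(1,3,2,4,5) pr])
  also have "\<dots> = hat_map leg23 (hat_exp X) * id_twisted_comult J1 (hat_exp X)"
    by (simp add: twisted_exp_ln(4)[OF J1(1) X_ord] hat_map_exp alg_hom_leg23 X_ord pw legs)
  finally show ?thesis by (simp add: cocycle_over_def)
qed

definition "F1 = hat_exp X * J1"

lemma F1: "hat_unit F1" "cocycle F1"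
  unfolding F1_def by (intro hat_unit_mult cocycle_compose extension_cocycle J1 K)+

lemma twisted_F1: "twisted_comult J1 x = y \<Longrightarrow> hat_exp X * y = z * hat_exp X \<Longrightarrow> twisted_comult F1 x = z"
  unfolding F1_def twisted_comult_mult[OF K J1(1)] by (rule conj_eqI[OF K]) simp

lemma X_commute:
  assumes "\<And>i. i \<in> S \<Longrightarrow> A i * x = x * A i" "\<And>i. i \<in> S \<Longrightarrow> b i * y = y * b i"
  shows "X * (x \<otimes>\<^sub>c y) = (x \<otimes>\<^sub>c y) * X"
  unfolding X_def using assms by (simp add: sum_distrib_left sum_distrib_right hat_tens_mult)

lemma twisted_F1_Hm: "twisted_comult F1 Hm = inl Hm + inr Hm"
proof (rule twisted_F1[OF twisted_J1_simps(2)])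
  have "(A i \<otimes>\<^sub>c b i) * (inl Hm + inr Hm) = (inl Hm + inr Hm) * (A i \<otimes>\<^sub>c b i)" if i: "i \<in> S" for i
  proof -
    have "A i * Hm = Hm * A i - (1/2) *\<^sub>C A i" "b i * Hm = Hm * b i + (1/2) *\<^sub>C b i"
      using Hm(2)[OF i] b_rel(4)[OF i i] by simp_all
    then show ?thesis
      by (simp add: inl_inr_tens distrib_left distrib_right hat_tens_mult hat_tens_simps)
  qed
  then have "X * (inl Hm + inr Hm) = (inl Hm + inr Hm) * X"
    unfolding X_def by (simp add: sum_distrib_left sum_distrib_right)
  then show "hat_exp X * (inl Hm + inr Hm) = (inl Hm + inr Hm) * hat_exp X"
    by (intro hat_exp_intertwine X_ord)
qed

lemma X_inr_A:
  assumes "j \<in> S"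
  shows "X * inr (A j) = inr (A j) * X - A j \<otimes>\<^sub>c (t - t')"
proof -
  have "(A i \<otimes>\<^sub>c b i) * inr (A j) = inr (A j) * (A i \<otimes>\<^sub>c b i) - (if i = j then A j \<otimes>\<^sub>c (t - t') else 0)" if "i \<in> S" for i
    using b_rel(1)[OF that assms] by (simp add: inl_inr_tens hat_tens_mult hat_tens_simps)
  then have "X * inr (A j) = (\<Sum>i\<in>S. inr (A j) * (A i \<otimes>\<^sub>c b i) - (if i = j then A j \<otimes>\<^sub>c (t - t') else 0))"
    unfolding X_def by (simp add: sum_distrib_right)
  also have "\<dots> = inr (A j) * X - A j \<otimes>\<^sub>c (t - t')"
    unfolding X_def using assms fin by (simp add: sum_subtractf sum_distrib_left)
  finally show ?thesis .
qed

lemma b_t: "i \<in> S \<Longrightarrow> b i * t = t * b i" "i \<in> S \<Longrightarrow> b i * t' = t' * b i"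
  using commute_E[OF b_rel(5)] by simp_all

text \<open>
  The commutator with \<open>X\<close> replaces \<open>t\<close> by \<open>t'\<close> in the first summand.
\<close>

lemma twisted_F1_A: "j \<in> S \<Longrightarrow> twisted_comult F1 (A j) = A j \<otimes>\<^sub>c t' + inr (A j)"
proof (rule twisted_F1[OF twisted_J1_simps(3)])
  assume j: "j \<in> S"
  have 1: "hat_exp X * (A j \<otimes>\<^sub>c t) = (A j \<otimes>\<^sub>c t) * hat_exp X"
    by (intro hat_exp_intertwine X_ord X_commute AA j b_t)
  have "X * (A j \<otimes>\<^sub>c (t - t')) = (A j \<otimes>\<^sub>c (t - t')) * X"
    by (intro X_commute AA j) (simp_all add: b_t algebra_simps)
  then have "hat_exp X * inr (A j) = (inr (A j) - A j \<otimes>\<^sub>c (t - t')) * hat_exp X"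
    using hat_exp_conj[OF X_ord, of "inr (A j)" "- (A j \<otimes>\<^sub>c (t - t'))" 0] X_inr_A[OF j] by simp
  with 1 show "hat_exp X * (A j \<otimes>\<^sub>c t + inr (A j)) = (A j \<otimes>\<^sub>c t' + inr (A j)) * hat_exp X"
    by (simp add: algebra_simps hat_tens_simps)
qed

lemma reindex_r: "(\<Sum>i\<in>S. f (r i)) = (\<Sum>i\<in>S. f i)"
  by (rule sum.reindex_bij_witness[where i = r and j = r]) (auto simp: r_in r_r)

definition "Z = (\<Sum>i\<in>S. A i \<otimes>\<^sub>c (A (r i) * t'))"

text \<open>
  The first commutator of \<open>X\<close> with \<open>1 \<otimes> D\<close> is \<open>Z\<close>, since \<open>[b i, D] = A (r i) t'\<close>; the second one
  contracts \<open>b j\<close> with \<open>A (r i)\<close> to \<open>E\<close> and leaves the quadratic element \<open>Q\<close> in the first leg.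
\<close>

lemma twisted_F1_D: "twisted_comult F1 D = inl D + inr D + Z - Q \<otimes>\<^sub>c (1 - t' * t')"
proof (rule twisted_F1[OF twisted_J1_simps(1)])
  have 1: "hat_exp X * inl D = inl D * hat_exp X"
    unfolding inl_inr_tens by (intro hat_exp_intertwine X_ord X_commute) (simp_all add: DA)
  have XD: "X * inr D = inr D * X + Z"
    unfolding X_def Z_def sum_distrib_left sum_distrib_right sum.distrib[symmetric]
    by (intro sum.cong refl) (simp add: inl_inr_tens hat_tens_mult b_rel hat_tens_simps)
  have XZ: "X * Z = Z * X + (- 2) *\<^sub>C (Q \<otimes>\<^sub>c (1 - t' * t'))"
  proof -
    have At: "A i * t' = t' * A i" if "i \<in> S" for i using commute_E(3)[OF E_central(3)[OF that]] by simp
    have Zj: "X * (A j \<otimes>\<^sub>c (A (r j) * t')) = (A j \<otimes>\<^sub>c (A (r j) * t')) * X - (A (r j) * A j) \<otimes>\<^sub>c (1 - t' * t')"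
      if j: "j \<in> S" for j
    proof -
      have eq: "A j \<otimes>\<^sub>c (A (r j) * t') = inr (A (r j)) * (A j \<otimes>\<^sub>c t')"
        by (simp add: inl_inr_tens hat_tens_mult)
      have c: "X * (A j \<otimes>\<^sub>c t') = (A j \<otimes>\<^sub>c t') * X"
        by (intro X_commute AA j b_t)
      have "X * (A j \<otimes>\<^sub>c (A (r j) * t')) = (X * inr (A (r j))) * (A j \<otimes>\<^sub>c t')"
        unfolding eq by (simp only: mult.assoc)
      also have "\<dots> = inr (A (r j)) * (X * (A j \<otimes>\<^sub>c t')) - (A (r j) \<otimes>\<^sub>c (t - t')) * (A j \<otimes>\<^sub>c t')"
        unfolding X_inr_A[OF r_in[OF j]] by (simp only: left_diff_distrib mult.assoc)
      also have "\<dots> = (A j \<otimes>\<^sub>c (A (r j) * t')) * X - (A (r j) * A j) \<otimes>\<^sub>c (1 - t' * t')"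
        unfolding c eq by (simp add: hat_tens_mult left_diff_distrib t_t' mult.assoc)
      finally show ?thesis .
    qed
    have "X * Z = (\<Sum>j\<in>S. (A j \<otimes>\<^sub>c (A (r j) * t')) * X - (A (r j) * A j) \<otimes>\<^sub>c (1 - t' * t'))"
      unfolding Z_def sum_distrib_left by (intro sum.cong refl Zj)
    also have "\<dots> = Z * X - (\<Sum>j\<in>S. A j * A (r j)) \<otimes>\<^sub>c (1 - t' * t')"
      unfolding Z_def sum_subtractf sum_distrib_right hat_tens_sum
      by (intro arg_cong2[where f = "(-)"] refl sum.cong) (simp add: AA r_in)
    also have "(\<Sum>j\<in>S. A j * A (r j)) = 2 *\<^sub>C Q" by (simp add: Q_def scaleC_simps)
    finally show ?thesis by (simp only: hat_tens_simps(5)) simp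
  qed
  have QX: "X * (Q \<otimes>\<^sub>c (1 - t' * t')) = (Q \<otimes>\<^sub>c (1 - t' * t')) * X"
  proof (rule X_commute)
    fix i assume i: "i \<in> S"
    have "A i * (A j * A (r j)) = A j * A (r j) * A i" if "j \<in> S" for j
      using AA[OF i that] AA[OF i r_in[OF that]] by (metis mult.assoc)
    then show "A i * Q = Q * A i"
      by (simp add: Q_def scaleC_simps sum_distrib_left sum_distrib_right)
    show "b i * (1 - t' * t') = (1 - t' * t') * b i"
      using b_t(2)[OF i] by (simp add: algebra_simps) (metis mult.assoc)
  qed
  have "hat_exp X * inr D = (inr D + Z + (1/2) *\<^sub>C ((- 2) *\<^sub>C (Q \<otimes>\<^sub>c (1 - t' * t')))) * hat_exp X"
    by (rule hat_exp_conj[OF X_ord XD XZ]) (simp add: scaleC_simps QX)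
  with 1 show "hat_exp X * (inl D + inr D) = (inl D + inr D + Z - Q \<otimes>\<^sub>c (1 - t' * t')) * hat_exp X"
    by (simp add: distrib_left distrib_right left_diff_distrib scaleC_simps)
qed

text \<open>
  The mixed terms of \<open>\<Sum> \<Delta>(A i) \<Delta>(A (r i))\<close> agree in pairs after reindexing by \<open>r\<close>, which cancels
  the factor \<open>1/2\<close> and gives the same \<open>Z\<close> as for \<open>D\<close>.
\<close>

lemma twisted_F1_Q: "twisted_comult F1 Q = Q \<otimes>\<^sub>c (t' * t') + inr Q + Z"
proof -
  note hom = alg_homD[OF alg_hom_twisted(1)[OF F1(1)]] alg_hom_sum[OF alg_hom_twisted(1)[OF F1(1)]]
  have At: "t' * A i = A i * t'" if "i \<in> S" for i using commute_E(3)[OF E_central(3)[OF that]] .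
  have "twisted_comult F1 Q = (1/2) *\<^sub>C (\<Sum>i\<in>S. (A i \<otimes>\<^sub>c t' + inr (A i)) * (A (r i) \<otimes>\<^sub>c t' + inr (A (r i))))"
    by (simp add: Q_def hom twisted_F1_A r_in)
  also have "(\<Sum>i\<in>S. (A i \<otimes>\<^sub>c t' + inr (A i)) * (A (r i) \<otimes>\<^sub>c t' + inr (A (r i))))
    = (\<Sum>i\<in>S. (A i * A (r i)) \<otimes>\<^sub>c (t' * t') + inr (A i * A (r i))
        + A i \<otimes>\<^sub>c (A (r i) * t') + A (r i) \<otimes>\<^sub>c (A (r (r i)) * t'))"
    by (intro sum.cong refl)
      (simp add: inl_inr_tens distrib_left distrib_right hat_tens_mult At r_in r_r)
  also have "\<dots> = (\<Sum>i\<in>S. A i * A (r i)) \<otimes>\<^sub>c (t' * t') + inr (\<Sum>i\<in>S. A i * A (r i)) + Z + Z"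
    unfolding sum.distrib Z_def reindex_r[of "\<lambda>i. A i \<otimes>\<^sub>c (A (r i) * t')"]
    by (simp add: inl_inr_tens hat_tens_sum)
  also have "(1/2) *\<^sub>C \<dots> = Q \<otimes>\<^sub>c (t' * t') + inr Q + ((1/2) *\<^sub>C Z + (1/2) *\<^sub>C Z)"
    by (simp add: Q_def hat_tens_simps hat_hom_inr scaleC_add_right add.assoc)
  also have "(1/2) *\<^sub>C Z + (1/2) *\<^sub>C Z = Z" by (simp add: scaleC_add_left[symmetric] scaleC_one)
  finally show ?thesis .
qed

text \<open>
  Both \<open>Z\<close> and the terms \<open>Q \<otimes> t'\<^sup>2\<close> cancel in the difference of the last two coproducts.
\<close>

lemma twisted_F1_G: "twisted_comult F1 G = inl G + inr G"
  unfolding G_def alg_homD(5)[OF alg_hom_twisted(1)[OF F1(1)]] twisted_F1_D twisted_F1_Q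
  by (simp add: hat_hom_inl hat_hom_inr hat_tens_simps inl_inr_tens algebra_simps)

subsection \<open>The second Jordanian factor\<close>

lemma Q_ord: "ord_ge Q 1" and Q_mem: "Q \<in> completion"
  unfolding Q_def
  using ord_ge_mono[OF ord_ge_mult[OF ord(5) ord(5)[OF r_in]]]
  by (auto intro!: ord_ge_scaleC ord_ge_sum completion_scaleC completion_sum completion_mult mem r_in)

lemma G_ord: "ord_ge G 1" and G_mem: "G \<in> completion"
  unfolding G_def by (intro ord_ge_diff ord Q_ord completion_diff mem Q_mem)+

lemma Hm_G: "Hm * G = G * Hm + G"
proof -
  have "Hm * (A i * A (r i)) = A i * A (r i) * Hm + A i * A (r i)" if i: "i \<in> S" for i
  proof -
    have "Hm * (A i * A (r i)) = (Hm * A i) * A (r i)" by (simp only: mult.assoc)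
    also have "\<dots> = A i * (Hm * A (r i)) + (1/2) *\<^sub>C (A i * A (r i))"
      unfolding Hm(2)[OF i] by (simp only: distrib_right mult.assoc mult_scaleC_left)
    also have "\<dots> = A i * A (r i) * Hm + ((1/2) *\<^sub>C (A i * A (r i)) + (1/2) *\<^sub>C (A i * A (r i)))"
      unfolding Hm(2)[OF r_in[OF i]] by (simp only: distrib_left mult.assoc mult_scaleC_right add.assoc)
    finally show ?thesis by (simp add: scaleC_add_left[symmetric] scaleC_one)
  qed
  then have "Hm * Q = Q * Hm + Q"
    by (simp add: Q_def scaleC_simps sum_distrib_left sum_distrib_right sum.distrib scaleC_add_right)
  then show ?thesis by (simp add: G_def algebra_simps Hm(1))
qed

definition "Phi_link = J2 * hat_exp X * J1"

lemma Phi_link: "hat_unit Phi_link" "cocycle Phi_link"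
proof -
  note J2 = jordanian_twist[OF F1(1) mem(2) G_mem ord(2) G_ord Hm_G twisted_F1_Hm twisted_F1_G, folded J2_def]
  show "hat_unit Phi_link" "cocycle Phi_link"
    using hat_unit_mult[OF J2(1) F1(1)] cocycle_compose[OF F1 J2(3)]
    by (simp_all add: Phi_link_def F1_def mult.assoc)
qed

text \<open>
  Applying \<open>\<epsilon>\<close> to either leg kills each exponent: the elements involved are primitive up to
  products and logarithms, and \<open>ln (1 + 0) = 0\<close>.
\<close>

lemma Phi_link_counit: "hat_map counit_id Phi_link = 1" "hat_map id_counit Phi_link = 1"
proof -
  define e :: "'g uea \<Rightarrow> 'g uea" where "e = (\<lambda>a. counit a *\<^sub>C (1 :: 'g uea))"
  have "alg_hom e" unfolding e_def alg_hom_def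
    by (auto intro!: clinearI simp: alg_homD[OF alg_hom_counit] scaleC_add_left scaleC_simps scaleC_complex_def)
  have zero: "hat_map e x = 0" if "primitive x" for x
  proof -
    have "counit (x $$ d) = 0" for d
      using that hat_map_nth_hom[OF alg_hom_counit, of x d] by (simp add: primitive_def)
    then show ?thesis
      by (simp add: fls_eq_iff hat_map_nth_hom[OF \<open>alg_hom e\<close>]) (simp add: e_def)
  qed
  note he = alg_homD[OF alg_hom_hat_map[OF \<open>alg_hom e\<close>]] alg_hom_sum[OF alg_hom_hat_map[OF \<open>alg_hom e\<close>]]
  have ci: "hat_map counit_id (inl f) = hat_map e f" "hat_map counit_id (inr f) = f"
    "hat_map id_counit (inl f) = f" "hat_map id_counit (inr f) = hat_map e f" for f :: "'g uea fls"
    by (simp_all add: hat_map_comp counit_id id_counit alg_hom_tens_one e_def)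
      (simp_all add: fls_eq_iff hat_map_nth)
  have "hat_map e Q = 0" by (simp add: Q_def he zero prim r_in)
  then have eG: "hat_map e G = 0" by (simp add: G_def he zero prim)
  have ln: "hat_map e s = 0" "hat_map e (hat_ln1p G) = 0"
    by (simp_all add: s_def hat_map_ln1p \<open>alg_hom e\<close> ord G_ord zero prim eG hat_ln1p_zero)
  note o = ord_ge_tens[OF ord(1) s_ord(1)] ord_ge_tens[OF ord(2) ord_ge_hat_ln1p[OF G_ord]]
  have 1: "hat_map \<phi> Phi_link = hat_exp (hat_map \<phi> (inl Hm) * hat_map \<phi> (inr (hat_ln1p G)))
    * hat_exp (\<Sum>i\<in>S. hat_map \<phi> (inl (A i)) * (hat_map \<phi> (inr (B i)) * hat_map \<phi> (inr t')))
    * hat_exp (hat_map \<phi> (inl Hp) * hat_map \<phi> (inr s))"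
    if \<phi>: "alg_hom \<phi>" for \<phi> :: "'g uea2 \<Rightarrow> 'g uea"
  proof -
    note h = alg_homD[OF alg_hom_hat_map[OF \<phi>]] alg_hom_sum[OF alg_hom_hat_map[OF \<phi>]]
    show ?thesis
      using o by (simp add: Phi_link_def J1_def J2_def h hat_map_exp \<phi> X_ord)
        (simp add: X_def h hat_tens_def b_def hat_hom_inr)
  qed
  show "hat_map counit_id Phi_link = 1" "hat_map id_counit Phi_link = 1"
    unfolding 1[OF counit_id(1)] 1[OF id_counit(1)] ci
    by (simp_all add: zero prim ln hat_exp_zero)
qed

text \<open>
  All ingredients of the link are assumed to commute with \<open>x\<close>, except that \<open>A i\<close> and \<open>B i\<close> need do so
  only in the combinations \<open>Q\<close> and \<open>\<Sum> A i \<otimes> B i\<close>.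
\<close>

lemma Phi_link_commute:
  assumes x: "hat_map comult x = inl x + inr x" "Hp * x = x * Hp" "Hm * x = x * Hm" "E * x = x * E" "D * x = x * D"
    and Q: "Q * x = x * Q" and T: "(\<Sum>i\<in>S. A i \<otimes>\<^sub>c B i) * (inl x + inr x) = (inl x + inr x) * (\<Sum>i\<in>S. A i \<otimes>\<^sub>c B i)"
  shows "Phi_link * hat_map comult x = hat_map comult x * Phi_link"
proof -
  have com2: "hat_exp (H \<otimes>\<^sub>c y) * (inl x + inr x) = (inl x + inr x) * hat_exp (H \<otimes>\<^sub>c y)"
    if "ord_ge H 0" "ord_ge y 1" "H * x = x * H" "y * x = x * y" for H y
    using ord_ge_tens[OF that(1,2)] that(3,4)
    by (intro hat_exp_intertwine) (simp_all add: inl_inr_tens distrib_left distrib_right hat_tens_mult)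
  have G: "G * x = x * G" using x Q by (simp add: G_def algebra_simps)
  have "X = (\<Sum>i\<in>S. A i \<otimes>\<^sub>c B i) * inr t'"
    by (simp add: X_def b_def sum_distrib_right inl_inr_tens hat_tens_mult)
  moreover have "inr t' * (inl x + inr x) = (inl x + inr x) * inr t'"
    using commute_E(3)[OF x(4)] by (simp add: inl_inr_tens distrib_left distrib_right hat_tens_mult)
  ultimately have "X * (inl x + inr x) = (inl x + inr x) * X"
    using commute_mult[OF T[symmetric], of "inr t'"] by simp
  then have X: "hat_exp X * (inl x + inr x) = (inl x + inr x) * hat_exp X"
    by (intro hat_exp_intertwine X_ord)
  have "J1 * (inl x + inr x) = (inl x + inr x) * J1" "J2 * (inl x + inr x) = (inl x + inr x) * J2"
    unfolding J1_def J2_def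
    by (intro com2 ord s_ord commute_E x ord_ge_hat_ln1p G_ord hat_ln1p_intertwine G)+
  with X have "(inl x + inr x) * (J2 * hat_exp X * J1) = J2 * hat_exp X * J1 * (inl x + inr x)"
    by (intro commute_mult) simp_all
  then show ?thesis by (simp add: Phi_link_def x(1))
qed

text \<open>
  If \<open>F\<close> commutes with the coproducts of all ingredients of the link, then on the link the coproduct
  twisted by \<open>F\<close> agrees with the original one, so the cocycle equation carries over.
\<close>

lemma Phi_link_over:
  assumes F: "hat_unit F" and com: "\<And>x. x \<in> {Hp, Hm, E, D} \<union> A ` S \<union> B ` S \<Longrightarrow> F * hat_map comult x = hat_map comult x * F"
  shows "cocycle_over F Phi_link"
proof -
  define T where "T = {x. F * hat_map comult x = hat_map comult x * F}"
  have T_mult: "x * y \<in> T" if "x \<in> T" "y \<in> T" for x y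
    using that by (simp add: T_def hat_hom_comult commute_mult)
  have T_sum: "(\<Sum>i\<in>S. f i) \<in> T" if "\<And>i. i \<in> S \<Longrightarrow> f i \<in> T" for f :: "'i \<Rightarrow> 'g uea fls"
    using that by (simp add: T_def alg_hom_sum[OF alg_hom_hat_map[OF alg_hom_comult]] sum_distrib_left sum_distrib_right)
  have T_lin: "c *\<^sub>C x \<in> T" "y \<in> T \<Longrightarrow> x - y \<in> T" if "x \<in> T" for c x y
    using that by (simp_all add: T_def hat_hom_comult scaleC_simps algebra_simps)
  have T_exp: "hat_exp x \<in> T" "hat_ln1p x \<in> T" if "x \<in> T" "ord_ge x 1" for x
  proof -
    have o: "ord_ge (hat_map comult x) 1" using that(2) by (simp add: ord_ge_hat_map alg_homD(6)[OF alg_hom_comult])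
    show "hat_exp x \<in> T" "hat_ln1p x \<in> T"
      using that hat_exp_intertwine[OF o o, of F] hat_ln1p_intertwine[OF o o, of F]
      by (simp_all add: T_def hat_map_exp hat_map_ln1p alg_hom_comult)
  qed
  have gens: "Hp \<in> T" "Hm \<in> T" "E \<in> T" "D \<in> T" "i \<in> S \<Longrightarrow> A i \<in> T" "i \<in> S \<Longrightarrow> B i \<in> T" for i
    using com by (auto simp: T_def)
  have sT: "s \<in> T" unfolding s_def by (intro T_exp gens ord)
  have tT: "t' \<in> T" unfolding t'_def by (intro T_exp T_lin sT s_ord)
  have bT: "b i \<in> T" if "i \<in> S" for i unfolding b_def by (intro T_mult gens tT that)
  have "Q \<in> T" unfolding Q_def by (intro T_lin(1) T_sum T_mult gens r_in)
  then have GT: "hat_ln1p G \<in> T" unfolding G_def by (intro T_exp T_lin gens G_ord[unfolded G_def])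
  \<comment> \<open>The two conditions make the twisted maps agree with \<open>\<Delta> \<otimes> id\<close> and \<open>id \<otimes> \<Delta>\<close> on \<open>V\<close>, a subalgebra closed under \<open>hat_exp\<close>.\<close>
  define V where "V = {u. hat_map leg12 F * hat_map comult_id u = hat_map comult_id u * hat_map leg12 F
    \<and> hat_map leg23 F * hat_map id_comult u = hat_map id_comult u * hat_map leg23 F}"
  have V_tens: "x \<otimes>\<^sub>c y \<in> V" if "x \<in> T" "y \<in> T" for x y
  proof -
    have "hat_map leg12 F * hat_map leg12 (hat_map comult x) = hat_map leg12 (hat_map comult x) * hat_map leg12 F"
      "hat_map leg23 F * hat_map leg23 (hat_map comult y) = hat_map leg23 (hat_map comult y) * hat_map leg23 F"
      using that by (simp_all add: T_def flip: hat_hom_leg12(3) hat_hom_leg23(3))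
    then show ?thesis
      unfolding V_def hat_tens_def
      by (simp add: hat_hom_comult_id hat_hom_id_comult hat_leg_simps commute_mult hat_leg_ins_commute)
  qed
  have V_mult: "u * v \<in> V" if "u \<in> V" "v \<in> V" for u v
    using that by (simp add: V_def hat_hom_comult_id hat_hom_id_comult commute_mult)
  have V_sum: "(\<Sum>i\<in>S. f i) \<in> V" if "\<And>i. i \<in> S \<Longrightarrow> f i \<in> V" for f :: "'i \<Rightarrow> 'g uea2 fls"
    using that by (simp add: V_def alg_hom_sum[OF alg_hom_hat_map[OF comult_id(1)]]
        alg_hom_sum[OF alg_hom_hat_map[OF id_comult(1)]] sum_distrib_left sum_distrib_right)
  have V_exp: "hat_exp u \<in> V" if "u \<in> V" "ord_ge u 1" for u
  proof -
    have o: "ord_ge (hat_map comult_id u) 1" "ord_ge (hat_map id_comult u) 1"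
      using that(2) by (simp_all add: ord_ge_hat_map alg_homD(6)[OF comult_id(1)] alg_homD(6)[OF id_comult(1)])
    show ?thesis
      using that hat_exp_intertwine[OF o(1) o(1), of "hat_map leg12 F"] hat_exp_intertwine[OF o(2) o(2), of "hat_map leg23 F"]
      by (simp add: V_def hat_map_exp comult_id id_comult)
  qed
  have o: "ord_ge (Hp \<otimes>\<^sub>c s) 1" "ord_ge (Hm \<otimes>\<^sub>c hat_ln1p G) 1"
    using ord_ge_tens[OF ord(1) s_ord(1)] ord_ge_tens[OF ord(2) ord_ge_hat_ln1p[OF G_ord]] by simp_all
  have "X \<in> V" unfolding X_def by (intro V_sum V_tens gens bT)
  then have "Phi_link \<in> V"
    unfolding Phi_link_def J1_def J2_def
    by (intro V_mult V_exp V_tens gens sT GT o X_ord)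
  then have *: "twisted_comult_id F Phi_link = hat_map comult_id Phi_link"
    "id_twisted_comult F Phi_link = hat_map id_comult Phi_link"
    unfolding V_def twisted_comult_id_def id_twisted_comult_def
    by (simp_all add: mult.assoc leg12_unit[OF F] leg23_unit[OF F])
  show ?thesis
    using Phi_link(2) by (simp add: cocycle_over_def cocycle_def *)
qed

end

section \<open>The triangular R-matrix of a twist\<close>

text \<open>
  The permutations are named by their effect on the legs: \<open>cyc_left\<close> moves legs 1, 2, 3 to 3, 1, 2
  and \<open>cyc_right\<close> moves them to 2, 3, 1.
\<close>

definition cyc_left :: "'g::complex_lie_algebra uea3 \<Rightarrow> 'g uea3" where "cyc_left = tri ins3 ins1 ins2"
definition cyc_right :: "'g::complex_lie_algebra uea3 \<Rightarrow> 'g uea3" where "cyc_right = tri ins2 ins3 ins1"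
definition swap12 :: "'g::complex_lie_algebra uea3 \<Rightarrow> 'g uea3" where "swap12 = tri ins2 ins1 ins3"
definition swap23 :: "'g::complex_lie_algebra uea3 \<Rightarrow> 'g uea3" where "swap23 = tri ins1 ins3 ins2"

lemma perm_hom: "alg_hom cyc_left" "alg_hom cyc_right" "alg_hom swap12" "alg_hom swap23"
  unfolding cyc_left_def cyc_right_def swap12_def swap23_def
  by (rule alg_hom_tri; simp add: alg_hom_ins ins_commute)+

lemma perm_ins:
  "cyc_left (ins1 a) = ins3 a" "cyc_left (ins2 a) = ins1 a" "cyc_left (ins3 a) = ins2 a"
  "cyc_right (ins1 a) = ins2 a" "cyc_right (ins2 a) = ins3 a" "cyc_right (ins3 a) = ins1 a"
  "swap12 (ins1 a) = ins2 a" "swap12 (ins2 a) = ins1 a" "swap12 (ins3 a) = ins3 a"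
  "swap23 (ins1 a) = ins1 a" "swap23 (ins2 a) = ins3 a" "swap23 (ins3 a) = ins2 a"
  unfolding cyc_left_def cyc_right_def swap12_def swap23_def
  by (rule alg_hom_tri; simp add: alg_hom_ins ins_commute)+

lemma perm_legs:
  "cyc_left (leg12 t) = leg13 (tensor_swap t)" "cyc_left (leg23 t) = leg12 t"
  "cyc_right (leg12 t) = leg23 t" "cyc_right (leg23 t) = leg13 (tensor_swap t)"
  "swap12 (leg12 t) = leg12 (tensor_swap t)" "swap12 (leg23 t) = leg13 t"
  "swap23 (leg12 t) = leg13 t" "swap23 (leg23 t) = leg23 (tensor_swap t)"
  by (rule alg_hom_tensor_eqI[where t = t]; (rule perm_hom leg13(1) alg_hom_leg12 alg_hom_leg23
        alg_hom_comp[OF perm_hom(1)] alg_hom_comp[OF perm_hom(2)] alg_hom_comp[OF perm_hom(3)] alg_hom_comp[OF perm_hom(4)]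
        alg_hom_comp[OF leg13(1)] alg_hom_comp[OF alg_hom_leg12] alg_hom_comp[OF alg_hom_leg23] alg_hom_tensor_swap
      | simp add: leg_simps leg13 perm_ins tensor_swap_tens)+)+

lemma perm_comult:
  "cyc_left (id_comult t) = comult_id (tensor_swap t)"
  "cyc_right (comult_id t) = id_comult (tensor_swap t)"
  "swap23 (id_comult t) = id_comult t" "swap12 (comult_id t) = comult_id t"
  "swap23 (comult_id t) = cyc_left (comult_id t)" "swap12 (id_comult t) = cyc_right (id_comult t)"
  by (rule alg_hom_tensor_eqI[where t = t]; (rule comult_id(1) id_comult(1)
        alg_hom_comp[OF perm_hom(1)] alg_hom_comp[OF perm_hom(2)] alg_hom_comp[OF perm_hom(3)] alg_hom_comp[OF perm_hom(4)]
        alg_hom_comp[OF comult_id(1)] alg_hom_comp[OF id_comult(1)] alg_hom_tensor_swap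
      | simp add: comult_id id_comult perm_legs perm_ins tensor_swap_tens tensor_swap_comult)+)+

lemma hat_perm:
  "hat_map cyc_left (hat_map leg12 t) = hat_map leg13 (hat_map tensor_swap t)"
  "hat_map cyc_left (hat_map leg23 t) = hat_map leg12 t"
  "hat_map cyc_right (hat_map leg12 t) = hat_map leg23 t"
  "hat_map cyc_right (hat_map leg23 t) = hat_map leg13 (hat_map tensor_swap t)"
  "hat_map swap12 (hat_map leg12 t) = hat_map leg12 (hat_map tensor_swap t)"
  "hat_map swap12 (hat_map leg23 t) = hat_map leg13 t"
  "hat_map swap23 (hat_map leg12 t) = hat_map leg13 t"
  "hat_map swap23 (hat_map leg23 t) = hat_map leg23 (hat_map tensor_swap t)"
  "hat_map cyc_left (hat_map id_comult t) = hat_map comult_id (hat_map tensor_swap t)"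
  "hat_map cyc_right (hat_map comult_id t) = hat_map id_comult (hat_map tensor_swap t)"
  "hat_map swap23 (hat_map id_comult t) = hat_map id_comult t"
  "hat_map swap12 (hat_map comult_id t) = hat_map comult_id t"
  "hat_map swap23 (hat_map comult_id t) = hat_map cyc_left (hat_map comult_id t)"
  "hat_map swap12 (hat_map id_comult t) = hat_map cyc_right (hat_map id_comult t)"
  by (simp_all add: hat_map_comp perm_hom alg_hom_leg12 alg_hom_leg23 leg13(1) alg_hom_tensor_swap
      comult_id(1) id_comult(1) perm_legs perm_comult)

lemmas hat_perm_mult = alg_homD(3)[OF alg_hom_hat_map[OF perm_hom(1)]] alg_homD(3)[OF alg_hom_hat_map[OF perm_hom(2)]]
  alg_homD(3)[OF alg_hom_hat_map[OF perm_hom(3)]] alg_homD(3)[OF alg_hom_hat_map[OF perm_hom(4)]]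

lemma hat_map_inverse:
  fixes F :: "'a::inner_graded_algebra fls"
  assumes "alg_hom \<phi>" "hat_invertible F"
  shows "hat_map \<phi> F * hat_map \<phi> (hat_inverse F) = 1" "hat_map \<phi> (hat_inverse F) * hat_map \<phi> F = 1"
  using hat_inverse[OF assms(2)] by (simp_all add: alg_homD[OF alg_hom_hat_map[OF assms(1)]] flip: alg_homD(3)[OF alg_hom_hat_map[OF assms(1)]])

lemma inverse_swap_lemma:
  fixes a b c d a' b' :: "'a::monoid_mult"
  assumes "a * b = c * d" "a' * a = 1" "d * d' = 1"
  shows "a' * c = b * d'"
proof -
  have "a' * c = a' * (c * d) * d'" by (simp add: mult.assoc assms(3))
  also have "\<dots> = (a' * a) * (b * d')" by (simp only: assms(1)[symmetric] mult.assoc)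
  finally show ?thesis by (simp add: assms(2))
qed

text \<open>
  Let \<open>\<Omega>\<close> be the common value of the two sides of the cocycle equation.  Permuting its legs, with
  cocommutativity of \<open>\<Delta>\<close>, expresses \<open>(\<Delta>\<^sub>F \<otimes> id) R\<close> as \<open>\<pi>(\<Omega>) \<Omega>\<inverse>\<close> for the cyclic permutation \<open>\<pi>\<close> and
  \<open>F\<^sub>1\<^sub>3\<inverse> F\<^sub>3\<^sub>2\<close> as \<open>\<pi>((\<Delta> \<otimes> id) F) ((id \<otimes> \<Delta>) F)\<inverse>\<close>, which yields the first quasitriangularity
  relation; the second is its mirror image.
\<close>

lemma triangular_twist:
  fixes F :: "'g::inner_graded_lie_algebra uea2 fls"
  assumes inv: "hat_invertible F" and coc: "cocycle F"
  shows "triangular_R_matrix F (hat_map tensor_swap F * hat_inverse F)"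
proof -
  let ?F' = "hat_inverse F"
  let ?l12 = "hat_map leg12" and ?l23 = "hat_map leg23" and ?l13 = "hat_map leg13" and ?sw = "hat_map tensor_swap"
    and ?c = "hat_map comult_id" and ?d = "hat_map id_comult"
  define R where "R = ?sw F * ?F'"
  note F = hat_inverse[OF inv]
  note i12 = hat_map_inverse[OF alg_hom_leg12 inv] and i23 = hat_map_inverse[OF alg_hom_leg23 inv]
    and i13 = hat_map_inverse[OF leg13(1) inv] and isw = hat_map_inverse[OF alg_hom_tensor_swap inv]
    and ic = hat_map_inverse[OF comult_id(1) inv] and id = hat_map_inverse[OF id_comult(1) inv]
  have swsw: "?sw (?sw t) = t" for t :: "'g uea2 fls"
    by (simp add: hat_map_comp alg_hom_tensor_swap tensor_swap_swap fls_eq_iff hat_map_nth)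
  have Om: "?l12 F * ?c F = ?l23 F * ?d F" using coc by (simp add: cocycle_def)
  have "hat_invertible (?sw F)"
    unfolding hat_invertible_def
    using isw inv completion_swap[OF F(1)] by (auto simp: hat_invertible_def intro: completion_swap)
  moreover have "hat_invertible ?F'" using F inv by (auto simp: hat_invertible_def)
  ultimately have 1: "hat_invertible R" unfolding R_def by (rule hat_invertible_mult)
  have 2: "?sw R * R = 1"
  proof -
    have "?sw R * R = F * (?sw ?F' * ?sw F) * ?F'"
      by (simp add: R_def hat_hom_swap swsw mult.assoc)
    then show ?thesis by (simp add: isw F)
  qed
  have 3: "R * twisted_comult F x = ?sw (twisted_comult F x) * R" for x
  proof -
    have swc: "?sw (hat_map comult x) = hat_map comult x"
      by (simp add: hat_map_comp alg_hom_tensor_swap alg_hom_comult tensor_swap_comult)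
    have "R * twisted_comult F x = ?sw F * (?F' * F) * hat_map comult x * ?F'"
      by (simp only: R_def twisted_comult_def mult.assoc)
    moreover have "?sw (twisted_comult F x) * R = ?sw F * hat_map comult x * (?sw ?F' * ?sw F) * ?F'"
      by (simp only: R_def twisted_comult_def hat_hom_swap swc mult.assoc)
    ultimately show ?thesis by (simp add: F isw)
  qed
  have dc: "?d ?F' * ?l23 ?F' = ?c ?F' * ?l12 ?F'"
  proof -
    have "?l12 F * ?c F * (?c ?F' * ?l12 ?F') = ?l12 F * (?c F * ?c ?F') * ?l12 ?F'"
      by (simp only: mult.assoc)
    then have "?l23 F * ?d F * (?c ?F' * ?l12 ?F') = 1" by (simp add: Om[symmetric] ic i12)
    then have "?d ?F' * (?l23 ?F' * ?l23 F) * ?d F * (?c ?F' * ?l12 ?F') = ?d ?F' * ?l23 ?F'"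
      by (simp only: mult.assoc mult_1_right)
    then show ?thesis by (simp add: i23 id)
  qed
  have 4: "twisted_comult_id F R = ?l13 R * ?l23 R"
  proof -
    have pi: "?l12 F * ?c (?sw F) = ?l13 (?sw F) * hat_map cyc_left (?c F)"
      using arg_cong[OF Om, of "hat_map cyc_left"] by (simp add: hat_perm_mult hat_perm)
    have "?l13 F * hat_map cyc_left (?c F) = ?l23 (?sw F) * ?d F"
      using arg_cong[OF Om, of "hat_map swap23"] by (simp add: hat_perm_mult hat_perm)
    then have sw: "?l13 ?F' * ?l23 (?sw F) = hat_map cyc_left (?c F) * ?d ?F'"
      by (rule inverse_swap_lemma[OF _ i13(2) id(1)])
    have "twisted_comult_id F R = (?l12 F * ?c (?sw F)) * (?c ?F' * ?l12 ?F')"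
      by (simp only: twisted_comult_id_def R_def hat_hom_comult_id mult.assoc)
    also have "\<dots> = ?l13 (?sw F) * (hat_map cyc_left (?c F) * ?d ?F') * ?l23 ?F'"
      by (simp only: pi dc[symmetric] mult.assoc)
    also have "\<dots> = ?l13 R * ?l23 R"
      by (simp only: sw[symmetric] R_def hat_hom_leg13 hat_hom_leg23 mult.assoc)
    finally show ?thesis .
  qed
  have 5: "id_twisted_comult F R = ?l13 R * ?l12 R"
  proof -
    have pi: "?l23 F * ?d (?sw F) = ?l13 (?sw F) * hat_map cyc_right (?d F)"
      using arg_cong[OF Om, of "hat_map cyc_right"] by (simp add: hat_perm_mult hat_perm)
    have "?l13 F * hat_map cyc_right (?d F) = ?l12 (?sw F) * ?c F"
      using arg_cong[OF Om, of "hat_map swap12"] by (simp add: hat_perm_mult hat_perm)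
    then have sw: "?l13 ?F' * ?l12 (?sw F) = hat_map cyc_right (?d F) * ?c ?F'"
      by (rule inverse_swap_lemma[OF _ i13(2) ic(1)])
    have "id_twisted_comult F R = (?l23 F * ?d (?sw F)) * (?d ?F' * ?l23 ?F')"
      by (simp only: id_twisted_comult_def R_def hat_hom_id_comult mult.assoc)
    also have "\<dots> = ?l13 (?sw F) * (hat_map cyc_right (?d F) * ?c ?F') * ?l12 ?F'"
      by (simp only: pi dc mult.assoc)
    also have "\<dots> = ?l13 R * ?l12 R"
      by (simp only: sw[symmetric] R_def hat_hom_leg13 hat_hom_leg12 mult.assoc)
    finally show ?thesis .
  qed
  show ?thesis
    unfolding triangular_R_matrix_def using 1 2 3 4 5 by (simp add: R_def)
qed

section \<open>Brackets in $so(M)$\<close>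

lemma mat_A_bracket:
  assumes ij: "i \<in> {1..CARD('m)}" "j \<in> {1..CARD('m)}" and kl: "k \<in> {1..CARD('m)}" "l \<in> {1..CARD('m)}"
  shows "mat_A i j ** mat_A k l - mat_A k l ** mat_A i j
    = (if j = k then mat_A i l else 0) - (if i = l then mat_A k j else 0)
      - (if j = CARD('m) + 1 - l then mat_A i (CARD('m) + 1 - k) else 0)
      + (if i = CARD('m) + 1 - k then mat_A (CARD('m) + 1 - l) j else (0 :: 'm::{finite,linorder} cmat))"
proof -
  let ?M = "CARD('m)"
  define i' j' k' l' where "i' = ?M + 1 - i" and "j' = ?M + 1 - j" and "k' = ?M + 1 - k" and "l' = ?M + 1 - l"
  note p = i'_def j'_def k'_def l'_def
  have ranges: "i' \<in> {1..?M}" "j' \<in> {1..?M}" "k' \<in> {1..?M}" "l' \<in> {1..?M}"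
    using ij kl by (auto simp: p)
  have inv: "?M + 1 - i' = i" "?M + 1 - j' = j" "?M + 1 - k' = k" "?M + 1 - l' = l"
    using ij kl by (auto simp: p)
  have eqs: "(i' = l') = (i = l)" "(k' = j') = (j = k)" "(l' = i') = (i = l)"
    "(i' = k) = (i = k')" "(l = j') = (j = l')" "(l = i) = (i = l)" "(k' = i) = (i = k')"
    using ij kl by (auto simp: p)
  have A: "mat_A i j = mat_unit i j - (mat_unit j' i' :: 'm cmat)"
    "mat_A k l = mat_unit k l - (mat_unit l' k' :: 'm cmat)"
    "mat_A i l = mat_unit i l - (mat_unit l' i' :: 'm cmat)"
    "mat_A k j = mat_unit k j - (mat_unit j' k' :: 'm cmat)"
    "mat_A i k' = mat_unit i k' - (mat_unit k i' :: 'm cmat)"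
    "mat_A l' j = mat_unit l' j - (mat_unit j' l :: 'm cmat)"
    by (simp_all only: mat_A_def inv p[symmetric])
  define P Q R T where "P \<longleftrightarrow> j = k" and "Q \<longleftrightarrow> i = l" and "R \<longleftrightarrow> j = l'" and "T \<longleftrightarrow> i = k'"
  note PQRT = P_def[symmetric] Q_def[symmetric] R_def[symmetric] T_def[symmetric]
  have 1: "mat_A i j ** mat_A k l
    = (if P then mat_unit i l else 0) - (if R then mat_unit i k' else 0)
      - ((if T then mat_unit j' l else 0) - (if Q then mat_unit j' k' else (0 :: 'm cmat)))"
    unfolding A cmat_mult_simps
    by (simp only: mat_unit_mult[OF ij(2) kl(1)] mat_unit_mult[OF ij(2) ranges(4)]
        mat_unit_mult[OF ranges(1) kl(1)] mat_unit_mult[OF ranges(1) ranges(4)] eqs PQRT) simp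
  have 2: "mat_A k l ** mat_A i j
    = (if Q then mat_unit k j else 0) - (if R then mat_unit k i' else 0)
      - ((if T then mat_unit l' j else 0) - (if P then mat_unit l' i' else (0 :: 'm cmat)))"
    unfolding A cmat_mult_simps
    by (simp only: mat_unit_mult[OF kl(2) ij(1)] mat_unit_mult[OF kl(2) ranges(2)]
        mat_unit_mult[OF ranges(3) ij(1)] mat_unit_mult[OF ranges(3) ranges(2)] eqs PQRT) simp
  have "mat_A i j ** mat_A k l - mat_A k l ** mat_A i j
    = (if P then mat_A i l else 0) - (if Q then mat_A k j else 0)
      - (if R then mat_A i k' else 0) + (if T then mat_A l' j else (0 :: 'm cmat))"
    unfolding 1 2 unfolding A by simp
  then show ?thesis
    unfolding P_def Q_def R_def T_def p .
qed

lemma Rep_so_A: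
  assumes "i \<in> {1..CARD('m)}" "j \<in> {1..CARD('m)}"
  shows "Rep_so (so_A i j :: 'm::{finite,linorder} so) = mat_A i j"
  unfolding so_A_def using assms
  by (intro Abs_so_inverse) (auto simp: so_set_def intro!: cvec.span_base)

lemma so_A_bracket:
  assumes "i \<in> {1..CARD('m)}" "j \<in> {1..CARD('m)}" "k \<in> {1..CARD('m)}" "l \<in> {1..CARD('m)}"
  shows "lie (so_A i j) (so_A k l)
    = (if j = k then so_A i l else 0) - (if i = l then so_A k j else 0)
      - (if j = CARD('m) + 1 - l then so_A i (CARD('m) + 1 - k) else 0)
      + (if i = CARD('m) + 1 - k then so_A (CARD('m) + 1 - l) j else (0 :: 'm::{finite,linorder} so))"
proof -
  have r: "CARD('m) + 1 - k \<in> {1..CARD('m)}" "CARD('m) + 1 - l \<in> {1..CARD('m)}" using assms by auto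
  show ?thesis
    unfolding Rep_so_inject[symmetric]
    by (simp only: lie_so.rep_eq plus_so.rep_eq minus_so.rep_eq if_distrib[of Rep_so] zero_so.rep_eq
        Rep_so_A[OF assms(1,2)] Rep_so_A[OF assms(3,4)] Rep_so_A[OF assms(1,4)] Rep_so_A[OF assms(3,2)]
        Rep_so_A[OF assms(1) r(1)] Rep_so_A[OF r(2) assms(2)] mat_A_bracket[OF assms])
qed

lemma so_A_flip:
  assumes "i \<in> {1..CARD('m)}" "j \<in> {1..CARD('m)}"
  shows "so_A (CARD('m) + 1 - j) (CARD('m) + 1 - i) = - (so_A i j :: 'm::{finite,linorder} so)"
proof -
  have "CARD('m) + 1 - (CARD('m) + 1 - i) = i" "CARD('m) + 1 - (CARD('m) + 1 - j) = j"
    using assms by auto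
  then have "mat_A (CARD('m) + 1 - j) (CARD('m) + 1 - i) = - (mat_A i j :: 'm cmat)"
    unfolding mat_A_def by simp
  moreover have "CARD('m) + 1 - j \<in> {1..CARD('m)}" "CARD('m) + 1 - i \<in> {1..CARD('m)}"
    using assms by auto
  ultimately show ?thesis
    unfolding Rep_so_inject[symmetric] uminus_so.rep_eq Rep_so_A[OF assms] by (simp only: Rep_so_A)
qed

lemma so_A_zero:
  assumes "i \<in> {1..CARD('m)}"
  shows "so_A i (CARD('m) + 1 - i) = (0 :: 'm::{finite,linorder} so)"
proof -
  have "CARD('m) + 1 - (CARD('m) + 1 - i) = i" using assms by auto
  then have "mat_A i (CARD('m) + 1 - i) = (0 :: 'm cmat)"
    unfolding mat_A_def by simp
  moreover have "CARD('m) + 1 - i \<in> {1..CARD('m)}" using assms by auto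
  ultimately show ?thesis
    unfolding Rep_so_inject[symmetric] zero_so.rep_eq using assms by (simp only: Rep_so_A)
qed

lemma so_H_eq:
  assumes "i \<in> {1..CARD('m)}"
  shows "so_H i = (1/2) *\<^sub>C (so_A i i :: 'm::{finite,linorder} so)"
proof -
  have "so_H i = Abs_so (Rep_so ((1/2) *\<^sub>C (so_A i i :: 'm so)))"
    unfolding so_H_def scaleC_so.rep_eq Rep_so_A[OF assms assms] mat_A_def ..
  then show ?thesis by (simp add: Rep_so_inverse)
qed

lemma so_induct [case_names A add scaleC]:
  fixes x :: "'m::{finite,linorder} so"
  assumes A: "\<And>i j. i \<in> {1..CARD('m)} \<Longrightarrow> j \<in> {1..CARD('m)} \<Longrightarrow> P (so_A i j)"
    and add: "\<And>x y. P x \<Longrightarrow> P y \<Longrightarrow> P (x + y)" and scaleC: "\<And>c x. P x \<Longrightarrow> P (c *\<^sub>C x)"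
  shows "P x"
proof -
  let ?S = "{mat_A i j | i j. i \<in> {1..CARD('m)} \<and> j \<in> {1..CARD('m)}} :: 'm cmat set"
  have "X \<in> so_set \<and> P (Abs_so X)" if "X \<in> so_set" for X :: "'m cmat"
    using that unfolding so_set_def
  proof (induction rule: cvec.span_induct_alt)
    case base
    have "Abs_so 0 = (0 *\<^sub>C so_A 1 1 :: 'm so)" by (simp add: zero_so_def)
    moreover have "1 \<le> CARD('m)" by (simp add: Suc_le_eq)
    ultimately show ?case using scaleC[OF A[of 1 1], of 0] by (simp add: cvec.span_zero)
  next
    case (step c x y)
    have x: "x \<in> so_set" using step(1) unfolding so_set_def by (rule cvec.span_base)
    have y: "y \<in> so_set" using step unfolding so_set_def by blast
    have "P (Abs_so x)" using step(1) A by (auto simp: so_A_def)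
    then have "P (c *\<^sub>C Abs_so x + Abs_so y)" using step(2) by (intro add scaleC) auto
    moreover have "c *\<^sub>C Abs_so x + Abs_so y = Abs_so (c *\<^sub>C x + y)"
      using x y by (simp add: Rep_so_inject[symmetric] plus_so.rep_eq scaleC_so.rep_eq Abs_so_inverse)
        (subst Abs_so_inverse, auto simp: so_set_def intro: cvec.span_add cvec.span_scale)
    ultimately show ?case
      using x y by (auto simp: so_set_def intro: cvec.span_add cvec.span_scale)
  qed
  from this[OF Rep_so[of x]] show ?thesis by (simp add: Rep_so_inverse)
qed

subsection \<open>The grading\<close>

text \<open>
  The eigenvalue of the diagonal matrix \<open>so_grading_element\<close> on the \<open>k\<close>-th basis vector: \<open>N + 1 - k\<close> in
  the first half, the negative of the mirror value in the second half, and \<open>0\<close> in the middle.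
\<close>

definition so_weight :: "nat \<Rightarrow> nat \<Rightarrow> int"
  where "so_weight M k = (if k \<le> M div 2 then int (M div 2 + 1 - k)
    else if M < k + M div 2 then - int (M div 2 + 1 - (M + 1 - k)) else 0)"

lemma so_A_bracket_diag:
  fixes M defines "M \<equiv> CARD('m)"
  assumes i: "i \<in> {1..M}" and kl: "k \<in> {1..M}" "l \<in> {1..M}"
  shows "lie (so_A i i) (so_A k l) = (of_bool (i = k) - of_bool (i = l) + of_bool (i = M + 1 - l)
    - of_bool (i = M + 1 - k)) *\<^sub>C (so_A k l :: 'm::{finite,linorder} so)"
proof -
  have "lie (so_A i i) (so_A k l) = (if i = k then so_A k l else 0) - (if i = l then so_A k l else 0)
    - (if i = M + 1 - l then so_A (M + 1 - l) (M + 1 - k) else 0)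
    + (if i = M + 1 - k then so_A (M + 1 - l) (M + 1 - k) else (0 :: 'm so))"
    using so_A_bracket[where 'm = 'm, of i i k l] i kl unfolding M_def by (auto split: if_splits)
  moreover have "so_A (M + 1 - l) (M + 1 - k) = - (so_A k l :: 'm so)"
    unfolding M_def by (rule so_A_flip) (use kl in \<open>auto simp: M_def\<close>)
  ultimately show ?thesis
    by (auto simp: cvec.scale_left_diff_distrib scaleC_add_left scaleC_one split: if_splits)
qed

lemma sum_so_weight:
  assumes k: "k \<in> {1..M}"
  shows "(\<Sum>i = 1..M div 2. of_nat (M div 2 + 1 - i) * (of_bool (i = k) - of_bool (i = M + 1 - k)))
    = (of_int (so_weight M k) :: complex)"
proof -
  have *: "(\<Sum>i = 1..M div 2. of_nat (M div 2 + 1 - i) * of_bool (i = j))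
    = (if 1 \<le> j \<and> j \<le> M div 2 then of_nat (M div 2 + 1 - j) else (0 :: complex))" for j
    by (simp add: of_bool_def if_distrib[where f = "\<lambda>x. _ * x"] sum.delta cong: if_cong)
  show ?thesis
    unfolding right_diff_distrib sum_subtractf * so_weight_def using k by auto
qed

lemma lie_grading_so_A:
  assumes kl: "k \<in> {1..CARD('m)}" "l \<in> {1..CARD('m)}"
  shows "lie so_grading_element (so_A k l) =
    of_int (so_weight CARD('m) k - so_weight CARD('m) l) *\<^sub>C (so_A k l :: 'm::{finite,linorder} so)"
proof -
  let ?N = "CARD('m) div 2" and ?M = "CARD('m)"
  have sum: "lie (\<Sum>i\<in>S. f i) x = (\<Sum>i\<in>S. lie (f i) x)" for f :: "nat \<Rightarrow> 'm so" and S x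
  proof -
    have "lie 0 x = 0" using lie_add_left[of 0 0 x] by simp
    then show ?thesis by (induction S rule: infinite_finite_induct) (simp_all add: lie_add_left)
  qed
  have rearrange: "2 * (n * (1 / 2 * (x - y + z - w))) = n * (x - w) - n * (y - z)" for n x y z w :: complex
    by (simp add: field_simps)
  have "lie so_grading_element (so_A k l)
    = (\<Sum>i = 1..?N. of_nat (2 * (?N + 1 - i)) *\<^sub>C (1/2) *\<^sub>C lie (so_A i i) (so_A k l :: 'm so))"
    unfolding so_grading_element_def sum
  proof (intro sum.cong refl)
    fix i assume "i \<in> {1..?N}"
    then have i: "i \<in> {1..?M}" by auto
    show "lie (of_nat (2 * (?N + 1 - i)) *\<^sub>C so_H i) (so_A k l)
      = of_nat (2 * (?N + 1 - i)) *\<^sub>C (1/2) *\<^sub>C lie (so_A i i) (so_A k l :: 'm so)"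
      by (simp only: so_H_eq[OF i] lie_scaleC_left)
  qed
  also have "\<dots> = (\<Sum>i = 1..?N. (of_nat (?N + 1 - i) * (of_bool (i = k) - of_bool (i = ?M + 1 - k))
      - of_nat (?N + 1 - i) * (of_bool (i = l) - of_bool (i = ?M + 1 - l))) *\<^sub>C (so_A k l :: 'm so))"
  proof (intro sum.cong refl)
    fix i assume "i \<in> {1..?N}"
    then have i: "i \<in> {1..?M}" by auto
    show "of_nat (2 * (?N + 1 - i)) *\<^sub>C (1/2) *\<^sub>C lie (so_A i i) (so_A k l :: 'm so)
      = (of_nat (?N + 1 - i) * (of_bool (i = k) - of_bool (i = ?M + 1 - k))
      - of_nat (?N + 1 - i) * (of_bool (i = l) - of_bool (i = ?M + 1 - l))) *\<^sub>C so_A k l"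
      unfolding so_A_bracket_diag[OF i kl] scaleC_scaleC
      by (rule arg_cong[where f = "\<lambda>c. c *\<^sub>C so_A k l"])
        (simp only: of_nat_mult of_nat_numeral mult.assoc rearrange)
  qed
  also have "\<dots> = of_int (so_weight ?M k - so_weight ?M l) *\<^sub>C so_A k l"
    unfolding cvec.scale_sum_left[symmetric] sum_subtractf sum_so_weight[OF kl(1)] sum_so_weight[OF kl(2)] by simp
  finally show ?thesis .
qed

lemma so_A_homog:
  "k \<in> {1..CARD('m)} \<Longrightarrow> l \<in> {1..CARD('m)} \<Longrightarrow>
    so_A k l \<in> (lie_homog (so_weight CARD('m) k - so_weight CARD('m) l) :: 'm::{finite,linorder} so set)"
  by (simp add: lie_homog_so_def lie_grading_so_A)

instance so :: ("{finite,linorder}") inner_graded_lie_algebra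
proof
  show "\<exists>h. \<forall>d. \<forall>x\<in>lie_homog d. lie h x = of_int d *\<^sub>C (x :: 'a so)"
    by (auto simp: lie_homog_so_def)
  fix P :: "'a so \<Rightarrow> bool" and z
  assume P: "\<And>d x. x \<in> lie_homog d \<Longrightarrow> P x" "\<And>x y. P x \<Longrightarrow> P y \<Longrightarrow> P (x + y)"
  have sc: "c *\<^sub>C x \<in> lie_homog d" if "x \<in> lie_homog d" for c d and x :: "'a so"
    using that by (simp add: lie_homog_so_def lie_scaleC_right scaleC_scaleC mult.commute)
  have "\<forall>c. P (c *\<^sub>C z)"
  proof (induction z rule: so_induct)
    case (A i j)
    then show ?case by (intro allI P(1)[OF sc[OF so_A_homog]])
  qed (simp_all add: scaleC_add_right P(2) scaleC_scaleC)
  then show "P z" by (metis scaleC_one)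
qed

subsection \<open>The generators in the completion\<close>

definition gen :: "nat \<Rightarrow> nat \<Rightarrow> 'm::{finite,linorder} so uea fls"
  where "gen i j = hat (uea_gen (so_A i j))"

lemma gen_bracket:
  assumes "i \<in> {1..CARD('m)}" "j \<in> {1..CARD('m)}" "k \<in> {1..CARD('m)}" "l \<in> {1..CARD('m)}"
  shows "gen i j * gen k l = gen k l * gen i j + ((if j = k then gen i l else 0) - (if i = l then gen k j else 0)
      - (if j = CARD('m) + 1 - l then gen i (CARD('m) + 1 - k) else 0)
      + (if i = CARD('m) + 1 - k then gen (CARD('m) + 1 - l) j else (0 :: 'm::{finite,linorder} so uea fls)))"
proof -
  have "gen i j * gen k l - gen k l * gen i j = hat (uea_gen (lie (so_A i j) (so_A k l :: 'm so)))"
    by (simp add: gen_def uea_gen_simps(6) hat_simps)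
  also have "\<dots> = (if j = k then gen i l else 0) - (if i = l then gen k j else 0)
      - (if j = CARD('m) + 1 - l then gen i (CARD('m) + 1 - k) else 0)
      + (if i = CARD('m) + 1 - k then gen (CARD('m) + 1 - l) j else 0)"
    unfolding so_A_bracket[OF assms]
    by (simp only: uea_gen_simps(1,3) hat_simps(4,5) if_distrib[of uea_gen] if_distrib[of hat]
        uea_gen_simps(4) hat_simps(6) gen_def[symmetric])
  finally show ?thesis by (simp add: diff_eq_eq add.commute)
qed

lemma gen_flip:
  "i \<in> {1..CARD('m)} \<Longrightarrow> j \<in> {1..CARD('m)} \<Longrightarrow>
    gen (CARD('m) + 1 - j) (CARD('m) + 1 - i) = - (gen i j :: 'm::{finite,linorder} so uea fls)"
  unfolding gen_def by (simp only: so_A_flip uea_gen_simps hat_simps)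

lemma gen_zero:
  "i \<in> {1..CARD('m)} \<Longrightarrow> gen i (CARD('m) + 1 - i) = (0 :: 'm::{finite,linorder} so uea fls)"
  unfolding gen_def by (simp only: so_A_zero uea_gen_simps hat_simps)

lemma gen_bracket_diag:
  assumes "i \<in> {1..CARD('m)}" "k \<in> {1..CARD('m)}" "l \<in> {1..CARD('m)}"
  shows "gen i i * gen k l = gen k l * gen i i + (of_bool (i = k) - of_bool (i = l)
    + of_bool (i = CARD('m) + 1 - l) - of_bool (i = CARD('m) + 1 - k)) *\<^sub>C (gen k l :: 'm::{finite,linorder} so uea fls)"
proof -
  have "gen i i * gen k l - gen k l * gen i i = hat (uea_gen (lie (so_A i i) (so_A k l :: 'm so)))"
    by (simp add: gen_def uea_gen_simps(6) hat_simps)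
  also have "\<dots> = (of_bool (i = k) - of_bool (i = l)
    + of_bool (i = CARD('m) + 1 - l) - of_bool (i = CARD('m) + 1 - k)) *\<^sub>C gen k l"
    unfolding so_A_bracket_diag[OF assms] by (simp only: uea_gen_simps hat_simps gen_def)
  finally show ?thesis by (simp add: diff_eq_eq add.commute)
qed

lemma primitive_gen: "primitive (gen i j)"
  by (simp add: primitive_def gen_def hat_completion hat_comult_gen hat_counit_gen)

lemma primitive_lin: "primitive x \<Longrightarrow> primitive (c *\<^sub>C x)" "primitive x \<Longrightarrow> primitive (- x)"
  "primitive x \<Longrightarrow> primitive y \<Longrightarrow> primitive (x + y)" "primitive x \<Longrightarrow> primitive y \<Longrightarrow> primitive (x - y)"
  by (simp_all add: primitive_def completion_scaleC completion_minus completion_add completion_diff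
      hat_hom_comult hat_hom_inl hat_hom_inr alg_homD[OF alg_hom_hat_map[OF alg_hom_counit]] scaleC_add_right)

lemma ord_ge_gen:
  "k \<in> {1..CARD('m)} \<Longrightarrow> l \<in> {1..CARD('m)} \<Longrightarrow> n \<le> so_weight CARD('m) k - so_weight CARD('m) l
    \<Longrightarrow> ord_ge (gen k l :: 'm::{finite,linorder} so uea fls) n"
  unfolding gen_def by (rule ord_ge_hat[OF homog_uea_gen[OF so_A_homog]])

section \<open>A link of the chain\<close>

text \<open>
  The columns strictly between \<open>b\<close> and its mirror image \<open>r b\<close> form the index set \<open>S\<close>.  Written as
  \<open>A j = - A\<^sub>a\<^sub>,\<^sub>r\<^sub>(\<^sub>j\<^sub>)\<close> and \<open>B j = - A\<^sub>b\<^sub>,\<^sub>j\<close>, the root vectors \<open>E\<^sub>a\<^sub>\<plusminus>\<^sub>l\<close>, \<open>E\<^sub>a\<close> and \<open>E\<^sub>b\<^sub>\<plusminus>\<^sub>l\<close>, \<open>E\<^sub>b\<close> are treated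
  alike, and even and odd \<open>M\<close> need no distinction before the comparison with the given sums.
\<close>

locale so_link =
  fixes k M :: nat and M_type :: "'m::{finite,linorder} itself"
  assumes k: "4 * (k + 1) \<le> M" and M: "M = CARD('m)"
begin

definition "a = 2 * k + 1"
definition "b = 2 * k + 2"
definition "S = {2 * k + 3..M - 2 * k - 2}"
definition "r j = M + 1 - j"
definition "mid = M div 2 + 1"

lemmas bracket = gen_bracket[where 'm = 'm, folded M, folded r_def]
lemmas bracket_diag = gen_bracket_diag[where 'm = 'm, folded M, folded r_def]
lemmas flip = gen_flip[where 'm = 'm, folded M, folded r_def]
lemmas zero = gen_zero[where 'm = 'm, folded M, folded r_def]
lemmas ord_gen = ord_ge_gen[where 'm = 'm, folded M]

definition Hp :: "'m so uea fls" where "Hp = (1/2) *\<^sub>C gen a a + (1/2) *\<^sub>C gen b b"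
definition Hm :: "'m so uea fls" where "Hm = (1/2) *\<^sub>C gen a a - (1/2) *\<^sub>C gen b b"
definition E :: "'m so uea fls" where "E = - gen a (r b)"
definition D :: "'m so uea fls" where "D = - gen a b"
definition A :: "nat \<Rightarrow> 'm so uea fls" where "A j = - gen a (r j)"
definition B :: "nat \<Rightarrow> 'm so uea fls" where "B j = - gen b j"

lemma rng: "a \<in> {1..M}" "b \<in> {1..M}" "j \<in> S \<Longrightarrow> j \<in> {1..M}" "j \<in> {1..M} \<Longrightarrow> r j \<in> {1..M}"
  using k by (auto simp: S_def a_def b_def r_def)

lemma rng_r: "r a \<in> {1..M}" "r b \<in> {1..M}" "j \<in> S \<Longrightarrow> r j \<in> {1..M}"
  by (intro rng; assumption)+

lemma r_S: "j \<in> S \<Longrightarrow> r j \<in> S"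
  using k by (auto simp: S_def r_def)

lemma r_eq: "i \<in> {1..M} \<Longrightarrow> j \<in> {1..M} \<Longrightarrow> r i = r j \<longleftrightarrow> i = j"
  by (auto simp: r_def)

lemma ne: "a \<noteq> b" "a \<noteq> r a" "a \<noteq> r b" "b \<noteq> r a" "b \<noteq> r b" "r (r a) = a" "r (r b) = b" "r a \<noteq> r b"
  using k by (auto simp: a_def b_def r_def)

lemma neS:
  assumes "j \<in> S"
  shows "a \<noteq> j" "b \<noteq> j" "a \<noteq> r j" "b \<noteq> r j" "j \<noteq> r a" "j \<noteq> r b" "r (r j) = j"
  using assms k by (auto simp: a_def b_def r_def S_def)

lemmas rngs = rng(1-3) rng_r
lemmas distinct = ne ne(1-5,8)[symmetric] neS neS(1-6)[symmetric]

lemma H_gen: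
  assumes "c \<in> {1..M}" "i \<in> {1..M}" "j \<in> {1..M}"
  shows "((1/2) *\<^sub>C gen c c) * gen i j = gen i j * ((1/2) *\<^sub>C gen c c) + (1/2 * (of_bool (c = i) - of_bool (c = j)
    + of_bool (c = r j) - of_bool (c = r i))) *\<^sub>C (gen i j :: 'm so uea fls)"
  by (simp only: mult_scaleC_left mult_scaleC_right bracket_diag[OF assms] scaleC_add_right scaleC_scaleC)

lemma link_ord: "ord_ge Hp 0" "ord_ge Hm 0" "ord_ge E 1" "ord_ge D 1"
  "j \<in> S \<Longrightarrow> ord_ge (A j) 1" "j \<in> S \<Longrightarrow> ord_ge (B j) 1"
proof -
  show "ord_ge Hp 0" "ord_ge Hm 0"
    unfolding Hp_def Hm_def
    by (intro ord_ge_add ord_ge_diff ord_ge_scaleC ord_gen rngs; simp)+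
  have wa: "so_weight M a = int (M div 2) - 2 * int k" "so_weight M b = int (M div 2) - 2 * int k - 1"
    using k by (auto simp: so_weight_def a_def b_def)
  have wr: "so_weight M (r i) = - so_weight M i" if "i \<in> {1..M}" for i
    using that by (auto simp: so_weight_def r_def)
  have wS: "so_weight M j \<le> int (M div 2) - 2 * int k - 2" if "j \<in> S" for j
    using that k by (auto simp: so_weight_def S_def)
  have pos: "2 * int k + 2 \<le> int (M div 2)" using k by presburger
  show "ord_ge E 1" "ord_ge D 1"
    unfolding E_def D_def
    by (intro ord_ge_minus ord_gen rngs; use pos in \<open>simp add: wa wr[OF rng(2)]\<close>)+
  show "ord_ge (A j) 1" "ord_ge (B j) 1" if "j \<in> S"
    unfolding A_def B_def
    by (intro ord_ge_minus ord_gen rngs that; use wS[OF that] wS[OF r_S[OF that]] in \<open>simp add: wa\<close>)+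
qed

text \<open>
  The only possible contribution to the bracket is \<open>A\<^sub>c\<^sub>,\<^sub>r\<^sub>(\<^sub>c\<^sub>)\<close>, which vanishes.
\<close>

lemma gen_same_row:
  assumes "c \<in> {1..M}" "i \<in> {1..M}" "j \<in> {1..M}" "c \<noteq> i" "c \<noteq> j" "c \<noteq> r c"
  shows "gen c i * gen c j = gen c j * (gen c i :: 'm so uea fls)"
  using bracket[of c i c j] assms zero[of c] by auto

lemma link: "twist_link Hp Hm E D A B S r"
proof
  show "finite S" by (simp add: S_def)
  show "r i \<in> S" "r (r i) = i" if "i \<in> S" for i
    using that by (simp_all add: r_S neS)
  show "primitive Hp" "primitive Hm" "primitive E" "primitive D" "primitive (A i)" "primitive (B i)" for i
    unfolding Hp_def Hm_def E_def D_def A_def B_def by (intro primitive_lin primitive_gen)+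
  show "ord_ge Hp 0" "ord_ge Hm 0" "ord_ge E 1" "ord_ge D 1"
    "i \<in> S \<Longrightarrow> ord_ge (A i) 1" "i \<in> S \<Longrightarrow> ord_ge (B i) 1" for i by (fact link_ord)+
  let ?ha = "(1/2) *\<^sub>C gen a a :: 'm so uea fls" and ?hb = "(1/2) *\<^sub>C gen b b :: 'm so uea fls"
  have half: "(1/2) *\<^sub>C x + (1/2) *\<^sub>C x = x" for x :: "'m so uea fls"
    by (simp add: scaleC_add_left[symmetric] scaleC_one)
  note H = H_gen[OF rng(1)] H_gen[OF rng(2)]
  have hE: "?ha * E = E * ?ha + (1/2) *\<^sub>C E" "?hb * E = E * ?hb + (1/2) *\<^sub>C E"
    using H(1)[OF rng(1) rng_r(2)] H(2)[OF rng(1) rng_r(2)] by (simp_all add: E_def distinct)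
  have hD: "?ha * D = D * ?ha + (1/2) *\<^sub>C D" "?hb * D = D * ?hb - (1/2) *\<^sub>C D"
    using H(1)[OF rng(1) rng(2)] H(2)[OF rng(1) rng(2)] by (simp_all add: D_def distinct)
  have haa: "?ha * ?hb = ?hb * ?ha"
    using H(1)[OF rng(2) rng(2)] by (simp add: distinct scaleC_simps)
  show "Hp * E = E * Hp + E" "E * Hm = Hm * E"
    using half[of E] by (simp_all add: Hp_def Hm_def distrib_left distrib_right left_diff_distrib right_diff_distrib
        hE add_ac del: mult_scaleC_left mult_scaleC_right)
  show "Hp * D = D * Hp" "Hm * D = D * Hm + D"
    using half[of D] by (simp_all add: Hp_def Hm_def distrib_left distrib_right left_diff_distrib right_diff_distrib
        hD add_ac)
  show "Hp * Hm = Hm * Hp"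
    unfolding Hp_def Hm_def by (simp only: distrib_left distrib_right left_diff_distrib right_diff_distrib haa) simp
  show "E * D = D * E"
    unfolding E_def D_def using gen_same_row[OF rng(1) rng_r(2) rng(2)] by (simp add: distinct)
  fix i assume i: "i \<in> S"
  have hA: "?ha * A i = A i * ?ha + (1/2) *\<^sub>C A i" "?hb * A i = A i * ?hb"
    using H(1)[OF rng(1) rng_r(3)[OF i]] H(2)[OF rng(1) rng_r(3)[OF i]] by (simp_all add: A_def distinct i)
  have hB: "?ha * B i = B i * ?ha" "?hb * B i = B i * ?hb + (1/2) *\<^sub>C B i"
    using H(1)[OF rng(2) rng(3)[OF i]] H(2)[OF rng(2) rng(3)[OF i]] by (simp_all add: B_def distinct i)
  show "Hp * A i = A i * Hp + (1/2) *\<^sub>C A i" "Hm * A i = A i * Hm + (1/2) *\<^sub>C A i"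
    "Hp * B i = B i * Hp + (1/2) *\<^sub>C B i" "Hm * B i = B i * Hm - (1/2) *\<^sub>C B i"
    by (simp_all add: Hp_def Hm_def distrib_left distrib_right left_diff_distrib right_diff_distrib hA hB)
  show "E * A i = A i * E" "D * A i = A i * D"
    unfolding E_def D_def A_def
    using gen_same_row[OF rng(1) rng_r(2) rng_r(3)[OF i]] gen_same_row[OF rng(1) rng(2) rng_r(3)[OF i]]
    by (simp_all add: distinct i)
  show "E * B i = B i * E"
    using bracket[OF rng(1) rng_r(2) rng(2) rng(3)[OF i]] r_eq[OF rng(2) rng(3)[OF i]]
    by (simp add: E_def B_def distinct i)
  show "D * B i = B i * D - A (r i)"
    using bracket[OF rng(1) rng(2) rng(2) rng(3)[OF i]] by (simp add: D_def B_def A_def distinct i)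
  fix j assume j: "j \<in> S"
  show "A i * A j = A j * A i"
    unfolding A_def using gen_same_row[OF rng(1) rng_r(3)[OF i] rng_r(3)[OF j]] by (simp add: distinct i j)
  show "B i * B j = B j * B i"
    unfolding B_def using gen_same_row[OF rng(2) rng(3)[OF i] rng(3)[OF j]] by (simp add: distinct i j)
  show "A i * B j = B j * A i + (if i = j then E else 0)"
    using bracket[OF rng(1) rng_r(3)[OF i] rng(2) rng(3)[OF j]]
      r_eq[OF rng(3)[OF i] rng(3)[OF j]]
    by (auto simp: A_def B_def E_def distinct i j)
qed

sublocale L: twist_link Hp Hm E D A B S r by (rule link)

subsection \<open>Identification with the factors of the chain\<close>

text \<open>
  The form in which the sums over \<open>l\<close> are given: \<open>S\<close> consists of a lower half, its mirror image and,
  for odd \<open>M\<close>, a fixed point of \<open>r\<close>.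
\<close>

lemma symmetric_sum:
  fixes f :: "nat \<Rightarrow> 'a::ab_group_add"
  shows "(\<Sum>j\<in>S. f j) = (if odd M then f mid else 0) + (\<Sum>l = 2 * k + 3..M div 2. f l + f (r l))"
proof -
  define N where "N = M div 2"
  let ?mid = "if odd M then {N + 1} else {}" and ?low = "{2 * k + 3..N}" and ?high = "{M + 1 - N..M - 2 * k - 2}"
  have N: "odd M \<Longrightarrow> M = 2 * N + 1" "even M \<Longrightarrow> M = 2 * N"
    by (auto simp: N_def elim: oddE)
  have S: "S = ?mid \<union> (?low \<union> ?high)"
    unfolding S_def using k N by (cases "odd M") auto
  have disj: "?mid \<inter> (?low \<union> ?high) = {}" "?low \<inter> ?high = {}"
  proof -
    have "2 * N \<le> M" "odd M \<Longrightarrow> 2 * N + 1 \<le> M"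
      by (auto simp: N_def elim: oddE)
    then show "?mid \<inter> (?low \<union> ?high) = {}" "?low \<inter> ?high = {}"
      by auto
  qed
  have "(\<Sum>j\<in>S. f j) = (\<Sum>j\<in>?mid. f j) + ((\<Sum>j\<in>?low. f j) + (\<Sum>j\<in>?high. f j))"
  proof -
    have "(\<Sum>j\<in>S. f j) = (\<Sum>j\<in>?mid. f j) + (\<Sum>j\<in>?low \<union> ?high. f j)"
      unfolding S by (rule sum.union_disjoint[OF _ _ disj(1)]) auto
    also have "(\<Sum>j\<in>?low \<union> ?high. f j) = (\<Sum>j\<in>?low. f j) + (\<Sum>j\<in>?high. f j)"
      by (rule sum.union_disjoint[OF _ _ disj(2)]) auto
    finally show ?thesis .
  qed
  also have "(\<Sum>j\<in>?high. f j) = (\<Sum>l\<in>?low. f (r l))"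
    by (rule sum.reindex_bij_witness[where i = r and j = r]) (use k in \<open>auto simp: r_def N_def\<close>)
  finally show ?thesis by (simp add: sum.distrib N_def mid_def)
qed

lemma low_S: "l \<in> {2 * k + 3..M div 2} \<Longrightarrow> l \<in> S"
  using k by (auto simp: S_def)

lemma mid_r: "odd M \<Longrightarrow> r mid = mid"
  by (auto simp: r_def mid_def elim: oddE)

lemma hat_E: "hat (E_plus i l) = (- gen i (r l) :: 'm so uea fls)" "hat (E_minus i l) = (- gen i l :: 'm so uea fls)"
  "hat (E_short i) = (- gen i mid :: 'm so uea fls)"
  unfolding E_plus_def E_minus_def E_short_def gen_def M[symmetric] r_def mid_def by (simp_all only: uea_gen_simps hat_simps)

lemma hat_AB:
  "hat (E_plus a b) = E" "hat (E_minus a b) = D" "hat (E_plus a l) = A l" "hat (E_minus b l) = B l"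
  "l \<in> S \<Longrightarrow> hat (E_minus a l) = A (r l)" "hat (E_plus b l) = B (r l)"
  by (simp_all only: hat_E A_def B_def D_def E_def neS)

lemma hat_AB_mid:
  assumes "odd M"
  shows "hat (E_short a) = A mid" "hat (E_short b) = B mid"
  by (simp_all only: hat_E A_def B_def mid_r[OF assms])

lemma hat_I_tens: "hat (I_tens k) = (\<Sum>j\<in>S. A j \<otimes>\<^sub>c B j)"
proof -
  have AB: "hat (x \<otimes> y) = hat x \<otimes>\<^sub>c hat y" for x y :: "'m so uea"
    unfolding hat_tens_def
    by (subst tens_split)
      (simp only: hat_simps(3) hat_map_hat[OF alg_hom_tens_one(1) homog_tens_one(1)]
        hat_map_hat[OF alg_hom_tens_one(2) homog_tens_one(2)])
  have mid: "hat (if odd M then E_short a \<otimes> E_short b else 0) = (if odd M then A mid \<otimes>\<^sub>c B mid else 0)"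
    by (cases "odd M") (simp_all only: if_True if_False not_False_eq_True not_True_eq_False not_not AB hat_AB_mid hat_simps(6))
  have low: "hat (E_plus a l \<otimes> E_minus b l) = A l \<otimes>\<^sub>c B l" "hat (E_minus a l \<otimes> E_plus b l) = A (r l) \<otimes>\<^sub>c B (r l)"
    if "l \<in> {2 * k + 3..M div 2}" for l
    by (simp_all only: AB hat_AB low_S[OF that])
  show ?thesis
    unfolding I_tens_def Let_def symmetric_sum M[symmetric] a_def[symmetric] b_def[symmetric]
      hat_simps(4) alg_hom_sum[OF alg_hom_hat] mid
    by (intro arg_cong2[where f = "(+)"] refl sum.cong low)
qed

lemma hat_G: "hat (G_elt k) = L.G"
proof -
  let ?f = "\<lambda>j. A j * A (r j)"
  have l: "(1/2) *\<^sub>C (?f l + ?f (r l)) = hat (E_plus a l) * hat (E_minus a l :: 'm so uea)"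
    if "l \<in> {2 * k + 3..M div 2}" for l
  proof -
    have lS: "l \<in> S" "r l \<in> S" using low_S[OF that] r_S by auto
    have "?f (r l) = ?f l" using L.AA[OF lS(2,1)] by (simp add: neS lS)
    then show ?thesis
      by (simp add: hat_AB lS scaleC_add_right scaleC_add_left[symmetric] scaleC_one)
  qed
  have "L.Q = (if odd M then (1/2) *\<^sub>C ?f mid else 0)
    + (\<Sum>l = 2 * k + 3..M div 2. (1/2) *\<^sub>C (?f l + ?f (r l)))"
    unfolding L.Q_def symmetric_sum scaleC_add_right cvec.scale_sum_right by simp
  also have "(\<Sum>l = 2 * k + 3..M div 2. (1/2) *\<^sub>C (?f l + ?f (r l)))
    = (\<Sum>l = 2 * k + 3..M div 2. hat (E_plus a l) * hat (E_minus a l))"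
    by (intro sum.cong refl l)
  also have "(if odd M then (1/2) *\<^sub>C ?f mid else 0) = hat (if odd M then (1/2) *\<^sub>C (E_short a)\<^sup>2 else 0)"
  proof (cases "odd M")
    case True
    then show ?thesis by (simp only: if_True not_False_eq_True hat_simps(3,7) power2_eq_square hat_AB_mid[OF True] mid_r[OF True])
  qed (simp only: if_False hat_simps(6))
  finally have "hat (I_one k) = L.Q"
    unfolding I_one_def Let_def M[symmetric] a_def[symmetric] by (simp only: hat_simps)
  then show ?thesis
    unfolding G_elt_def L.G_def a_def[symmetric] b_def[symmetric] by (simp only: hat_simps hat_AB(2))
qed

lemma sigma: "sigma_plus k = L.s" "sigma_G k = hat_ln1p L.G"
  unfolding sigma_plus_def L.s_def sigma_G_def hat_G a_def[symmetric] b_def[symmetric] hat_AB(1) by (rule refl)+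

lemma Phi_eq: "Phi k = L.Phi_link"
proof -
  have "hat (H_elt i) = ((1/2) *\<^sub>C gen i i :: 'm so uea fls)" if "i \<in> {1..M}" for i
    unfolding H_elt_def so_H_eq[OF that[unfolded M]] gen_def by (simp only: uea_gen_simps hat_simps)
  then have H: "hat (H_elt a - H_elt b) = Hm" "hat (H_elt a + H_elt b) = Hp"
    by (simp_all only: Hp_def Hm_def hat_simps rng)
  have X: "hat (I_tens k) * (1 \<otimes>\<^sub>c hat_exp ((- 1 / 2) *\<^sub>C sigma_plus k)) = L.X"
    unfolding hat_I_tens sigma L.t'_def[symmetric] L.X_def L.b_def sum_distrib_right
    by (simp add: hat_tens_mult)
  show ?thesis
    unfolding Phi_def Let_def X a_def[symmetric] b_def[symmetric] unfolding H sigma L.Phi_link_def L.J1_def L.J2_def ..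
qed

subsection \<open>The subalgebra fixed by a link\<close>

text \<open>
  Infinitesimal invariance: \<open>ad\<close> of \<open>gen c d\<close> sends \<open>A d\<close> to \<open>A c\<close> and \<open>A (r c)\<close> to \<open>- A (r d)\<close>, and acts
  dually on the \<open>B\<close>'s, so the contributions to \<open>\<Sum> A j \<otimes> B j\<close> and to \<open>\<Sum> A j A (r j)\<close> cancel in
  pairs.
\<close>

lemma Phi_commute_gen:
  assumes cd: "c \<in> S" "d \<in> S"
  shows "Phi k * hat_map comult (gen c d) = hat_map comult (gen c d) * (Phi k :: 'm so uea2 fls)"
  unfolding Phi_eq
proof (rule L.Phi_link_commute)
  let ?x = "gen c d :: 'm so uea fls"
  note rcd = rng(3)[OF cd(1)] rng(3)[OF cd(2)]
  have rS: "r c \<in> S" "r d \<in> S" "r (r c) = c" "r (r d) = d" using r_S neS cd by auto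
  note di = distinct cd rS
  show "hat_map comult ?x = inl ?x + inr ?x" by (simp add: primitive_gen[unfolded primitive_def])
  have "((1/2) *\<^sub>C gen a a) * ?x = ?x * ((1/2) *\<^sub>C gen a a)" "((1/2) *\<^sub>C gen b b) * ?x = ?x * ((1/2) *\<^sub>C gen b b)"
    using H_gen[OF rng(1) rcd] H_gen[OF rng(2) rcd] by (simp_all add: di)
  then show "Hp * ?x = ?x * Hp" "Hm * ?x = ?x * Hm"
    by (simp_all add: Hp_def Hm_def distrib_left distrib_right left_diff_distrib right_diff_distrib)
  show "E * ?x = ?x * E" "D * ?x = ?x * D"
    using bracket[OF rng(1) rng_r(2) rcd] bracket[OF rng(1) rng(2) rcd]
      r_eq[OF rng(2) rcd(2)] by (simp_all add: E_def D_def di)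
  have flip: "gen c (r a) = - (gen a (r c) :: 'm so uea fls)" "gen c (r b) = - (gen b (r c) :: 'm so uea fls)"
    using flip[OF rng(1) rng(4)[OF rcd(1)]] flip[OF rng(2) rng(4)[OF rcd(1)]] rS(3) by simp_all
  have xA: "?x * A j = A j * ?x + ((if j = d then A c else 0) - (if j = r c then A (r d) else 0))" if j: "j \<in> S" for j
  proof -
    have "(c = r j) = (j = r c)" "(d = j) = (j = d)" using neS(7)[OF j] rS(3) by auto
    then show ?thesis
      using bracket[OF rcd rng(1) rng_r(3)[OF j]] j
      by (simp add: A_def di flip)
  qed
  have xB: "?x * B j = B j * ?x + ((if j = r d then B (r c) else 0) - (if j = c then B d else 0))" if j: "j \<in> S" for j
  proof -
    have "(d = r j) = (j = r d)" "(c = j) = (j = c)" using neS(7)[OF j] rS(4) by auto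
    then show ?thesis
      using bracket[OF rcd rng(2) rng(3)[OF j]] j
      by (simp add: B_def di flip)
  qed
  have "(inl ?x + inr ?x) * (A j \<otimes>\<^sub>c B j) = (A j \<otimes>\<^sub>c B j) * (inl ?x + inr ?x)
    + ((if j = d then A c \<otimes>\<^sub>c B d else 0) - (if j = r c then A (r d) \<otimes>\<^sub>c B (r c) else 0)
      + ((if j = r d then A (r d) \<otimes>\<^sub>c B (r c) else 0) - (if j = c then A c \<otimes>\<^sub>c B d else 0)))" if "j \<in> S" for j
    by (simp add: inl_inr_tens distrib_left distrib_right hat_tens_mult xA[OF that] xB[OF that] hat_tens_simps)
  then have "(inl ?x + inr ?x) * (\<Sum>j\<in>S. A j \<otimes>\<^sub>c B j) = (\<Sum>j\<in>S. A j \<otimes>\<^sub>c B j) * (inl ?x + inr ?x)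
    + (A c \<otimes>\<^sub>c B d - A (r d) \<otimes>\<^sub>c B (r c) + (A (r d) \<otimes>\<^sub>c B (r c) - A c \<otimes>\<^sub>c B d))"
    unfolding sum_distrib_left sum_distrib_right using L.fin cd rS
    by (simp add: sum.distrib sum_subtractf)
  then show "(\<Sum>j\<in>S. A j \<otimes>\<^sub>c B j) * (inl ?x + inr ?x) = (inl ?x + inr ?x) * (\<Sum>j\<in>S. A j \<otimes>\<^sub>c B j)"
    by simp
  have "?x * (A j * A (r j)) = A j * A (r j) * ?x
    + ((if j = d then A c * A (r d) else 0) - (if j = r c then A (r d) * A c else 0)
      + ((if j = r d then A (r d) * A c else 0) - (if j = c then A c * A (r d) else 0)))" if j: "j \<in> S" for j
  proof -
    have eq: "(r j = d) = (j = r d)" "(r j = r c) = (j = c)" using neS(7)[OF j] rS by metis+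
    have "?x * (A j * A (r j)) = (?x * A j) * A (r j)" by (simp only: mult.assoc)
    also have "\<dots> = A j * (?x * A (r j)) + ((if j = d then A c else 0) - (if j = r c then A (r d) else 0)) * A (r j)"
      unfolding xA[OF j] by (simp only: distrib_right mult.assoc)
    also have "\<dots> = A j * A (r j) * ?x + (A j * ((if j = r d then A c else 0) - (if j = c then A (r d) else 0))
      + ((if j = d then A c else 0) - (if j = r c then A (r d) else 0)) * A (r j))"
      unfolding xA[OF r_S[OF j]] eq by (simp only: distrib_left mult.assoc add.assoc)
    also have "A j * ((if j = r d then A c else 0) - (if j = c then A (r d) else 0))
      = (if j = r d then A (r d) * A c else 0) - (if j = c then A c * A (r d) else 0)"
      by (simp add: right_diff_distrib)
    also have "((if j = d then A c else 0) - (if j = r c then A (r d) else 0)) * A (r j)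
      = (if j = d then A c * A (r d) else 0) - (if j = r c then A (r d) * A c else 0)"
      by (simp add: left_diff_distrib rS)
    finally show ?thesis by (simp only: add.commute)
  qed
  then have "?x * (\<Sum>j\<in>S. A j * A (r j)) = (\<Sum>j\<in>S. A j * A (r j)) * ?x
    + (A c * A (r d) - A (r d) * A c + (A (r d) * A c - A c * A (r d)))"
    unfolding sum_distrib_left sum_distrib_right using L.fin cd rS
    by (simp add: sum.distrib sum_subtractf)
  then show "L.Q * ?x = ?x * L.Q" by (simp add: L.Q_def scaleC_simps)
qed

end

section \<open>The full chain\<close>

lemma full_chain_Suc: "full_chain (Suc p) = Phi (Suc p) * full_chain p"
  by (simp add: full_chain_def)

text \<open>
  The last clause is what the induction needs: the chain commutes with the coproducts of the
  orthogonal algebra on the remaining indices, from which the next link is built.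
\<close>

lemma full_chain_twist:
  fixes F :: "'m::{finite,linorder} so uea2 fls"
  assumes M: "M = CARD('m)" and "4 * (p + 1) \<le> M" and "F = full_chain p"
  shows "hat_unit F \<and> cocycle F \<and> hat_map counit_id F = 1 \<and> hat_map id_counit F = 1
    \<and> (\<forall>c d. c \<in> {2 * p + 3..M - 2 * p - 2} \<longrightarrow> d \<in> {2 * p + 3..M - 2 * p - 2} \<longrightarrow>
        F * hat_map comult (gen c d) = hat_map comult (gen c d) * F)"
  using assms(2) unfolding assms(3)
proof (induction p)
  case 0
  interpret so_link 0 M "TYPE('m)" by standard (use 0 M in simp_all)
  have "full_chain 0 = (Phi 0 :: 'm so uea2 fls)" by (simp add: full_chain_def)
  then show ?case
    using L.Phi_link L.Phi_link_counit Phi_commute_gen by (simp add: Phi_eq S_def)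
next
  case (Suc p)
  let ?F = "full_chain p :: 'm so uea2 fls"
  interpret so_link "Suc p" M "TYPE('m)" by standard (use Suc M in simp_all)
  have IH: "hat_unit ?F" "cocycle ?F" "hat_map counit_id ?F = 1" "hat_map id_counit ?F = 1"
    "c \<in> {2 * p + 3..M - 2 * p - 2} \<Longrightarrow> d \<in> {2 * p + 3..M - 2 * p - 2} \<Longrightarrow>
        ?F * hat_map comult (gen c d) = hat_map comult (gen c d) * ?F" for c d
    using Suc by auto
  have "?F * hat_map comult x = hat_map comult x * ?F" if "x \<in> {Hp, Hm, E, D} \<union> A ` S \<union> B ` S" for x
  proof -
    \<comment> \<open>The ingredients of the next link are linear combinations of generators fixed by the chain so far.\<close>
    define C where "C = {x. ?F * hat_map comult x = hat_map comult x * ?F}"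
    have lin: "x + y \<in> C" "x - y \<in> C" if "x \<in> C" "y \<in> C" for x y
      using that by (simp_all only: C_def mem_Collect_eq hat_hom_comult distrib_left distrib_right
          left_diff_distrib right_diff_distrib)
    have scale: "c *\<^sub>C x \<in> C" "- x \<in> C" if "x \<in> C" for x c
      using that by (simp_all only: C_def mem_Collect_eq hat_hom_comult scaleC_simps
          mult_minus_left mult_minus_right)
    have g: "gen c d \<in> C" if "c \<in> {2 * p + 3..M - 2 * p - 2}" "d \<in> {2 * p + 3..M - 2 * p - 2}" for c d
      using IH(5)[OF that] by (simp only: C_def mem_Collect_eq)
    have gens: "gen a a \<in> C" "gen b b \<in> C" "gen a (r b) \<in> C" "gen a b \<in> C"
      "j \<in> S \<Longrightarrow> gen a (r j) \<in> C" "j \<in> S \<Longrightarrow> gen b j \<in> C" for j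
      by (rule g; use k in \<open>auto simp: S_def a_def b_def r_def\<close>)+
    have "Hp \<in> C" "Hm \<in> C" "E \<in> C" "D \<in> C"
      unfolding Hp_def Hm_def E_def D_def by (intro lin scale gens)+
    moreover have "A j \<in> C" "B j \<in> C" if "j \<in> S" for j
      unfolding A_def B_def by (intro scale gens that)+
    ultimately have "x \<in> C" using that by blast
    then show ?thesis by (simp only: C_def mem_Collect_eq)
  qed
  then have "cocycle_over ?F (Phi (Suc p))"
    unfolding Phi_eq by (rule L.Phi_link_over[OF IH(1)])
  then have "cocycle (full_chain (Suc p) :: 'm so uea2 fls)"
    unfolding full_chain_Suc by (rule cocycle_compose[OF IH(1,2)])
  moreover have "hat_unit (full_chain (Suc p) :: 'm so uea2 fls)"
    unfolding full_chain_Suc Phi_eq by (rule hat_unit_mult[OF L.Phi_link(1) IH(1)])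
  moreover have "hat_map counit_id (full_chain (Suc p) :: 'm so uea2 fls) = 1"
    "hat_map id_counit (full_chain (Suc p) :: 'm so uea2 fls) = 1"
    unfolding full_chain_Suc Phi_eq
    by (simp_all add: alg_homD[OF alg_hom_hat_map[OF counit_id(1)]] alg_homD[OF alg_hom_hat_map[OF id_counit(1)]]
        L.Phi_link_counit IH(3,4))
  moreover have "full_chain (Suc p) * hat_map comult (gen c d) = hat_map comult (gen c d) * (full_chain (Suc p) :: 'm so uea2 fls)"
    if cd: "c \<in> {2 * Suc p + 3..M - 2 * Suc p - 2}" "d \<in> {2 * Suc p + 3..M - 2 * Suc p - 2}" for c d
  proof -
    have "?F * hat_map comult (gen c d) = hat_map comult (gen c d) * ?F"
      by (rule IH(5)) (use cd in auto)
    moreover have "Phi (Suc p) * hat_map comult (gen c d) = hat_map comult (gen c d) * (Phi (Suc p) :: 'm so uea2 fls)"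
      by (rule Phi_commute_gen) (use cd in \<open>simp_all add: S_def\<close>)
    ultimately show ?thesis
      unfolding full_chain_Suc by (intro commute_mult[symmetric]) simp_all
  qed
  ultimately show ?case by blast
qed

theorem mainTheorem1:
  fixes p :: nat and F :: "'m::{finite,linorder} so uea2 fls"
  assumes "4 \<le> CARD('m)"
    and "4 * (p + 1) \<le> CARD('m)"
    and "F = full_chain p"
  shows "twisting_element F \<and> hat_invertible F
    \<and> triangular_R_matrix F (hat_map tensor_swap F * hat_inverse F)"
proof -
  have F: "hat_unit F" "cocycle F" "hat_map counit_id F = 1" "hat_map id_counit F = 1"
    using full_chain_twist[OF refl assms(2,3)] by auto
  then show ?thesis
    using triangular_twist[OF hat_unitD(1)[OF F(1)] F(2)] hat_unitD[OF F(1)]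
    by (simp add: twisting_element_def cocycle_def)
qed

end
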